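(* Let $(\psi_n)$ be a sequence bounded in $L_\infty(T,m)$, where $(T,m)$ is a probability space, and suppose there is another sequence $(\varphi_n)$ bounded in $L_\infty(T,m)$ such that $\int\psi_n\overline{\varphi_k}\,dm=\delta_{n,k}$ for all $n,k$. Then $(\psi_n)$ is randomly Sidon if and only if it is $\otimes^4$-Sidon, and this holds if and only if it is $\otimes^k$-Sidon for some (equivalently, for all) $k\ge4$. In particular, this is valid when $(\psi_n)$ is a uniformly bounded orthonormal system.
   Context: Let $(g_n)$ be an i.i.d. sequence of standard complex Gaussian random variables on a probability space $(\Omega,\mathbb{P})$, with expectation $\mathbb{E}$. A sequence $(\psi_n)$ in $L_\infty(T,m)$ is randomly Sidon if there is a constant $C$ such that for every finitely supported scalar sequence $(a_n)$, $\sum|a_n|\le C\,\mathbb{E}\|\sum g_na_n\psi_n\|_{L_\infty(T,m)}$. For an integer $k\ge1$, $(\psi_n)$ is $\otimes^k$-Sidon if there is a constant $\alpha$ such that for every finitely supported scalar sequence $(a_n)$, $\sum|a_n|\le\alpha\|\sum a_n\,\psi_n(t_1)\psi_n(t_2)\cdots\psi_n(t_k)\|_{L_\infty(T^k,m^{k})}$, where $m^k$ is the product measure and $(t_1,\dots,t_k)\in T^k$. *)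

theory Defs
  imports "HOL-Probability.Probability"
begin

text \<open>
  Elements of \<open>L\<^sub>\<infinity>(T, m)\<close> are represented by measurable functions on a measure space \<open>m\<close> with
  \<open>space m = T\<close>. The norm takes values in \<open>ennreal\<close>; it is \<open>\<infinity>\<close> for functions that are not essentially
  bounded (and when the modulus is not measurable).
\<close>

definition Linf_norm :: "'a measure \<Rightarrow> ('a \<Rightarrow> complex) \<Rightarrow> ennreal" where
  "Linf_norm m f = esssup m (\<lambda>t. ennreal (cmod (f t)))"

definition bounded_in_Linf :: "'a measure \<Rightarrow> (nat \<Rightarrow> 'a \<Rightarrow> complex) \<Rightarrow> bool" where
  "bounded_in_Linf m \<psi> \<longleftrightarrow>
     (\<forall>n. \<psi> n \<in> borel_measurable m) \<and> (\<exists>B::real. \<forall>n. Linf_norm m (\<psi> n) \<le> ennreal B)"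

definition biorthogonal :: "'a measure \<Rightarrow> (nat \<Rightarrow> 'a \<Rightarrow> complex) \<Rightarrow> (nat \<Rightarrow> 'a \<Rightarrow> complex) \<Rightarrow> bool" where
  "biorthogonal m \<psi> \<phi> \<longleftrightarrow>
     (\<forall>n k. (\<integral>t. \<psi> n t * cnj (\<phi> k t) \<partial>m) = (if n = k then 1 else 0))"

definition orthonormal_system :: "'a measure \<Rightarrow> (nat \<Rightarrow> 'a \<Rightarrow> complex) \<Rightarrow> bool" where
  "orthonormal_system m \<psi> \<longleftrightarrow>
     (\<forall>n. \<psi> n \<in> borel_measurable m \<and> integrable m (\<lambda>t. (cmod (\<psi> n t))\<^sup>2)) \<and>
     (\<forall>n k. (\<integral>t. \<psi> n t * cnj (\<psi> k t) \<partial>m) = (if n = k then 1 else 0))"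

text \<open>
  Normalisation: a standard complex Gaussian \<open>g\<close> has \<open>\<bbbE>\<bar>g\<bar>\<^sup>2 = 1\<close>, i.e. its real and imaginary parts are
  independent real Gaussians of mean 0 and variance 1/2; its density with respect to Lebesgue measure
  on the complex plane is \<open>exp (- \<bar>z\<bar>\<^sup>2) / \<pi>\<close>.
\<close>

definition std_complex_gaussian :: "'w measure \<Rightarrow> ('w \<Rightarrow> complex) \<Rightarrow> bool" where
  "std_complex_gaussian P g \<longleftrightarrow>
     distributed P lborel g (\<lambda>z. ennreal (exp (- (cmod z)\<^sup>2) / pi))"

definition iid_std_complex_gaussian :: "'w measure \<Rightarrow> (nat \<Rightarrow> 'w \<Rightarrow> complex) \<Rightarrow> bool" where
  "iid_std_complex_gaussian P g \<longleftrightarrow>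
     prob_space P \<and> prob_space.indep_vars P (\<lambda>_. borel) g UNIV \<and>
     (\<forall>n. std_complex_gaussian P (g n))"

text \<open>
  In the next two definitions a negative constant would be truncated to 0 by \<open>ennreal\<close>, so allowing
  any real constant is the same as allowing a nonnegative one.
\<close>

definition randomly_Sidon ::
  "'w measure \<Rightarrow> (nat \<Rightarrow> 'w \<Rightarrow> complex) \<Rightarrow> 'a measure \<Rightarrow> (nat \<Rightarrow> 'a \<Rightarrow> complex) \<Rightarrow> bool" where
  "randomly_Sidon P g m \<psi> \<longleftrightarrow>
     (\<exists>C::real. \<forall>a::nat \<Rightarrow> complex. finite {n. a n \<noteq> 0} \<longrightarrow>
        ennreal (\<Sum>n | a n \<noteq> 0. cmod (a n))
          \<le> ennreal C * (\<integral>\<^sup>+\<omega>. Linf_norm m (\<lambda>t. \<Sum>n | a n \<noteq> 0. g n \<omega> * a n * \<psi> n t) \<partial>P))"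

text \<open>The point \<open>(t\<^sub>1, \<dots>, t\<^sub>k)\<close> of \<open>T\<^sup>k\<close> is the family \<open>t\<close> on the index set \<open>{..<k}\<close>.\<close>

definition tensor_Sidon :: "nat \<Rightarrow> 'a measure \<Rightarrow> (nat \<Rightarrow> 'a \<Rightarrow> complex) \<Rightarrow> bool" where
  "tensor_Sidon k m \<psi> \<longleftrightarrow>
     (\<exists>\<alpha>::real. \<forall>a::nat \<Rightarrow> complex. finite {n. a n \<noteq> 0} \<longrightarrow>
        ennreal (\<Sum>n | a n \<noteq> 0. cmod (a n))
          \<le> ennreal \<alpha> * Linf_norm (Pi\<^sub>M {..<k} (\<lambda>_. m))
                           (\<lambda>t. \<Sum>n | a n \<noteq> 0. a n * (\<Prod>i<k. \<psi> n (t i))))"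

end

theory Submission
  imports Defs
begin

text \<open>
  Both implications rest on averaging over signs, or over independent variables of mean zero, with
  constants that do not depend on the number of terms.

  \<^bold>\<open>From randomly Sidon to the fourth tensor power.\<close> For a realisation \<open>\<omega>\<close> of the Gaussian variables
  choose a functional of norm at most 1 on \<open>L\<^sub>\<infinity>(m)\<close> that recovers half of the norm of \<open>\<Sum> a\<^sub>n g\<^sub>n(\<omega>) \<psi>\<^sub>n\<close>,
  and let \<open>U\<^sub>n(\<omega>)\<close> be its value at \<open>\<psi>\<^sub>n\<close> (\<open>norming_functionals\<close>). The hypothesis says that
  \<open>\<Sum> a\<^sub>n E(g\<^sub>n U\<^sub>n)\<close> is of the order of \<open>\<Sum> \<bar>a\<^sub>n\<bar>\<close>. This survives when \<open>g\<^sub>n\<close> is replaced by a bounded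
  truncation \<open>c\<^sub>n\<close>: with \<open>W\<^sub>n = E(c\<^sub>n U\<^sub>n)\<close> one gets \<open>\<Sum> \<bar>a\<^sub>n\<bar> \<bar>W\<^sub>n\<bar> \<ge> \<kappa> \<Sum> \<bar>a\<^sub>n\<bar>\<close>, hence also
  \<open>\<Sum> \<bar>a\<^sub>n\<bar> \<bar>W\<^sub>n\<bar>\<^sup>2 \<ge> \<kappa>\<^sup>2 \<Sum> \<bar>a\<^sub>n\<bar>\<close> by the Cauchy--Schwarz inequality. It remains to bound the last sum
  by a multiple of the norm \<open>S\<close> of \<open>\<Sum> a\<^sub>n \<psi>\<^sub>n(p) \<psi>\<^sub>n(q) \<psi>\<^sub>n(u) \<psi>\<^sub>n(v)\<close>.

  Applying the functionals in the variables \<open>u\<close> and \<open>v\<close> gives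
  \<open>\<bar>\<Sum> a\<^sub>n \<psi>\<^sub>n(p) \<psi>\<^sub>n(q) U\<^sub>n(\<omega>) U\<^sub>n(\<omega>')\<bar> \<le> S\<close> for almost all \<open>p\<close>, \<open>q\<close> and all \<open>\<omega>\<close>, \<open>\<omega>'\<close>. Integrate this against a
  Riesz product \<open>\<Prod>\<^sub>k (1 + \<rho> \<xi>\<^sub>k(\<omega>) \<eta>\<^sub>k(\<omega>'))\<close>, where \<open>\<xi>\<^sub>k\<close> and \<open>\<eta>\<^sub>k\<close> are, up to normalisation, real or imaginary
  parts of \<open>cnj \<phi>\<^sub>k(p) c\<^sub>k\<close> and \<open>z\<^sub>k cnj \<phi>\<^sub>k(q) c\<^sub>k\<close> with \<open>\<bar>z\<^sub>k\<bar> \<le> 1\<close>. By independence the product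
  is the density of a probability measure, so the integral is at most \<open>S\<close>, and so is its part of degree zero in \<open>\<rho>\<close>. The parts of
  degree one for the four choices of real and imaginary parts combine to
  \<open>\<Sum>\<^sub>n\<^sub>,\<^sub>k a\<^sub>n z\<^sub>k \<psi>\<^sub>n(p) cnj \<phi>\<^sub>k(p) \<psi>\<^sub>n(q) cnj \<phi>\<^sub>k(q) E(c\<^sub>k U\<^sub>n)\<^sup>2\<close>, and the part of degree at least two is
  \<open>O(\<rho>\<^sup>2 \<Sum> \<bar>a\<^sub>n\<bar>)\<close> by Bessel's inequality for the orthogonal products of the \<open>\<xi>\<^sub>k\<close> (\<open>riesz_product_estimate\<close>).
  Integrating in \<open>p\<close> and \<open>q\<close> removes the terms with \<open>n \<noteq> k\<close> by biorthogonality, and the choice of the \<open>z\<^sub>k\<close>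
  turns what is left into \<open>\<Sum> \<bar>a\<^sub>n\<bar> \<bar>W\<^sub>n\<bar>\<^sup>2\<close>. A small \<open>\<rho>\<close> absorbs the error.

  \<^bold>\<open>From a tensor power to randomly Sidon.\<close> The tensor inequality with coefficients \<open>\<plusminus> g\<^sub>n(\<omega>) a\<^sub>n\<close>, adjusted
  by phases, bounds \<open>\<Sum> \<bar>g\<^sub>n(\<omega>)\<bar> \<bar>a\<^sub>n\<bar>\<close> by the norm of a signed sum of tensor products. On average over the signs
  such a norm is controlled by the norm of the signed sum of the \<open>\<psi>\<^sub>n\<close> themselves
  (\<open>Rademacher_tensor_contraction\<close>), because products are differences of squares and squaring is a
  Lipschitz map on a bounded set (\<open>Rademacher_comparison\<close>). The symmetry of the Gaussian variables removes the signs.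

  \<^bold>\<open>From one tensor power to the next.\<close> Freeze the new variable, apply the inequality for the lower power, and
  integrate; biorthogonality bounds the means of \<open>\<bar>\<psi>\<^sub>n\<bar>\<close> from below (\<open>tensor_Sidon_Suc\<close>).
\<close>

section \<open>Essential suprema and finite product measures\<close>

lemma Linf_norm_AE:
  assumes "f \<in> borel_measurable m" "Linf_norm m f \<le> ennreal c" "0 \<le> c"
  shows "AE t in m. cmod (f t) \<le> c"
proof -
  have "AE t in m. ennreal (cmod (f t)) \<le> Linf_norm m f"
    unfolding Linf_norm_def by (rule esssup_AE)
  then show ?thesis
  proof eventually_elim
    case (elim t)
    then have "ennreal (cmod (f t)) \<le> ennreal c" using assms(2) by (rule order_trans)
    then show ?case using assms(3) by (simp add: ennreal_le_iff)
  qed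
qed

lemma Linf_norm_le:
  assumes [measurable]: "f \<in> borel_measurable m" and "AE t in m. cmod (f t) \<le> c"
  shows "Linf_norm m f \<le> ennreal c"
  unfolding Linf_norm_def using assms(2) by (intro esssup_I) (auto intro!: ennreal_leI)

lemma bounded_in_LinfE:
  assumes "bounded_in_Linf m \<psi>"
  obtains B where "1 \<le> B" "\<And>n. \<psi> n \<in> borel_measurable m" "\<And>n. AE t in m. cmod (\<psi> n t) \<le> B"
proof -
  obtain B :: real where B: "\<And>n. \<psi> n \<in> borel_measurable m" "\<And>n. Linf_norm m (\<psi> n) \<le> ennreal B"
    using assms by (auto simp: bounded_in_Linf_def)
  have "Linf_norm m (\<psi> n) \<le> ennreal (max 1 B)" for n
    by (rule order_trans[OF B(2) ennreal_leI]) simp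
  then show ?thesis
    using Linf_norm_AE[OF B(1)] by (intro that[of "max 1 B"]) (auto simp: B(1))
qed

text \<open>A sublevel set of the norm is the set where the tail \<open>{t. c < \<bar>f x t\<bar>}\<close> is null, and measures of sections
  are measurable.\<close>

lemma borel_measurable_Linf_norm:
  assumes "sigma_finite_measure m" and f[measurable]: "case_prod f \<in> borel_measurable (N \<Otimes>\<^sub>M m)"
  shows "(\<lambda>x. Linf_norm m (f x)) \<in> borel_measurable N"
proof (rule borel_measurableI_le)
  interpret sigma_finite_measure m by fact
  fix c :: ennreal
  have "Linf_norm m (f x) \<le> c \<longleftrightarrow> emeasure m {t \<in> space m. c < ennreal (cmod (f x t))} = 0" if x: "x \<in> space N" for x
  proof -
    have [measurable]: "f x \<in> borel_measurable m" using measurable_compose_Pair1[OF x f] by simp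
    have "Linf_norm m (f x) \<le> c \<longleftrightarrow> (AE t in m. ennreal (cmod (f x t)) \<le> c)"
      unfolding Linf_norm_def using esssup_AE[where M=m and f="\<lambda>t. ennreal (cmod (f x t))"]
      by (auto intro!: esssup_I elim: eventually_mono intro: order_trans)
    also have "\<dots> \<longleftrightarrow> emeasure m {t \<in> space m. c < ennreal (cmod (f x t))} = 0"
      by (subst AE_iff_measurable[OF _ refl]) (auto simp: not_le)
    finally show ?thesis .
  qed
  then have "{x \<in> space N. Linf_norm m (f x) \<le> c}
     = {x \<in> space N. emeasure m {t \<in> space m. c < ennreal (cmod (f x t))} = 0}" by auto
  also have "\<dots> \<in> sets N" by measurable
  finally show "{x \<in> space N. Linf_norm m (f x) \<le> c} \<in> sets N" .
qed

text \<open>Fubini's theorem for null sets, with the new coordinate outermost: this order allows a statement about the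
  remaining coordinates to be applied for almost every value of the new one.\<close>

lemma AE_PiM_insert_rev:
  assumes "\<And>i. sigma_finite_measure (M i)" and I: "finite I" "i \<notin> I"
    and ae: "AE x in PiM (insert i I) M. Q x"
  shows "AE y in M i. AE x in PiM I M. Q (x(i := y))"
proof -
  interpret product_sigma_finite M using assms(1) by (simp add: product_sigma_finite_def)
  interpret I: sigma_finite_measure "PiM I M" using I(1) by (rule sigma_finite)
  obtain N where N: "{x \<in> space (PiM (insert i I) M). \<not> Q x} \<subseteq> N"
      "emeasure (PiM (insert i I) M) N = 0" and [measurable]: "N \<in> sets (PiM (insert i I) M)"
    using ae by (auto elim!: AE_E)
  have "0 = (\<integral>\<^sup>+ x. indicator N x \<partial>PiM (insert i I) M)" using N(2) by simp
  also have "\<dots> = (\<integral>\<^sup>+ y. (\<integral>\<^sup>+ x. indicator N (x(i := y)) \<partial>PiM I M) \<partial>M i)"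
    using I by (intro product_nn_integral_insert_rev) auto
  finally have *: "(\<integral>\<^sup>+ y. (\<integral>\<^sup>+ x. indicator N (x(i := y)) \<partial>PiM I M) \<partial>M i) = 0" by simp
  have meas2: "(\<lambda>(y, x). x(i := y)) \<in> measurable (M i \<Otimes>\<^sub>M PiM I M) (PiM (insert i I) M)"
    by measurable
  have [measurable]: "(\<lambda>z. indicator N ((snd z)(i := fst z)) :: ennreal) \<in> borel_measurable (M i \<Otimes>\<^sub>M PiM I M)"
    using measurable_compose[OF meas2 borel_measurable_indicator[of N]] by (simp add: case_prod_beta)
  have "AE y in M i. (\<integral>\<^sup>+ x. indicator N (x(i := y)) \<partial>PiM I M) = 0"
    using * by (subst (asm) nn_integral_0_iff_AE) (auto intro!: I.borel_measurable_nn_integral simp: case_prod_beta)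
  then have "AE y in M i. y \<in> space (M i) \<and> (\<integral>\<^sup>+ x. indicator N (x(i := y)) \<partial>PiM I M) = 0" by auto
  then show ?thesis
  proof eventually_elim
    case (elim y)
    have "(\<lambda>x. x(i := y)) \<in> measurable (PiM I M) (PiM (insert i I) M)"
      using elim by (intro measurable_fun_upd[where J=I]) auto
    note m1 = this
    have "AE x in PiM I M. indicator N (x(i := y)) = (0::ennreal)"
      using elim measurable_compose[OF m1 borel_measurable_indicator[of N]]
      by (subst (asm) nn_integral_0_iff_AE) auto
    then have "AE x in PiM I M. x \<in> space (PiM I M) \<and> indicator N (x(i := y)) = (0::ennreal)" by auto
    then show ?case
    proof eventually_elim
      case (elim x)
      then have "x(i := y) \<in> space (PiM (insert i I) M)" using measurable_space[OF m1] by auto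
      then show ?case using elim N(1) by (auto simp: indicator_def split: if_splits)
    qed
  qed
qed

lemma AE_PiM_lessThan_Suc:
  assumes "prob_space m" "AE x in PiM {..<Suc k} (\<lambda>_. m). Q x"
  shows "AE y in m. AE x in PiM {..<k} (\<lambda>_. m). Q (x(k := y))"
proof -
  interpret prob_space m by fact
  show ?thesis
    using AE_PiM_insert_rev[of "\<lambda>_. m" "{..<k}" k Q] assms(2) sigma_finite_measure_axioms
    unfolding lessThan_Suc by simp
qed

lemma tensor_Linf_norm_AE:
  fixes a :: "nat \<Rightarrow> complex"
  assumes m: "prob_space m" and [measurable]: "\<And>n. \<psi> n \<in> borel_measurable m"
    and le: "Linf_norm (PiM {..<k} (\<lambda>_. m)) (\<lambda>t. \<Sum>n\<in>J. a n * (\<Prod>i<k. \<psi> n (t i))) \<le> ennreal S" and S: "0 \<le> S"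
  shows "AE t in PiM {..<k} (\<lambda>_. m). cmod (\<Sum>n\<in>J. a n * (\<Prod>i<k. \<psi> n (t i))) \<le> S"
  by (rule Linf_norm_AE[OF _ le S]) measurable

text \<open>Coordinates are split off from the highest index downwards, so the last one becomes the outermost variable.\<close>

lemma AE_PiM_four:
  assumes m: "prob_space m" and ae: "AE t in PiM {..<4::nat} (\<lambda>_. m). Q (t 3) (t 2) (t 1) (t 0)"
  shows "AE s in m. AE t in m. AE u in m. AE v in m. Q s t u v"
proof -
  have 4: "{..<4::nat} = {..<Suc 3}" "{..<3::nat} = {..<Suc 2}" "{..<2::nat} = {..<Suc 1}" "{..<1::nat} = {..<Suc 0}"
    by (auto simp: numeral_eq_Suc)
  have a: "AE s in m. AE x in PiM {..<3::nat} (\<lambda>_. m). Q s (x 2) (x 1) (x 0)"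
    using AE_PiM_lessThan_Suc[OF m ae[unfolded 4(1)]] by simp
  have b: "AE t in m. AE x in PiM {..<2::nat} (\<lambda>_. m). Q s t (x 1) (x 0)"
    if "AE x in PiM {..<3::nat} (\<lambda>_. m). Q s (x 2) (x 1) (x 0)" for s
    using AE_PiM_lessThan_Suc[OF m that[unfolded 4(2)]] by simp
  have c: "AE u in m. AE x in PiM {..<1::nat} (\<lambda>_. m). Q s t u (x 0)"
    if "AE x in PiM {..<2::nat} (\<lambda>_. m). Q s t (x 1) (x 0)" for s t
    using AE_PiM_lessThan_Suc[OF m that[unfolded 4(3)]] by simp
  have d: "AE v in m. Q s t u v"
    if "AE x in PiM {..<1::nat} (\<lambda>_. m). Q s t u (x 0)" for s t u
  proof -
    have "AE v in m. AE x in PiM {..<0::nat} (\<lambda>_. m). Q s t u v"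
      using AE_PiM_lessThan_Suc[OF m that[unfolded 4(4)]] by simp
    moreover have "ae_filter (PiM {..<0::nat} (\<lambda>_. m)) \<noteq> bot"
      using m by (intro prob_space.ae_filter_bot prob_space_PiM)
    ultimately show ?thesis by (simp add: eventually_const)
  qed
  show ?thesis
    by (rule eventually_mono[OF a], drule b, erule eventually_mono, drule c, erule eventually_mono, erule d)
qed

section \<open>Riesz products of independent variables\<close>

text \<open>A factor with index in exactly one of the two sets occurs to the first power, and independence splits off
  its mean, which is zero. The case \<open>S' = {}\<close> says that nonempty products have mean zero.\<close>

lemma (in prob_space) expectation_prod_orthogonal:
  fixes p :: "'i \<Rightarrow> 'a \<Rightarrow> real"
  assumes fin: "finite I" and ind: "indep_vars (\<lambda>_. borel) p I"
    and bd: "\<And>k \<omega>. k \<in> I \<Longrightarrow> \<omega> \<in> space M \<Longrightarrow> \<bar>p k \<omega>\<bar> \<le> 1"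
    and mean: "\<And>k. k \<in> I \<Longrightarrow> expectation (p k) = 0"
    and S: "S \<subseteq> I" "S' \<subseteq> I" "S \<noteq> S'"
  shows "expectation (\<lambda>\<omega>. (\<Prod>k\<in>S. p k \<omega>) * (\<Prod>k\<in>S'. p k \<omega>)) = 0"
proof -
  define f where "f k x = (if k \<in> S then x else 1) * (if k \<in> S' then x else (1::real))" for k x
  have restr: "(\<Prod>k\<in>X. p k \<omega>) = (\<Prod>k\<in>I. if k \<in> X then p k \<omega> else 1)" if "X \<subseteq> I" for X \<omega>
    using prod.inter_restrict[OF fin, of "\<lambda>k. p k \<omega>" X] that by (simp add: Int_absorb1)
  have prod_f: "(\<Prod>k\<in>S. p k \<omega>) * (\<Prod>k\<in>S'. p k \<omega>) = (\<Prod>k\<in>I. f k (p k \<omega>))" for \<omega>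
    by (simp add: restr S f_def prod.distrib)
  have rv[measurable]: "p k \<in> borel_measurable M" if "k \<in> I" for k
    using ind that by (auto simp: indep_vars_def)
  have f_meas[measurable]: "f k \<in> borel_measurable borel" for k
    unfolding f_def by measurable
  have ind_f: "indep_vars (\<lambda>_. borel) (\<lambda>k \<omega>. f k (p k \<omega>)) I"
    by (rule indep_vars_compose2[OF ind]) simp
  have int_f: "integrable M (\<lambda>\<omega>. f k (p k \<omega>))" if "k \<in> I" for k
  proof (rule integrable_const_bound[where B=1])
    show "(\<lambda>\<omega>. f k (p k \<omega>)) \<in> borel_measurable M" using rv[OF that] by measurable
    show "AE \<omega> in M. norm (f k (p k \<omega>)) \<le> 1"
    proof (intro AE_I2)
      fix \<omega> assume "\<omega> \<in> space M"
      then have "\<bar>p k \<omega>\<bar> \<le> 1" by (rule bd[OF that])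
      then show "norm (f k (p k \<omega>)) \<le> 1"
        by (simp add: f_def abs_mult mult_le_one del: abs_mult_self_eq)
    qed
  qed
  obtain k where k: "k \<in> I" "k \<in> S \<longleftrightarrow> k \<notin> S'" using S by blast
  then have "f k x = x" for x by (auto simp: f_def)
  then have "expectation (\<lambda>\<omega>. f k (p k \<omega>)) = 0" using mean[OF k(1)] by simp
  then show ?thesis
    unfolding prod_f using indep_vars_lebesgue_integral[OF fin ind_f int_f] k(1) fin
    by (auto intro: prod_zero)
qed

lemma (in prob_space) bessel_inequality_real:
  fixes e :: "'i \<Rightarrow> 'a \<Rightarrow> real" and U :: "'a \<Rightarrow> real"
  assumes fin: "finite J"
    and e[measurable]: "\<And>j. j \<in> J \<Longrightarrow> e j \<in> borel_measurable M"
    and bd: "\<And>j \<omega>. j \<in> J \<Longrightarrow> \<omega> \<in> space M \<Longrightarrow> \<bar>e j \<omega>\<bar> \<le> 1"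
    and orth: "\<And>i j. i \<in> J \<Longrightarrow> j \<in> J \<Longrightarrow> i \<noteq> j \<Longrightarrow> expectation (\<lambda>\<omega>. e i \<omega> * e j \<omega>) = 0"
    and U[measurable]: "U \<in> borel_measurable M" and UB: "\<And>\<omega>. \<omega> \<in> space M \<Longrightarrow> \<bar>U \<omega>\<bar> \<le> B"
  shows "(\<Sum>j\<in>J. (expectation (\<lambda>\<omega>. e j \<omega> * U \<omega>))\<^sup>2) \<le> expectation (\<lambda>\<omega>. (U \<omega>)\<^sup>2)"
proof -
  define c where "c j = expectation (\<lambda>\<omega>. e j \<omega> * U \<omega>)" for j
  have B0: "0 \<le> B" using not_empty UB abs_ge_zero order_trans by blast
  have i_eU: "integrable M (\<lambda>\<omega>. e j \<omega> * U \<omega>)" if "j \<in> J" for j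
    using that bd UB B0 by (intro integrable_const_bound[where B="1*B"] AE_I2)
      (auto simp: abs_mult intro!: order_trans[OF mult_left_le_one_le])
  have i_ee: "integrable M (\<lambda>\<omega>. e i \<omega> * e j \<omega>)" if "i \<in> J" "j \<in> J" for i j
    using that bd by (intro integrable_const_bound[where B="1*1"] AE_I2)
      (auto simp: abs_mult intro!: mult_le_one)
  have i_UU: "integrable M (\<lambda>\<omega>. (U \<omega>)\<^sup>2)"
    using UB B0 by (intro integrable_const_bound[where B="B\<^sup>2"] AE_I2)
      (auto simp flip: abs_le_square_iff)
  have ee: "expectation (\<lambda>\<omega>. e i \<omega> * e j \<omega>) \<le> (if i = j then 1 else 0)" if "i \<in> J" "j \<in> J" for i j
  proof (cases "i = j")
    case True
    have "expectation (\<lambda>\<omega>. e i \<omega> * e i \<omega>) \<le> expectation (\<lambda>\<omega>. 1)"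
      using that bd i_ee[of i i]
      by (intro integral_mono) (auto simp flip: power2_eq_square simp: abs_square_le_1)
    then show ?thesis using True by (simp add: prob_space)
  qed (use that orth in auto)
  have expand: "(U \<omega> - (\<Sum>j\<in>J. c j * e j \<omega>))\<^sup>2
      = (U \<omega>)\<^sup>2 - 2 * (\<Sum>j\<in>J. c j * (e j \<omega> * U \<omega>)) + (\<Sum>i\<in>J. \<Sum>j\<in>J. c i * c j * (e i \<omega> * e j \<omega>))" for \<omega>
    by (simp add: power2_diff power2_eq_square sum_product sum_distrib_left sum_distrib_right algebra_simps)
  have "0 \<le> expectation (\<lambda>\<omega>. (U \<omega> - (\<Sum>j\<in>J. c j * e j \<omega>))\<^sup>2)" by simp
  also have "\<dots> = expectation (\<lambda>\<omega>. (U \<omega>)\<^sup>2) - 2 * (\<Sum>j\<in>J. c j * c j)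
      + (\<Sum>i\<in>J. \<Sum>j\<in>J. c i * c j * expectation (\<lambda>\<omega>. e i \<omega> * e j \<omega>))"
    unfolding expand using i_UU i_eU i_ee by (simp add: c_def Bochner_Integration.integral_sum)
  also have "(\<Sum>i\<in>J. \<Sum>j\<in>J. c i * c j * expectation (\<lambda>\<omega>. e i \<omega> * e j \<omega>)) \<le> (\<Sum>i\<in>J. c i * c i)"
  proof (rule sum_mono)
    fix i assume i: "i \<in> J"
    have "(\<Sum>j\<in>J. c i * c j * expectation (\<lambda>\<omega>. e i \<omega> * e j \<omega>))
      = c i * c i * expectation (\<lambda>\<omega>. e i \<omega> * e i \<omega>)"
      by (subst sum.remove[OF fin i], subst sum.neutral) (use orth i in auto)
    also have "\<dots> \<le> c i * c i * 1" using ee[OF i i] by (intro mult_left_mono) auto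
    finally show "(\<Sum>j\<in>J. c i * c j * expectation (\<lambda>\<omega>. e i \<omega> * e j \<omega>)) \<le> c i * c i" by simp
  qed
  finally show ?thesis by (simp add: c_def power2_eq_square)
qed

text \<open>The functions \<open>e j\<close> are real, so real and imaginary part of \<open>U\<close> can be treated separately.\<close>

lemma (in prob_space) bessel_inequality:
  fixes e :: "'i \<Rightarrow> 'a \<Rightarrow> real" and U :: "'a \<Rightarrow> complex"
  assumes fin: "finite J"
    and e[measurable]: "\<And>j. j \<in> J \<Longrightarrow> e j \<in> borel_measurable M"
    and bd: "\<And>j \<omega>. j \<in> J \<Longrightarrow> \<omega> \<in> space M \<Longrightarrow> \<bar>e j \<omega>\<bar> \<le> 1"
    and orth: "\<And>i j. i \<in> J \<Longrightarrow> j \<in> J \<Longrightarrow> i \<noteq> j \<Longrightarrow> expectation (\<lambda>\<omega>. e i \<omega> * e j \<omega>) = 0"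
    and U[measurable]: "U \<in> borel_measurable M" and UB: "\<And>\<omega>. \<omega> \<in> space M \<Longrightarrow> cmod (U \<omega>) \<le> B"
  shows "(\<Sum>j\<in>J. (cmod (expectation (\<lambda>\<omega>. e j \<omega> * U \<omega>)))\<^sup>2) \<le> B\<^sup>2"
proof -
  have B0: "0 \<le> B" using not_empty UB norm_ge_zero order_trans by blast
  have ReB: "\<bar>Re (U \<omega>)\<bar> \<le> B" "\<bar>Im (U \<omega>)\<bar> \<le> B" if "\<omega> \<in> space M" for \<omega>
    using UB[OF that] abs_Re_le_cmod[of "U \<omega>"] abs_Im_le_cmod[of "U \<omega>"] by auto
  have i_eU: "integrable M (\<lambda>\<omega>. complex_of_real (e j \<omega>) * U \<omega>)" if "j \<in> J" for j
    using that bd UB B0 by (intro integrable_const_bound[where B="1*B"] AE_I2)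
      (auto simp: norm_mult intro!: order_trans[OF mult_left_le_one_le])
  have Re: "Re (expectation (\<lambda>\<omega>. e j \<omega> * U \<omega>)) = expectation (\<lambda>\<omega>. e j \<omega> * Re (U \<omega>))" 
    and Im: "Im (expectation (\<lambda>\<omega>. e j \<omega> * U \<omega>)) = expectation (\<lambda>\<omega>. e j \<omega> * Im (U \<omega>))" if "j \<in> J" for j
    using integral_Re[OF i_eU[OF that]] integral_Im[OF i_eU[OF that]] by simp_all
  have iR: "integrable M (\<lambda>\<omega>. (Re (U \<omega>))\<^sup>2)" "integrable M (\<lambda>\<omega>. (Im (U \<omega>))\<^sup>2)"
    using ReB B0 by (auto intro!: integrable_const_bound[where B="B\<^sup>2"] AE_I2
      simp flip: abs_le_square_iff)
  have "(\<Sum>j\<in>J. (cmod (expectation (\<lambda>\<omega>. e j \<omega> * U \<omega>)))\<^sup>2)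
     = (\<Sum>j\<in>J. (expectation (\<lambda>\<omega>. e j \<omega> * Re (U \<omega>)))\<^sup>2) + (\<Sum>j\<in>J. (expectation (\<lambda>\<omega>. e j \<omega> * Im (U \<omega>)))\<^sup>2)"
    by (simp add: cmod_power2 Re Im sum.distrib)
  also have "\<dots> \<le> expectation (\<lambda>\<omega>. (Re (U \<omega>))\<^sup>2) + expectation (\<lambda>\<omega>. (Im (U \<omega>))\<^sup>2)"
    using ReB by (intro add_mono bessel_inequality_real[where B=B] assms) auto
  also have "\<dots> = expectation (\<lambda>\<omega>. (Re (U \<omega>))\<^sup>2 + (Im (U \<omega>))\<^sup>2)"
    using iR by simp
  also have "\<dots> \<le> expectation (\<lambda>\<omega>. B\<^sup>2)"
  proof (rule integral_mono)
    show "(Re (U \<omega>))\<^sup>2 + (Im (U \<omega>))\<^sup>2 \<le> B\<^sup>2" if "\<omega> \<in> space M" for \<omega>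
      using UB[OF that] by (simp add: power_mono flip: cmod_power2)
  qed (use iR in auto)
  finally show ?thesis by (simp add: prob_space)
qed

lemma norm_integral_le:
  fixes f :: "'a \<Rightarrow> 'b::{banach, second_countable_topology}"
  assumes "integrable M f" "integrable M g" "\<And>x. x \<in> space M \<Longrightarrow> norm (f x) \<le> g x"
  shows "norm (integral\<^sup>L M f) \<le> integral\<^sup>L M g"
  using assms by (intro order_trans[OF integral_norm_bound] integral_mono) auto

lemma integral_double_sum:
  fixes c :: "'n \<Rightarrow> 'i \<Rightarrow> complex"
  assumes "\<And>n X. X \<in> K \<Longrightarrow> n \<in> J \<Longrightarrow> integrable M (f n X)"
  shows "(\<integral>\<omega>. (\<Sum>n\<in>J. \<Sum>X\<in>K. c n X * f n X \<omega>) \<partial>M) = (\<Sum>n\<in>J. \<Sum>X\<in>K. c n X * (\<integral>\<omega>. f n X \<omega> \<partial>M))"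
proof -
  have "(\<integral>\<omega>. (\<Sum>n\<in>J. \<Sum>X\<in>K. c n X * f n X \<omega>) \<partial>M) = (\<Sum>n\<in>J. \<integral>\<omega>. (\<Sum>X\<in>K. c n X * f n X \<omega>) \<partial>M)"
    using assms by (intro Bochner_Integration.integral_sum Bochner_Integration.integrable_sum integrable_mult_right)
  also have "\<dots> = (\<Sum>n\<in>J. \<Sum>X\<in>K. c n X * (\<integral>\<omega>. f n X \<omega> \<partial>M))"
    using assms by (intro sum.cong refl) (simp add: Bochner_Integration.integral_sum)
  finally show ?thesis .
qed

text \<open>The kernel \<open>K \<omega> \<omega>' = (\<Prod>k\<in>I. 1 + \<rho> p\<^sub>k(\<omega>) q\<^sub>k(\<omega>'))\<close> is nonnegative and, by independence, has integral 1 in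
  \<open>\<omega>'\<close>. Hence the average of the form \<open>\<Sum> A\<^sub>n U\<^sub>n(\<omega>) U\<^sub>n(\<omega>')\<close> against \<open>K\<close> is at most \<open>S\<close>.
  Expanding \<open>K\<close> over the subsets \<open>X\<close> of \<open>I\<close> gives one term \<open>T n X\<close> of order \<open>\<rho> ^ card X\<close> for each of them: the empty set contributes
  at most \<open>S\<close>, the singletons give \<open>\<rho>\<close> times the quantity to be estimated, and Bessel's inequality bounds the
  sum over all larger sets by \<open>\<rho>\<^sup>2 B\<^sup>2\<close> for each \<open>n\<close>, whatever the size of \<open>I\<close>.\<close>

lemma (in prob_space) riesz_product_estimate:
  fixes p q :: "'i \<Rightarrow> 'a \<Rightarrow> real" and U :: "'n \<Rightarrow> 'a \<Rightarrow> complex" and A :: "'n \<Rightarrow> complex"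
  assumes fin: "finite I"
    and p: "indep_vars (\<lambda>_. borel) p I" "\<And>k \<omega>. k \<in> I \<Longrightarrow> \<omega> \<in> space M \<Longrightarrow> \<bar>p k \<omega>\<bar> \<le> 1"
       "\<And>k. k \<in> I \<Longrightarrow> expectation (p k) = 0"
    and q: "indep_vars (\<lambda>_. borel) q I" "\<And>k \<omega>. k \<in> I \<Longrightarrow> \<omega> \<in> space M \<Longrightarrow> \<bar>q k \<omega>\<bar> \<le> 1"
       "\<And>k. k \<in> I \<Longrightarrow> expectation (q k) = 0"
    and U[measurable]: "\<And>n. n \<in> J \<Longrightarrow> U n \<in> borel_measurable M"
    and UB: "\<And>n \<omega>. n \<in> J \<Longrightarrow> \<omega> \<in> space M \<Longrightarrow> cmod (U n \<omega>) \<le> B"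
    and G: "\<And>\<omega> \<omega>'. \<omega> \<in> space M \<Longrightarrow> \<omega>' \<in> space M \<Longrightarrow> cmod (\<Sum>n\<in>J. A n * (U n \<omega> * U n \<omega>')) \<le> S"
    and \<rho>: "0 < \<rho>" "\<rho> \<le> 1"
  shows "cmod (\<Sum>n\<in>J. A n * (\<Sum>k\<in>I. expectation (\<lambda>\<omega>. p k \<omega> * U n \<omega>) * expectation (\<lambda>\<omega>. q k \<omega> * U n \<omega>)))
     \<le> 2 * S / \<rho> + \<rho> * B\<^sup>2 * (\<Sum>n\<in>J. cmod (A n))"
proof -
  define P where "P X \<omega> = (\<Prod>k\<in>X. p k \<omega>)" for X \<omega>
  define Q where "Q X \<omega> = (\<Prod>k\<in>X. q k \<omega>)" for X \<omega>
  define \<alpha> where "\<alpha> n X = expectation (\<lambda>\<omega>. P X \<omega> * U n \<omega>)" for n X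
  define \<beta> where "\<beta> n X = expectation (\<lambda>\<omega>. Q X \<omega> * U n \<omega>)" for n X
  define K where "K \<omega> \<omega>' = (\<Prod>k\<in>I. \<rho> * (p k \<omega> * q k \<omega>') + 1)" for \<omega> \<omega>'
  define T where "T n X = complex_of_real (\<rho> ^ card X) * (\<alpha> n X * \<beta> n X)" for n X
  have rv[measurable]: "p k \<in> borel_measurable M" "q k \<in> borel_measurable M" if "k \<in> I" for k
    using p(1) q(1) that by (auto simp: indep_vars_def)
  have PQ_meas[measurable]: "P X \<in> borel_measurable M" "Q X \<in> borel_measurable M" if "X \<in> Pow I" for X
    using that unfolding P_def Q_def by (auto intro!: borel_measurable_prod)
  have PQ_bd: "\<bar>P X \<omega>\<bar> \<le> 1" "\<bar>Q X \<omega>\<bar> \<le> 1" if "X \<in> Pow I" "\<omega> \<in> space M" for X \<omega>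
    using that p(2) q(2) unfolding P_def Q_def abs_prod by (auto intro!: prod_le_1)
  have B0: "0 \<le> B" if "n \<in> J" for n using not_empty UB[OF that] norm_ge_zero order_trans by blast
  have i_PU: "integrable M (\<lambda>\<omega>. complex_of_real (P X \<omega>) * U n \<omega>)"
       "integrable M (\<lambda>\<omega>. complex_of_real (Q X \<omega>) * U n \<omega>)" if "X \<in> Pow I" "n \<in> J" for X n
    using that PQ_bd UB B0[OF that(2)] PQ_meas[OF that(1)]
    by (auto simp: norm_mult intro!: order_trans[OF mult_left_le_one_le] integrable_const_bound[where B="1*B"] AE_I2)
  have i_Q: "integrable M (Q X)" "integrable M (P X)" if "X \<in> Pow I" for X
    using that PQ_bd PQ_meas[OF that] by (auto intro!: integrable_const_bound[where B="1"] AE_I2)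
  have K_expand: "K \<omega> \<omega>' = (\<Sum>X\<in>Pow I. \<rho> ^ card X * (P X \<omega> * Q X \<omega>'))" for \<omega> \<omega>'
    unfolding K_def prod_add[OF fin] P_def Q_def by (simp add: prod.distrib)
  have K_nonneg: "0 \<le> K \<omega> \<omega>'" if "\<omega> \<in> space M" "\<omega>' \<in> space M" for \<omega> \<omega>'
    unfolding K_def
  proof (rule prod_nonneg)
    fix k assume "k \<in> I"
    then have "\<bar>\<rho> * (p k \<omega> * q k \<omega>')\<bar> \<le> 1 * (1 * 1)"
      unfolding abs_mult using \<rho> p(2) q(2) that by (intro mult_mono) auto
    then show "0 \<le> \<rho> * (p k \<omega> * q k \<omega>') + 1" by linarith
  qed
  have EQ: "expectation (Q X) = (if X = {} then 1 else 0)" if "X \<in> Pow I" for X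
    using expectation_prod_orthogonal[OF fin q, of X "{}"] that by (auto simp: Q_def[abs_def] prob_space)
  have EK: "expectation (\<lambda>\<omega>'. K \<omega> \<omega>') = 1" for \<omega>
  proof -
    have "expectation (\<lambda>\<omega>'. K \<omega> \<omega>') = (\<Sum>X\<in>Pow I. \<rho> ^ card X * (P X \<omega> * expectation (Q X)))"
      unfolding K_expand using i_Q by (simp add: Bochner_Integration.integral_sum)
    also have "\<dots> = (\<Sum>X\<in>Pow I. if X = {} then 1 else 0)"
      by (rule sum.cong) (auto simp: EQ P_def)
    finally show ?thesis using fin by simp
  qed
  have i_K: "integrable M (\<lambda>\<omega>'. K \<omega> \<omega>')" for \<omega>
    unfolding K_expand using i_Q by auto
  define H where "H \<omega> \<omega>' = (\<Sum>n\<in>J. A n * (U n \<omega> * U n \<omega>'))" for \<omega> \<omega>'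
  have KH: "complex_of_real (K \<omega> \<omega>') * H \<omega> \<omega>' =
     (\<Sum>n\<in>J. \<Sum>X\<in>Pow I. (A n * complex_of_real (\<rho> ^ card X) * (P X \<omega> * U n \<omega>)) * (Q X \<omega>' * U n \<omega>'))" for \<omega> \<omega>'
    unfolding H_def K_expand of_real_sum sum_distrib_left sum_distrib_right by (simp add: mult_ac)
  have inner: "expectation (\<lambda>\<omega>'. complex_of_real (K \<omega> \<omega>') * H \<omega> \<omega>')
     = (\<Sum>n\<in>J. \<Sum>X\<in>Pow I. (A n * complex_of_real (\<rho> ^ card X) * \<beta> n X) * (P X \<omega> * U n \<omega>))" for \<omega>
  proof -
    have "expectation (\<lambda>\<omega>'. complex_of_real (K \<omega> \<omega>') * H \<omega> \<omega>')
      = (\<Sum>n\<in>J. \<Sum>X\<in>Pow I. (A n * complex_of_real (\<rho> ^ card X) * (P X \<omega> * U n \<omega>)) * \<beta> n X)"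
      unfolding KH \<beta>_def using i_PU by (intro integral_double_sum)
    then show ?thesis by (simp add: mult_ac)
  qed
  have i_inner: "integrable M (\<lambda>\<omega>'. complex_of_real (K \<omega> \<omega>') * H \<omega> \<omega>')" for \<omega>
    unfolding KH by (intro Bochner_Integration.integrable_sum integrable_mult_right i_PU)
  have outer: "expectation (\<lambda>\<omega>. expectation (\<lambda>\<omega>'. complex_of_real (K \<omega> \<omega>') * H \<omega> \<omega>'))
     = (\<Sum>n\<in>J. A n * (\<Sum>X\<in>Pow I. T n X))"
  proof -
    have "expectation (\<lambda>\<omega>. expectation (\<lambda>\<omega>'. complex_of_real (K \<omega> \<omega>') * H \<omega> \<omega>'))
      = (\<Sum>n\<in>J. \<Sum>X\<in>Pow I. (A n * complex_of_real (\<rho> ^ card X) * \<beta> n X) * \<alpha> n X)"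
      unfolding inner \<alpha>_def using i_PU by (intro integral_double_sum)
    then show ?thesis by (simp add: T_def sum_distrib_left mult_ac)
  qed
  have S0: "0 \<le> S" using not_empty G norm_ge_zero order_trans by blast
  have inner_le: "cmod (expectation (\<lambda>\<omega>'. complex_of_real (K \<omega> \<omega>') * H \<omega> \<omega>')) \<le> S" if "\<omega> \<in> space M" for \<omega>
  proof -
    have "cmod (expectation (\<lambda>\<omega>'. complex_of_real (K \<omega> \<omega>') * H \<omega> \<omega>')) \<le> expectation (\<lambda>\<omega>'. K \<omega> \<omega>' * S)"
    proof (rule norm_integral_le[OF i_inner])
      show "cmod (complex_of_real (K \<omega> \<omega>') * H \<omega> \<omega>') \<le> K \<omega> \<omega>' * S" if "\<omega>' \<in> space M" for \<omega>'
        using G[OF \<open>\<omega> \<in> space M\<close> that] K_nonneg[OF \<open>\<omega> \<in> space M\<close> that]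
        by (auto simp: norm_mult H_def intro!: mult_left_mono)
    qed (use i_K in auto)
    also have "\<dots> = S" using EK by simp
    finally show ?thesis .
  qed
  have bound: "cmod (\<Sum>n\<in>J. A n * (\<Sum>X\<in>Pow I. T n X)) \<le> S"
  proof -
    have "cmod (expectation (\<lambda>\<omega>. expectation (\<lambda>\<omega>'. complex_of_real (K \<omega> \<omega>') * H \<omega> \<omega>'))) \<le> expectation (\<lambda>\<omega>. S)"
    proof (rule norm_integral_le)
      show "integrable M (\<lambda>\<omega>. expectation (\<lambda>\<omega>'. complex_of_real (K \<omega> \<omega>') * H \<omega> \<omega>'))"
        unfolding inner by (intro Bochner_Integration.integrable_sum integrable_mult_right i_PU)
    qed (use inner_le in auto)
    then show ?thesis unfolding outer by (simp add: prob_space)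
  qed
  have bound0: "cmod (\<Sum>n\<in>J. A n * T n {}) \<le> S"
  proof -
    have UI: "integrable M (U n)" if "n \<in> J" for n
      using that UB B0[OF that] by (auto intro!: integrable_const_bound[where B="B"] AE_I2)
    have "(\<Sum>n\<in>J. A n * T n {}) = expectation (\<lambda>\<omega>. expectation (\<lambda>\<omega>'. H \<omega> \<omega>'))"
      using UI by (simp add: H_def T_def \<alpha>_def \<beta>_def P_def Q_def Bochner_Integration.integral_sum)
    also have "cmod \<dots> \<le> expectation (\<lambda>\<omega>. S)"
    proof (rule norm_integral_le)
      show "integrable M (\<lambda>\<omega>. expectation (H \<omega>))"
        using UI by (simp add: H_def[abs_def] Bochner_Integration.integral_sum)
      fix \<omega> assume w: "\<omega> \<in> space M"
      have "cmod (expectation (H \<omega>)) \<le> expectation (\<lambda>\<omega>. S)"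
        by (rule norm_integral_le) (use UI G w in \<open>auto simp: H_def[abs_def]\<close>)
      then show "cmod (expectation (H \<omega>)) \<le> S" by (simp add: prob_space)
    qed simp
    finally show ?thesis by (simp add: prob_space)
  qed
  have bessel: "(\<Sum>X\<in>Pow I. (cmod (\<alpha> n X))\<^sup>2) \<le> B\<^sup>2" "(\<Sum>X\<in>Pow I. (cmod (\<beta> n X))\<^sup>2) \<le> B\<^sup>2" if "n \<in> J" for n
    unfolding \<alpha>_def \<beta>_def
    by (intro bessel_inequality[where e=P] bessel_inequality[where e=Q];
        use fin PQ_bd PQ_meas that UB[OF that] expectation_prod_orthogonal[OF fin p]
          expectation_prod_orthogonal[OF fin q] in \<open>auto simp: P_def[abs_def] Q_def[abs_def]\<close>)+
  \<comment> \<open>Empty set, singletons, and the remainder of order \<open>\<rho>\<^sup>2\<close>.\<close>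
  define R where "R = {X \<in> Pow I. 2 \<le> card X}"
  have split: "(\<Sum>X\<in>Pow I. T n X) = T n {} + (\<Sum>k\<in>I. T n {k}) + (\<Sum>X\<in>R. T n X)" for n
  proof -
    have "Pow I = insert {} ((\<lambda>k. {k}) ` I \<union> R)"
    proof (intro set_eqI iffI)
      fix X assume X: "X \<in> Pow I"
      then have "finite X" using fin finite_subset by auto
      then have "card X = 0 \<or> card X = 1 \<or> 2 \<le> card X" by linarith
      then show "X \<in> insert {} ((\<lambda>k. {k}) ` I \<union> R)"
        using X \<open>finite X\<close> by (auto simp: R_def card_1_singleton_iff)
    qed (auto simp: R_def)
    moreover have "(\<lambda>k. {k}) ` I \<inter> R = {}" "{} \<notin> (\<lambda>k. {k}) ` I \<union> R" "finite R"
      using fin by (auto simp: R_def)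
    ultimately show ?thesis using fin
      by (simp add: sum.union_disjoint sum.reindex)
  qed
  have rest: "cmod (\<Sum>X\<in>R. T n X) \<le> \<rho>\<^sup>2 * B\<^sup>2" if "n \<in> J" for n
  proof -
    have "cmod (\<Sum>X\<in>R. T n X) \<le> (\<Sum>X\<in>R. \<rho>\<^sup>2 * (((cmod (\<alpha> n X))\<^sup>2 + (cmod (\<beta> n X))\<^sup>2) / 2))"
    proof (rule sum_norm_le)
      fix X assume "X \<in> R"
      then have c: "2 \<le> card X" by (simp add: R_def)
      have *: "cmod (\<alpha> n X) * cmod (\<beta> n X) \<le> ((cmod (\<alpha> n X))\<^sup>2 + (cmod (\<beta> n X))\<^sup>2) / 2"
        using sum_squares_bound[of "cmod (\<alpha> n X)" "cmod (\<beta> n X)"] by simp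
      have "\<rho> ^ card X \<le> \<rho>\<^sup>2" using c \<rho> by (intro power_decreasing) auto
      then have "\<rho> ^ card X * (cmod (\<alpha> n X) * cmod (\<beta> n X)) \<le> \<rho>\<^sup>2 * (((cmod (\<alpha> n X))\<^sup>2 + (cmod (\<beta> n X))\<^sup>2) / 2)"
        using * by (intro mult_mono) auto
      then show "cmod (T n X) \<le> \<rho>\<^sup>2 * (((cmod (\<alpha> n X))\<^sup>2 + (cmod (\<beta> n X))\<^sup>2) / 2)"
        using \<rho> by (simp add: T_def norm_mult norm_power)
    qed
    also have "\<dots> \<le> (\<Sum>X\<in>Pow I. \<rho>\<^sup>2 * (((cmod (\<alpha> n X))\<^sup>2 + (cmod (\<beta> n X))\<^sup>2) / 2))"
      using fin by (intro sum_mono2) (auto simp: R_def)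
    also have "\<dots> = \<rho>\<^sup>2 * (((\<Sum>X\<in>Pow I. (cmod (\<alpha> n X))\<^sup>2) + (\<Sum>X\<in>Pow I. (cmod (\<beta> n X))\<^sup>2)) / 2)"
      by (simp add: sum_distrib_left sum.distrib add_divide_distrib sum_divide_distrib algebra_simps)
    also have "\<dots> \<le> \<rho>\<^sup>2 * ((B\<^sup>2 + B\<^sup>2) / 2)"
      using bessel[OF that] by (intro mult_left_mono) auto
    finally show ?thesis by simp
  qed
  define L where "L = (\<Sum>n\<in>J. A n * (\<Sum>k\<in>I. expectation (\<lambda>\<omega>. p k \<omega> * U n \<omega>) * expectation (\<lambda>\<omega>. q k \<omega> * U n \<omega>)))"
  have lin: "of_real \<rho> * L = (\<Sum>n\<in>J. A n * (\<Sum>k\<in>I. T n {k}))"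
    by (simp add: L_def T_def \<alpha>_def \<beta>_def P_def Q_def sum_distrib_left mult_ac)
  have "of_real \<rho> * L = (\<Sum>n\<in>J. A n * (\<Sum>X\<in>Pow I. T n X)) - (\<Sum>n\<in>J. A n * T n {}) - (\<Sum>n\<in>J. A n * (\<Sum>X\<in>R. T n X))"
    unfolding lin split by (simp add: algebra_simps sum.distrib)
  also have "cmod \<dots> \<le> S + S + (\<Sum>n\<in>J. cmod (A n) * (\<rho>\<^sup>2 * B\<^sup>2))"
    by (intro order_trans[OF norm_triangle_ineq4] add_mono bound bound0 sum_norm_le)
       (auto simp: norm_mult intro!: mult_left_mono rest)
  finally have "\<rho> * cmod L \<le> 2 * S + \<rho>\<^sup>2 * B\<^sup>2 * (\<Sum>n\<in>J. cmod (A n))"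
    using \<rho> by (simp add: norm_mult sum_distrib_left mult_ac)
  then show ?thesis
    using \<rho> unfolding L_def[symmetric] by (simp add: field_simps power2_eq_square)
qed

text \<open>Positivity of the Riesz product needs real factors. A complex product
  \<open>(u\<^sub>k c\<^sub>k) (v\<^sub>k c\<^sub>k)\<close> is a combination of four products of real and imaginary parts, whence the factor 4.\<close>

lemma (in prob_space) riesz_product_estimate_complex:
  fixes c :: "'i \<Rightarrow> 'a \<Rightarrow> complex" and U :: "'n \<Rightarrow> 'a \<Rightarrow> complex" and A :: "'n \<Rightarrow> complex"
  assumes fin: "finite I" and ind: "indep_vars (\<lambda>_. borel) c I"
    and c1: "\<And>k \<omega>. k \<in> I \<Longrightarrow> \<omega> \<in> space M \<Longrightarrow> cmod (c k \<omega>) \<le> 1"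
    and mean: "\<And>k. k \<in> I \<Longrightarrow> expectation (c k) = 0"
    and u: "\<And>k. k \<in> I \<Longrightarrow> cmod (u k) \<le> 1" and v: "\<And>k. k \<in> I \<Longrightarrow> cmod (v k) \<le> 1"
    and U[measurable]: "\<And>n. n \<in> J \<Longrightarrow> U n \<in> borel_measurable M"
    and UB: "\<And>n \<omega>. n \<in> J \<Longrightarrow> \<omega> \<in> space M \<Longrightarrow> cmod (U n \<omega>) \<le> B"
    and G: "\<And>\<omega> \<omega>'. \<omega> \<in> space M \<Longrightarrow> \<omega>' \<in> space M \<Longrightarrow> cmod (\<Sum>n\<in>J. A n * (U n \<omega> * U n \<omega>')) \<le> S"
    and \<rho>: "0 < \<rho>" "\<rho> \<le> 1"
  shows "cmod (\<Sum>n\<in>J. A n * (\<Sum>k\<in>I. u k * v k * (expectation (\<lambda>\<omega>. c k \<omega> * U n \<omega>))\<^sup>2))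
     \<le> 4 * (2 * S / \<rho> + \<rho> * B\<^sup>2 * (\<Sum>n\<in>J. cmod (A n)))"
proof -
  have rv[measurable]: "c k \<in> borel_measurable M" if "k \<in> I" for k
    using ind that by (auto simp: indep_vars_def)
  \<comment> \<open>Real part for \<open>\<zeta> = 1\<close>, imaginary part for \<open>\<zeta> = -\<i>\<close>.\<close>
  define R where "R \<zeta> s k \<omega> = Re (\<zeta> * s k * c k \<omega>)" for \<zeta> and s :: "'i \<Rightarrow> complex" and k \<omega>
  have R_ind: "indep_vars (\<lambda>_. borel) (R \<zeta> s) I" for \<zeta> s
    unfolding R_def by (rule indep_vars_compose2[OF ind]) measurable
  have c_int: "integrable M (c k)" if "k \<in> I" for k
    using that c1 by (intro integrable_const_bound[where B=1] AE_I2) auto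
  have R_mean: "expectation (R \<zeta> s k) = 0" if "k \<in> I" for \<zeta> s k
  proof -
    have "integrable M (\<lambda>\<omega>. \<zeta> * s k * c k \<omega>)" using c_int[OF that] by simp
    from integral_Re[OF this] show ?thesis
      unfolding R_def using mean[OF that] by simp
  qed
  have R_le: "\<bar>R \<zeta> s k \<omega>\<bar> \<le> 1" if "cmod \<zeta> = 1" "cmod (s k) \<le> 1" "k \<in> I" "\<omega> \<in> space M" for \<zeta> s k \<omega>
  proof -
    have "cmod (\<zeta> * s k * c k \<omega>) \<le> 1"
      using that c1 by (simp add: norm_mult mult_le_one)
    then show ?thesis unfolding R_def using abs_Re_le_cmod order_trans by blast
  qed
  have R_meas[measurable]: "R \<zeta> s k \<in> borel_measurable M" if "k \<in> I" for \<zeta> s k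
    using R_ind[of \<zeta> s] that by (auto simp: indep_vars_def)
  define E where "E \<zeta> s n k = expectation (\<lambda>\<omega>. of_real (R \<zeta> s k \<omega>) * U n \<omega>)" for \<zeta> s n k
  define T where "T \<zeta> \<eta> = (\<Sum>n\<in>J. A n * (\<Sum>k\<in>I. E \<zeta> u n k * E \<eta> v n k))" for \<zeta> \<eta>
  have T_le: "cmod (T \<zeta> \<eta>) \<le> 2 * S / \<rho> + \<rho> * B\<^sup>2 * (\<Sum>n\<in>J. cmod (A n))" if "cmod \<zeta> = 1" "cmod \<eta> = 1" for \<zeta> \<eta>
    unfolding T_def E_def
    by (rule riesz_product_estimate[OF fin R_ind _ R_mean R_ind _ R_mean U UB G \<rho>])
       (use R_le u v that in auto)
  have cU_int: "integrable M (\<lambda>\<omega>. of_real (R \<zeta> s k \<omega>) * U n \<omega>)"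
    if "k \<in> I" "n \<in> J" "cmod \<zeta> = 1" "cmod (s k) \<le> 1" for \<zeta> s k n
  proof (rule integrable_const_bound[where B=B])
    show "AE \<omega> in M. norm (complex_of_real (R \<zeta> s k \<omega>) * U n \<omega>) \<le> B"
      using R_le[of \<zeta> s k] UB that
      by (intro AE_I2) (auto simp: norm_mult intro!: order_trans[OF mult_left_le_one_le])
  qed (use that in measurable)
  have split: "s k * expectation (\<lambda>\<omega>. c k \<omega> * U n \<omega>) = E 1 s n k + \<i> * E (-\<i>) s n k"
    if k: "k \<in> I" and n: "n \<in> J" and s: "cmod (s k) \<le> 1" for s k n
  proof -
    have "s k * c k \<omega> = of_real (R 1 s k \<omega>) + \<i> * of_real (R (-\<i>) s k \<omega>)" for \<omega>
      by (rule complex_eqI) (simp_all add: R_def)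
    then have eq: "s k * (c k \<omega> * U n \<omega>) = of_real (R 1 s k \<omega>) * U n \<omega> + \<i> * (of_real (R (-\<i>) s k \<omega>) * U n \<omega>)" for \<omega>
      by (simp only: mult.assoc[symmetric] distrib_right)
    have "s k * expectation (\<lambda>\<omega>. c k \<omega> * U n \<omega>) = expectation (\<lambda>\<omega>. s k * (c k \<omega> * U n \<omega>))" by simp
    also have "\<dots> = E 1 s n k + \<i> * E (-\<i>) s n k"
      unfolding eq E_def using cU_int[of k n 1 s] cU_int[of k n "-\<i>" s] k n s
      by (subst Bochner_Integration.integral_add) auto
    finally show ?thesis .
  qed
  have key: "u k * v k * (expectation (\<lambda>\<omega>. c k \<omega> * U n \<omega>))\<^sup>2
      = (E 1 u n k + \<i> * E (-\<i>) u n k) * (E 1 v n k + \<i> * E (-\<i>) v n k)" if nk: "n \<in> J" "k \<in> I" for n k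
  proof -
    have "u k * v k * (expectation (\<lambda>\<omega>. c k \<omega> * U n \<omega>))\<^sup>2
       = (u k * expectation (\<lambda>\<omega>. c k \<omega> * U n \<omega>)) * (v k * expectation (\<lambda>\<omega>. c k \<omega> * U n \<omega>))"
      by (simp add: power2_eq_square mult_ac)
    then show ?thesis
      using split[of k n u] split[of k n v] nk u v by simp
  qed
  have "(\<Sum>n\<in>J. A n * (\<Sum>k\<in>I. u k * v k * (expectation (\<lambda>\<omega>. c k \<omega> * U n \<omega>))\<^sup>2))
    = (\<Sum>n\<in>J. A n * (\<Sum>k\<in>I. (E 1 u n k + \<i> * E (-\<i>) u n k) * (E 1 v n k + \<i> * E (-\<i>) v n k)))"
    by (rule sum.cong[OF refl], rule arg_cong[where f="(*) _"], rule sum.cong[OF refl], rule key)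
  also have "\<dots> = T 1 1 + \<i> * T 1 (-\<i>) + \<i> * T (-\<i>) 1 - T (-\<i>) (-\<i>)"
    unfolding T_def sum_distrib_left sum.distrib[symmetric] sum_subtractf[symmetric]
    by (intro sum.cong refl) (simp add: algebra_simps)
  also have "cmod \<dots> \<le> cmod (T 1 1) + cmod (T 1 (-\<i>)) + cmod (T (-\<i>) 1) + cmod (T (-\<i>) (-\<i>))"
    by (intro order_trans[OF norm_triangle_ineq4] order_trans[OF norm_triangle_ineq] add_mono) (auto simp: norm_mult)
  also have "\<dots> \<le> 4 * (2 * S / \<rho> + \<rho> * B\<^sup>2 * (\<Sum>n\<in>J. cmod (A n)))"
  proof -
    define b where "b = 2 * S / \<rho> + \<rho> * B\<^sup>2 * (\<Sum>n\<in>J. cmod (A n))"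
    have "cmod (T 1 1) \<le> b" "cmod (T 1 (-\<i>)) \<le> b" "cmod (T (-\<i>) 1) \<le> b" "cmod (T (-\<i>) (-\<i>)) \<le> b"
      unfolding b_def by (intro T_le; simp)+
    then show ?thesis unfolding b_def[symmetric] by linarith
  qed
  finally show ?thesis .
qed

section \<open>Averages over signs\<close>

text \<open>A pattern of signs on \<open>I\<close> is encoded by the set \<open>X \<subseteq> I\<close> of the indices with a plus sign, so that an average over
  signs becomes a sum over \<open>Pow I\<close>.\<close>

definition sgn_of :: "'i set \<Rightarrow> 'i \<Rightarrow> real" where
  "sgn_of X n = (if n \<in> X then 1 else -1)"

lemma sum_Pow_insert:
  fixes f :: "'i set \<Rightarrow> 'b::comm_monoid_add"
  assumes "finite I" "x \<notin> I"
  shows "(\<Sum>X\<in>Pow (insert x I). f X) = (\<Sum>X\<in>Pow I. f X + f (insert x X))"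
proof -
  have "inj_on (insert x) (Pow I)" using assms(2) by (auto simp: inj_on_def)
  moreover have "Pow I \<inter> insert x ` Pow I = {}" using assms(2) by auto
  ultimately show ?thesis
    using assms(1) by (simp add: Pow_insert sum.union_disjoint sum.reindex sum.distrib)
qed

lemma sum_Pow_compl:
  fixes f :: "'i set \<Rightarrow> 'b::comm_monoid_add"
  shows "(\<Sum>X\<in>Pow I. f (I - X)) = (\<Sum>X\<in>Pow I. f X)"
  by (rule sum.reindex_bij_witness[where i="\<lambda>X. I - X" and j="\<lambda>X. I - X"]) auto

text \<open>For nearly optimal \<open>v\<close> and \<open>w\<close> the left-hand side is \<open>h v + h w + (F w - F v)\<close>. The difference is at most
  \<open>\<bar>G v - G w\<bar>\<close>, and the right-hand side is free to use \<open>v\<close> and \<open>w\<close> in either order.\<close>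

lemma SUP_sign_comparison:
  fixes h F G :: "'v \<Rightarrow> real"
  assumes V: "V \<noteq> {}"
    and bdd: "bdd_above ((\<lambda>v. h v + G v) ` V)" "bdd_above ((\<lambda>v. h v - G v) ` V)"
    and incr: "\<And>v w. v \<in> V \<Longrightarrow> w \<in> V \<Longrightarrow> \<bar>F v - F w\<bar> \<le> \<bar>G v - G w\<bar>"
  shows "(SUP v\<in>V. h v - F v) + (SUP v\<in>V. h v + F v) \<le> (SUP v\<in>V. h v - G v) + (SUP v\<in>V. h v + G v)"
    (is "_ \<le> ?R")
proof -
  have *: "(h v - F v) + (h w + F w) \<le> ?R" if "v \<in> V" "w \<in> V" for v w
  proof -
    have "h v - G v \<le> (SUP v\<in>V. h v - G v)" "h v + G v \<le> (SUP v\<in>V. h v + G v)" if "v \<in> V" for v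
      using that bdd by (auto intro: cSUP_upper)
    from this[OF that(1)] this[OF that(2)] show ?thesis using incr[OF that] by (auto simp: abs_if split: if_splits)
  qed
  have "(SUP v\<in>V. h v - F v) \<le> ?R - (h w + F w)" if "w \<in> V" for w
    using * that V by (intro cSUP_least) (auto simp: algebra_simps)
  then have "h w + F w \<le> ?R - (SUP v\<in>V. h v - F v)" if "w \<in> V" for w
    using that by (simp add: algebra_simps)
  then have "(SUP w\<in>V. h w + F w) \<le> ?R - (SUP v\<in>V. h v - F v)"
    using V by (intro cSUP_least)
  then show ?thesis by (simp add: algebra_simps)
qed

text \<open>The comparison principle of Ledoux and Talagrand. The signs are treated one at a time by
  \<open>SUP_sign_comparison\<close>; the term \<open>h\<close> keeps the induction going by collecting the coordinates that have been
  replaced already.\<close>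

lemma Rademacher_comparison:
  fixes F G :: "'i \<Rightarrow> 'v \<Rightarrow> real"
  assumes "finite I" and V: "V \<noteq> {}"
    and bdd: "\<And>v. v \<in> V \<Longrightarrow> \<bar>h v\<bar> \<le> C" "\<And>n v. n \<in> I \<Longrightarrow> v \<in> V \<Longrightarrow> \<bar>F n v\<bar> \<le> C"
       "\<And>n v. n \<in> I \<Longrightarrow> v \<in> V \<Longrightarrow> \<bar>G n v\<bar> \<le> C"
    and incr: "\<And>n v w. n \<in> I \<Longrightarrow> v \<in> V \<Longrightarrow> w \<in> V \<Longrightarrow> \<bar>F n v - F n w\<bar> \<le> \<bar>G n v - G n w\<bar>"
  shows "(\<Sum>X\<in>Pow I. SUP v\<in>V. h v + (\<Sum>n\<in>I. sgn_of X n * F n v))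
     \<le> (\<Sum>X\<in>Pow I. SUP v\<in>V. h v + (\<Sum>n\<in>I. sgn_of X n * G n v))"
  using assms(1,3-)
proof (induction I arbitrary: h C rule: finite_induct)
  case (insert x I)
  let ?s = "\<lambda>F X v. \<Sum>n\<in>I. sgn_of X n * F n v"
  have s_ins: "sgn_of (insert x X) n = sgn_of X n" if "n \<in> I" for X n
    using that insert.hyps by (auto simp: sgn_of_def)
  have sum_ins: "(\<Sum>n\<in>I. sgn_of (insert x X) n * H n v) = ?s H X v" for H :: "'i \<Rightarrow> 'v \<Rightarrow> real" and X v
    by (rule sum.cong) (auto simp: s_ins)
  have expand: "(\<Sum>X\<in>Pow (insert x I). SUP v\<in>V. h v + (\<Sum>n\<in>insert x I. sgn_of X n * H n v))
     = (\<Sum>X\<in>Pow I. (SUP v\<in>V. (h v + ?s H X v) - H x v) + (SUP v\<in>V. (h v + ?s H X v) + H x v))"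
    for H :: "'i \<Rightarrow> 'v \<Rightarrow> real"
  proof -
    have "(SUP v\<in>V. h v + (\<Sum>n\<in>insert x I. sgn_of X n * H n v)) = (SUP v\<in>V. (h v + ?s H X v) - H x v)"
      "(SUP v\<in>V. h v + (\<Sum>n\<in>insert x I. sgn_of (insert x X) n * H n v)) = (SUP v\<in>V. (h v + ?s H X v) + H x v)"
      if "X \<in> Pow I" for X
    proof -
      have i: "(\<Sum>n\<in>insert x I. sgn_of Y n * H n v) = sgn_of Y x * H x v + ?s H Y v" for Y v
        using insert.hyps by simp
      have "x \<notin> X" using that insert.hyps by auto
      then have "sgn_of X x = -1" "sgn_of (insert x X) x = 1" by (auto simp: sgn_of_def)
      then show "(SUP v\<in>V. h v + (\<Sum>n\<in>insert x I. sgn_of X n * H n v)) = (SUP v\<in>V. (h v + ?s H X v) - H x v)"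
        "(SUP v\<in>V. h v + (\<Sum>n\<in>insert x I. sgn_of (insert x X) n * H n v)) = (SUP v\<in>V. (h v + ?s H X v) + H x v)"
        by (simp_all only: i sum_ins) (simp_all add: algebra_simps)
    qed
    then show ?thesis unfolding sum_Pow_insert[OF insert.hyps] by simp
  qed
  have C0: "0 \<le> C" using V insert.prems(1) abs_ge_zero order_trans by blast
  have s_bd: "\<bar>?s H X v\<bar> \<le> card I * C" if "\<And>n v. n \<in> I \<Longrightarrow> v \<in> V \<Longrightarrow> \<bar>H n v\<bar> \<le> C" "v \<in> V"
    for H :: "'i \<Rightarrow> 'v \<Rightarrow> real" and X v
  proof -
    have "\<bar>?s H X v\<bar> \<le> (\<Sum>n\<in>I. C)"
      by (rule order_trans[OF sum_abs sum_mono]) (use that in \<open>auto simp: sgn_of_def abs_mult\<close>)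
    then show ?thesis by simp
  qed
  have "(\<Sum>X\<in>Pow (insert x I). SUP v\<in>V. h v + (\<Sum>n\<in>insert x I. sgn_of X n * F n v))
     \<le> (\<Sum>X\<in>Pow I. (SUP v\<in>V. (h v + ?s F X v) - G x v) + (SUP v\<in>V. (h v + ?s F X v) + G x v))"
    unfolding expand
  proof (rule sum_mono)
    fix X assume "X \<in> Pow I"
    have b: "\<bar>h v + ?s F X v\<bar> \<le> C + card I * C" if "v \<in> V" for v
      using insert.prems(1)[OF that] s_bd[of F v X] insert.prems(2) that by force
    show "(SUP v\<in>V. (h v + ?s F X v) - F x v) + (SUP v\<in>V. (h v + ?s F X v) + F x v)
       \<le> (SUP v\<in>V. (h v + ?s F X v) - G x v) + (SUP v\<in>V. (h v + ?s F X v) + G x v)"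
    proof (rule SUP_sign_comparison[OF V])
      show "bdd_above ((\<lambda>v. h v + ?s F X v + G x v) ` V)" "bdd_above ((\<lambda>v. h v + ?s F X v - G x v) ` V)"
        using b insert.prems(3)[of x]
        by (auto intro!: bdd_aboveI2[where M="C + card I * C + C"] simp: abs_le_iff add_mono) (smt (verit) insertI1)+
    qed (use insert.prems(4) in auto)
  qed
  also have "\<dots> = (\<Sum>X\<in>Pow I. SUP v\<in>V. (h v - G x v) + ?s F X v) + (\<Sum>X\<in>Pow I. SUP v\<in>V. (h v + G x v) + ?s F X v)"
    by (simp add: sum.distrib algebra_simps)
  also have "\<dots> \<le> (\<Sum>X\<in>Pow I. SUP v\<in>V. (h v - G x v) + ?s G X v) + (\<Sum>X\<in>Pow I. SUP v\<in>V. (h v + G x v) + ?s G X v)"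
  proof (intro add_mono insert.IH[where C="2 * C"])
    fix v assume v: "v \<in> V"
    show "\<bar>h v - G x v\<bar> \<le> 2 * C" "\<bar>h v + G x v\<bar> \<le> 2 * C"
      using insert.prems(1)[OF v] insert.prems(3)[of x v] v by auto
    show "\<bar>F n v\<bar> \<le> 2 * C" "\<bar>G n v\<bar> \<le> 2 * C" if "n \<in> I" for n
      using insert.prems(2)[of n v] insert.prems(3)[of n v] v that C0 by auto
    show "\<bar>F n v\<bar> \<le> 2 * C" "\<bar>G n v\<bar> \<le> 2 * C" if "n \<in> I" for n
      using insert.prems(2)[of n v] insert.prems(3)[of n v] v that C0 by auto
  qed (use insert.prems(4) in auto)
  also have "\<dots> = (\<Sum>X\<in>Pow (insert x I). SUP v\<in>V. h v + (\<Sum>n\<in>insert x I. sgn_of X n * G n v))"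
    unfolding expand by (simp add: sum.distrib algebra_simps)
  finally show ?case .
qed simp

text \<open>On \<open>[-2, 2]\<close> the map \<open>x \<mapsto> x\<^sup>2/4\<close> is a contraction. Absolute values cost a factor 2: the supremum of \<open>\<bar>Y\<bar>\<close> is at
  most that of \<open>Y\<close> plus that of \<open>-Y\<close>, since the point \<open>z\<close> makes both nonnegative, and complementing
  the sign pattern exchanges the two.\<close>

lemma Rademacher_square_comparison:
  fixes f :: "'i \<Rightarrow> 'w \<Rightarrow> real"
  assumes fin: "finite I" and c: "\<And>n. n \<in> I \<Longrightarrow> 0 \<le> c n"
    and f: "\<And>n w. n \<in> I \<Longrightarrow> w \<in> W \<Longrightarrow> \<bar>f n w\<bar> \<le> 2"
    and z: "z \<in> W" "\<And>n. n \<in> I \<Longrightarrow> f n z = 0"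
  shows "(\<Sum>X\<in>Pow I. SUP w\<in>W. \<bar>\<Sum>n\<in>I. sgn_of X n * (c n * ((f n w)\<^sup>2 / 4))\<bar>)
     \<le> 2 * (\<Sum>X\<in>Pow I. SUP w\<in>W. \<bar>\<Sum>n\<in>I. sgn_of X n * (c n * f n w)\<bar>)"
proof -
  define Y where "Y X w = (\<Sum>n\<in>I. sgn_of X n * (c n * ((f n w)\<^sup>2 / 4)))" for X w
  define Z where "Z X w = (\<Sum>n\<in>I. sgn_of X n * (c n * f n w))" for X w
  define C where "C = 2 * sum c I"
  have W: "W \<noteq> {}" using z by auto
  have c_le: "c n \<le> sum c I" if "n \<in> I" for n using that fin c by (intro member_le_sum) auto
  have sq: "(f n w)\<^sup>2 / 4 \<le> 1" if "n \<in> I" "w \<in> W" for n w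
    using f[OF that] abs_le_square_iff[of "f n w" 2] by simp
  have F_bd: "\<bar>c n * ((f n w)\<^sup>2 / 4)\<bar> \<le> C" if "n \<in> I" "w \<in> W" for n w
  proof -
    have "c n * ((f n w)\<^sup>2 / 4) \<le> c n * 1" using c[OF that(1)] sq[OF that] by (intro mult_left_mono) auto
    then show ?thesis using c[OF that(1)] c_le[OF that(1)] by (simp add: C_def)
  qed
  have G_bd: "\<bar>c n * f n w\<bar> \<le> C" if "n \<in> I" "w \<in> W" for n w
  proof -
    have "\<bar>c n * f n w\<bar> \<le> sum c I * 2"
      unfolding abs_mult using c c_le f that by (intro mult_mono) (auto intro: sum_nonneg)
    then show ?thesis by (simp add: C_def)
  qed
  have sum_bd: "\<bar>\<Sum>n\<in>I. sgn_of X n * H n\<bar> \<le> card I * C" if "\<And>n. n \<in> I \<Longrightarrow> \<bar>H n\<bar> \<le> C" for X H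
  proof -
    have "\<bar>\<Sum>n\<in>I. sgn_of X n * H n\<bar> \<le> (\<Sum>n\<in>I. C)"
      by (rule order_trans[OF sum_abs sum_mono]) (use that in \<open>auto simp: sgn_of_def abs_mult\<close>)
    then show ?thesis by simp
  qed
  have Y_bd: "\<bar>Y X w\<bar> \<le> card I * C" and Z_bd: "\<bar>Z X w\<bar> \<le> card I * C" if "w \<in> W" for X w
    unfolding Y_def Z_def by (rule sum_bd, rule F_bd[OF _ that], assumption)
       (rule sum_bd, rule G_bd[OF _ that], assumption)
  have bddY: "bdd_above (Y X ` W)" and bddZ: "bdd_above (Z X ` W)" "bdd_above ((\<lambda>w. \<bar>Z X w\<bar>) ` W)" for X
    using Y_bd Z_bd by (auto intro!: bdd_aboveI2[where M="card I * C"] intro: order_trans[OF abs_ge_self])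
  have Y_compl: "Y (I - X) w = - Y X w" for X w
    unfolding Y_def sum_negf[symmetric] by (rule sum.cong) (auto simp: sgn_of_def)
  have Y0: "0 \<le> (SUP w\<in>W. Y X w)" for X
    using cSUP_upper[OF z(1) bddY, of X] z(2) by (simp add: Y_def)
  have "(\<Sum>X\<in>Pow I. SUP w\<in>W. \<bar>Y X w\<bar>) \<le> (\<Sum>X\<in>Pow I. (SUP w\<in>W. Y X w) + (SUP w\<in>W. Y (I - X) w))"
  proof (intro sum_mono cSUP_least W)
    fix X w assume "w \<in> W"
    then have "Y X w \<le> (SUP w\<in>W. Y X w)" "- Y X w \<le> (SUP w\<in>W. Y (I - X) w)"
      using cSUP_upper[OF _ bddY[of X], of w] cSUP_upper[OF _ bddY[of "I - X"], of w] by (auto simp: Y_compl)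
    then show "\<bar>Y X w\<bar> \<le> (SUP w\<in>W. Y X w) + (SUP w\<in>W. Y (I - X) w)"
      using Y0[of X] Y0[of "I - X"] by linarith
  qed
  also have "\<dots> = 2 * (\<Sum>X\<in>Pow I. SUP w\<in>W. Y X w)"
    unfolding sum.distrib sum_Pow_compl[of "\<lambda>X. SUP w\<in>W. Y X w"] by simp
  also have "(\<Sum>X\<in>Pow I. SUP w\<in>W. Y X w) \<le> (\<Sum>X\<in>Pow I. SUP w\<in>W. Z X w)"
  proof -
    have "(\<Sum>X\<in>Pow I. SUP w\<in>W. 0 + Y X w) \<le> (\<Sum>X\<in>Pow I. SUP w\<in>W. 0 + Z X w)"
      unfolding Y_def Z_def
    proof (rule Rademacher_comparison[OF fin W, where C=C and h="\<lambda>_. 0"])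
      fix n v w assume nvw: "n \<in> I" "v \<in> W" "w \<in> W"
      have "\<bar>c n * ((f n v)\<^sup>2 / 4) - c n * ((f n w)\<^sup>2 / 4)\<bar> = c n * (\<bar>f n v - f n w\<bar> * (\<bar>f n v + f n w\<bar> / 4))"
      proof -
        have "c n * ((f n v)\<^sup>2 / 4) - c n * ((f n w)\<^sup>2 / 4) = c n * ((f n v - f n w) * ((f n v + f n w) / 4))"
          by (simp add: power2_eq_square algebra_simps diff_divide_distrib)
        then show ?thesis using c[OF nvw(1)] by (simp only: abs_mult abs_divide abs_of_nonneg abs_numeral)
      qed
      also have "\<dots> \<le> c n * (\<bar>f n v - f n w\<bar> * 1)"
        using c f[of n v] f[of n w] nvw by (intro mult_left_mono) auto
      finally show "\<bar>c n * ((f n v)\<^sup>2 / 4) - c n * ((f n w)\<^sup>2 / 4)\<bar> \<le> \<bar>c n * f n v - c n * f n w\<bar>"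
        using c[OF nvw(1)] by (simp only: right_diff_distrib[symmetric] abs_mult)
    qed (use F_bd G_bd fin c in \<open>auto simp: C_def intro: sum_nonneg\<close>)
    then show ?thesis by simp
  qed
  also have "\<dots> \<le> (\<Sum>X\<in>Pow I. SUP w\<in>W. \<bar>Z X w\<bar>)"
    by (intro sum_mono cSUP_least[OF W] order_trans[OF abs_ge_self cSUP_upper[OF _ bddZ(2)]])
  finally show ?thesis by (simp add: Y_def Z_def)
qed

definition signed_sup :: "'i set \<Rightarrow> ('i \<Rightarrow> real) \<Rightarrow> ('i \<Rightarrow> complex) set \<Rightarrow> 'i set \<Rightarrow> real" where
  "signed_sup I c V X = (SUP v\<in>V. cmod (\<Sum>n\<in>I. of_real (sgn_of X n * c n) * v n))"

lemma signed_sup_upper: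
  assumes "finite I" "\<And>n. n \<in> I \<Longrightarrow> 0 \<le> c n" "\<And>n v. n \<in> I \<Longrightarrow> v \<in> V \<Longrightarrow> cmod (v n) \<le> 1" "v \<in> V"
  shows "cmod (\<Sum>n\<in>I. of_real (sgn_of X n * c n) * v n) \<le> signed_sup I c V X"
  unfolding signed_sup_def
proof (rule cSUP_upper[OF assms(4)], rule bdd_aboveI2)
  fix v assume "v \<in> V"
  show "cmod (\<Sum>n\<in>I. of_real (sgn_of X n * c n) * v n) \<le> (\<Sum>n\<in>I. c n * 1)"
    using assms(2) assms(3)[OF _ \<open>v \<in> V\<close>]
    by (intro order_trans[OF norm_sum sum_mono])
       (auto simp: norm_mult sgn_of_def abs_mult intro!: mult_left_le)
qed

text \<open>The product of two complex numbers has four products of real and imaginary parts, and each of these is a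
  difference of two squares \<open>(x \<plusminus> y)\<^sup>2/4\<close>. For each of the eight squares the previous comparison removes the square and leaves a
  sum of one term in \<open>u\<close> and one in \<open>v\<close>. The zero vectors provide the point where the squares vanish.\<close>

lemma signed_sup_mult:
  assumes fin: "finite I" and c: "\<And>n. n \<in> I \<Longrightarrow> 0 \<le> c n"
    and U: "\<And>n u. n \<in> I \<Longrightarrow> u \<in> U \<Longrightarrow> cmod (u n) \<le> 1" "(\<lambda>_. 0) \<in> U"
    and V: "\<And>n v. n \<in> I \<Longrightarrow> v \<in> V \<Longrightarrow> cmod (v n) \<le> 1" "(\<lambda>_. 0) \<in> V"
  shows "(\<Sum>X\<in>Pow I. signed_sup I c {\<lambda>n. u n * v n | u v. u \<in> U \<and> v \<in> V} X)
     \<le> 16 * ((\<Sum>X\<in>Pow I. signed_sup I c U X) + (\<Sum>X\<in>Pow I. signed_sup I c V X))"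
proof -
  \<comment> \<open>The parameters \<open>\<zeta>\<close>, \<open>\<eta>\<close> of modulus 1 select the parts: \<open>Re (-\<i> * x) = Im x\<close>, and a sign gives the difference.\<close>
  define f where "f \<zeta> \<eta> n w = Re (\<zeta> * fst w n) + Re (\<eta> * snd w n)" for \<zeta> \<eta> :: complex and n :: 'a and w
  define Y where "Y \<zeta> \<eta> X w = (\<Sum>n\<in>I. sgn_of X n * (c n * ((f \<zeta> \<eta> n w)\<^sup>2 / 4)))" for \<zeta> \<eta> X w
  define Q where "Q \<zeta> \<eta> X = (SUP w\<in>U\<times>V. \<bar>Y \<zeta> \<eta> X w\<bar>)" for \<zeta> \<eta> X
  have Re_le: "\<bar>Re (\<zeta> * z)\<bar> \<le> cmod z" if "cmod \<zeta> = 1" for \<zeta> z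
    using abs_Re_le_cmod[of "\<zeta> * z"] that by (simp add: norm_mult)
  have f_le: "\<bar>f \<zeta> \<eta> n w\<bar> \<le> 2" if "cmod \<zeta> = 1" "cmod \<eta> = 1" "n \<in> I" "w \<in> U \<times> V" for \<zeta> \<eta> n w
    using Re_le[OF that(1), of "fst w n"] Re_le[OF that(2), of "snd w n"] U(1)[OF that(3), of "fst w"]
      V(1)[OF that(3), of "snd w"] that(4) by (auto simp: f_def)
  have Y_upper: "\<bar>Y \<zeta> \<eta> X w\<bar> \<le> Q \<zeta> \<eta> X" if "cmod \<zeta> = 1" "cmod \<eta> = 1" "w \<in> U \<times> V" for \<zeta> \<eta> X w
    unfolding Q_def
  proof (rule cSUP_upper[OF that(3)], rule bdd_aboveI2)
    fix w assume w: "w \<in> U \<times> V"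
    have "(f \<zeta> \<eta> n w)\<^sup>2 / 4 \<le> 1" if "n \<in> I" for n
      using f_le[OF \<open>cmod \<zeta> = 1\<close> \<open>cmod \<eta> = 1\<close> that w] abs_le_square_iff[of "f \<zeta> \<eta> n w" 2] by simp
    then show "\<bar>Y \<zeta> \<eta> X w\<bar> \<le> (\<Sum>n\<in>I. c n * 1)"
      unfolding Y_def using c
      by (intro order_trans[OF sum_abs sum_mono])
         (auto simp: sgn_of_def abs_mult simp del: times_divide_eq_right intro!: mult_left_le)
  qed
  have Q_sum: "(\<Sum>X\<in>Pow I. Q \<zeta> \<eta> X) \<le> 2 * ((\<Sum>X\<in>Pow I. signed_sup I c U X) + (\<Sum>X\<in>Pow I. signed_sup I c V X))"
    if "cmod \<zeta> = 1" "cmod \<eta> = 1" for \<zeta> \<eta>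
  proof -
    have "(\<Sum>X\<in>Pow I. Q \<zeta> \<eta> X) \<le> 2 * (\<Sum>X\<in>Pow I. SUP w\<in>U\<times>V. \<bar>\<Sum>n\<in>I. sgn_of X n * (c n * f \<zeta> \<eta> n w)\<bar>)"
      unfolding Q_def Y_def
      by (rule Rademacher_square_comparison[OF fin c f_le[OF that], where z="(\<lambda>_. 0, \<lambda>_. 0)"])
         (use U V in \<open>auto simp: f_def\<close>)
    also have "\<dots> \<le> 2 * (\<Sum>X\<in>Pow I. signed_sup I c U X + signed_sup I c V X)"
    proof (intro mult_left_mono sum_mono cSUP_least)
      fix X w assume w: "w \<in> U \<times> V"
      have "(\<Sum>n\<in>I. sgn_of X n * (c n * f \<zeta> \<eta> n w))
         = Re (\<zeta> * (\<Sum>n\<in>I. of_real (sgn_of X n * c n) * fst w n)) + Re (\<eta> * (\<Sum>n\<in>I. of_real (sgn_of X n * c n) * snd w n))"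
        unfolding f_def sum_distrib_left Re_sum sum.distrib[symmetric]
        by (rule sum.cong) (auto simp: algebra_simps)
      also have "\<bar>\<dots>\<bar> \<le> cmod (\<Sum>n\<in>I. of_real (sgn_of X n * c n) * fst w n) + cmod (\<Sum>n\<in>I. of_real (sgn_of X n * c n) * snd w n)"
        by (intro order_trans[OF abs_triangle_ineq] add_mono Re_le that)
      also have "\<dots> \<le> signed_sup I c U X + signed_sup I c V X"
        using w fin c U V by (intro add_mono signed_sup_upper) auto
      finally show "\<bar>\<Sum>n\<in>I. sgn_of X n * (c n * f \<zeta> \<eta> n w)\<bar> \<le> signed_sup I c U X + signed_sup I c V X" .
    qed (use U V in auto)
    finally show ?thesis by (simp add: sum.distrib)
  qed
  have main: "signed_sup I c {\<lambda>n. u n * v n | u v. u \<in> U \<and> v \<in> V} X \<le>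
      Q 1 1 X + Q 1 (-1) X + Q (-\<i>) (-\<i>) X + Q (-\<i>) \<i> X + Q 1 (-\<i>) X + Q 1 \<i> X + Q (-\<i>) 1 X + Q (-\<i>) (-1) X" for X
    unfolding signed_sup_def
  proof (rule cSUP_least)
    fix z assume "z \<in> {\<lambda>n. u n * v n | u v. u \<in> U \<and> v \<in> V}"
    then obtain u v where uv: "u \<in> U" "v \<in> V" and z: "z = (\<lambda>n. u n * v n)" by auto
    define w where "w = (u, v)"
    have w: "w \<in> U \<times> V" using uv by (simp add: w_def)
    let ?s = "\<Sum>n\<in>I. of_real (sgn_of X n * c n) * z n"
    have pol: "k * ((x + y)\<^sup>2 / 4) - k * ((x + - y)\<^sup>2 / 4) = k * (x * y)" for k x y :: real
    proof -
      have "(x + y)\<^sup>2 / 4 - (x + - y)\<^sup>2 / 4 = x * y" by (simp add: power2_eq_square field_simps)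
      then show ?thesis by (simp only: right_diff_distrib[symmetric])
    qed
    have f_w: "f 1 1 n w = Re (u n) + Re (v n)" "f 1 (-1) n w = Re (u n) + - Re (v n)"
      "f (-\<i>) (-\<i>) n w = Im (u n) + Im (v n)" "f (-\<i>) \<i> n w = Im (u n) + - Im (v n)"
      "f 1 (-\<i>) n w = Re (u n) + Im (v n)" "f 1 \<i> n w = Re (u n) + - Im (v n)"
      "f (-\<i>) 1 n w = Im (u n) + Re (v n)" "f (-\<i>) (-1) n w = Im (u n) + - Re (v n)" for n
      by (simp_all add: f_def w_def)
    have Re: "Re ?s = Y 1 1 X w - Y 1 (-1) X w - (Y (-\<i>) (-\<i>) X w - Y (-\<i>) \<i> X w)"
      unfolding Y_def Re_sum sum_subtractf[symmetric] z f_w mult.assoc[symmetric] pol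
      by (rule sum.cong) (auto simp: algebra_simps)
    have Im: "Im ?s = Y 1 (-\<i>) X w - Y 1 \<i> X w + (Y (-\<i>) 1 X w - Y (-\<i>) (-1) X w)"
      unfolding Y_def Im_sum sum_subtractf[symmetric] sum.distrib[symmetric] z f_w mult.assoc[symmetric] pol
      by (rule sum.cong) (auto simp: algebra_simps)
    have "cmod ?s \<le> \<bar>Re ?s\<bar> + \<bar>Im ?s\<bar>" by (rule cmod_le)
    also have "\<dots> \<le> \<bar>Y 1 1 X w\<bar> + \<bar>Y 1 (-1) X w\<bar> + \<bar>Y (-\<i>) (-\<i>) X w\<bar> + \<bar>Y (-\<i>) \<i> X w\<bar>
       + \<bar>Y 1 (-\<i>) X w\<bar> + \<bar>Y 1 \<i> X w\<bar> + \<bar>Y (-\<i>) 1 X w\<bar> + \<bar>Y (-\<i>) (-1) X w\<bar>"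
    proof -
      have "\<bar>a - b - (c - d)\<bar> \<le> \<bar>a\<bar> + \<bar>b\<bar> + \<bar>c\<bar> + \<bar>d\<bar>" "\<bar>a - b + (c - d)\<bar> \<le> \<bar>a\<bar> + \<bar>b\<bar> + \<bar>c\<bar> + \<bar>d\<bar>"
        for a b c d :: real by linarith+
      from add_mono[OF this] show ?thesis unfolding Re Im by (simp only: add.assoc)
    qed
    also have "\<dots> \<le> Q 1 1 X + Q 1 (-1) X + Q (-\<i>) (-\<i>) X + Q (-\<i>) \<i> X + Q 1 (-\<i>) X + Q 1 \<i> X + Q (-\<i>) 1 X + Q (-\<i>) (-1) X"
      by (intro add_mono Y_upper w) auto
    finally show "cmod ?s \<le> Q 1 1 X + Q 1 (-1) X + Q (-\<i>) (-\<i>) X + Q (-\<i>) \<i> X + Q 1 (-\<i>) X + Q 1 \<i> X + Q (-\<i>) 1 X + Q (-\<i>) (-1) X" .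
  qed (use U V in blast)
  have "(\<Sum>X\<in>Pow I. signed_sup I c {\<lambda>n. u n * v n | u v. u \<in> U \<and> v \<in> V} X) \<le>
    (\<Sum>X\<in>Pow I. Q 1 1 X) + (\<Sum>X\<in>Pow I. Q 1 (-1) X) + (\<Sum>X\<in>Pow I. Q (-\<i>) (-\<i>) X) + (\<Sum>X\<in>Pow I. Q (-\<i>) \<i> X)
     + (\<Sum>X\<in>Pow I. Q 1 (-\<i>) X) + (\<Sum>X\<in>Pow I. Q 1 \<i> X) + (\<Sum>X\<in>Pow I. Q (-\<i>) 1 X) + (\<Sum>X\<in>Pow I. Q (-\<i>) (-1) X)"
    unfolding sum.distrib[symmetric] by (rule sum_mono[OF main])
  also have "\<dots> \<le> 16 * ((\<Sum>X\<in>Pow I. signed_sup I c U X) + (\<Sum>X\<in>Pow I. signed_sup I c V X))"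
    using Q_sum[of 1 1] Q_sum[of 1 "-1"] Q_sum[of "-\<i>" "-\<i>"] Q_sum[of "-\<i>" "\<i>"]
      Q_sum[of 1 "-\<i>"] Q_sum[of 1 \<i>] Q_sum[of "-\<i>" 1] Q_sum[of "-\<i>" "-1"] by simp
  finally show ?thesis .
qed

text \<open>The index is one less than the number of factors, since the empty product, the vector of ones, is not controlled by \<open>V\<close>.\<close>

fun prod_vectors :: "('i \<Rightarrow> complex) set \<Rightarrow> nat \<Rightarrow> ('i \<Rightarrow> complex) set" where
  "prod_vectors V 0 = V"
| "prod_vectors V (Suc k) = {\<lambda>n. u n * v n | u v. u \<in> prod_vectors V k \<and> v \<in> V}"

lemma prod_vectors_le_1:
  assumes "\<And>n v. n \<in> I \<Longrightarrow> v \<in> V \<Longrightarrow> cmod (v n) \<le> 1"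
  shows "n \<in> I \<Longrightarrow> u \<in> prod_vectors V k \<Longrightarrow> cmod (u n) \<le> 1"
  by (induction k arbitrary: u) (auto simp: norm_mult assms intro!: mult_le_one)

lemma zero_in_prod_vectors: "(\<lambda>_. 0) \<in> V \<Longrightarrow> (\<lambda>_. 0) \<in> prod_vectors V k"
proof (induction k)
  case (Suc k)
  then have "(\<lambda>_. 0) \<in> prod_vectors V k" "(\<lambda>_. 0) \<in> V" by simp_all
  then show ?case unfolding prod_vectors.simps mem_Collect_eq
    by (intro exI[of _ "\<lambda>_. 0"] conjI) simp_all
qed simp

lemma prod_in_prod_vectors:
  "(\<And>i. i \<le> k \<Longrightarrow> v i \<in> V) \<Longrightarrow> (\<lambda>n. \<Prod>i\<le>k. v i n) \<in> prod_vectors V k"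
proof (induction k)
  case (Suc k)
  then have "(\<lambda>n. \<Prod>i\<le>k. v i n) \<in> prod_vectors V k" "v (Suc k) \<in> V" by auto
  then show ?case unfolding prod_vectors.simps mem_Collect_eq
    by (intro exI[of _ "\<lambda>n. \<Prod>i\<le>k. v i n"] exI[of _ "v (Suc k)"] conjI) simp_all
qed simp

lemma signed_sup_prod_vectors:
  assumes fin: "finite I" and c: "\<And>n. n \<in> I \<Longrightarrow> 0 \<le> c n"
    and V: "\<And>n v. n \<in> I \<Longrightarrow> v \<in> V \<Longrightarrow> cmod (v n) \<le> 1" "(\<lambda>_. 0) \<in> V"
  shows "(\<Sum>X\<in>Pow I. signed_sup I c (prod_vectors V k) X) \<le> 32 ^ k * (\<Sum>X\<in>Pow I. signed_sup I c V X)"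
proof (induction k)
  case (Suc k)
  define R where "R = (\<Sum>X\<in>Pow I. signed_sup I c V X)"
  have "0 \<le> R" unfolding R_def
    by (intro sum_nonneg order_trans[OF norm_ge_zero signed_sup_upper[where v="\<lambda>_. 0"]])
       (use assms in auto)
  then have R_le: "R \<le> 32 ^ k * R" by (simp add: mult_le_cancel_right1)
  have "(\<Sum>X\<in>Pow I. signed_sup I c (prod_vectors V (Suc k)) X)
    \<le> 16 * ((\<Sum>X\<in>Pow I. signed_sup I c (prod_vectors V k) X) + R)"
    unfolding prod_vectors.simps R_def
  proof (rule signed_sup_mult[OF fin c])
    show "cmod (u n) \<le> 1" if "n \<in> I" "u \<in> prod_vectors V k" for n u
      using prod_vectors_le_1[of I V, OF _ that] V(1) by blast
  qed (use V zero_in_prod_vectors in auto)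
  also have "\<dots> \<le> 16 * (32 ^ k * R + 32 ^ k * R)" using Suc R_le unfolding R_def by (intro mult_left_mono add_mono) auto
  also have "\<dots> = 32 ^ Suc k * R" by simp
  finally show ?case unfolding R_def .
qed simp

section \<open>Complex Gaussian variables\<close>

lemma nn_integral_lborel_scale:
  fixes f :: "'b::euclidean_space \<Rightarrow> ennreal"
  assumes [measurable]: "f \<in> borel_measurable borel" and "c \<noteq> 0"
  shows "(\<integral>\<^sup>+z. f z \<partial>lborel) = ennreal (\<bar>c\<bar> ^ DIM('b)) * (\<integral>\<^sup>+z. f (c *\<^sub>R z) \<partial>lborel)"
proof -
  have "(\<integral>\<^sup>+z. f z \<partial>lborel) = (\<integral>\<^sup>+z. f z \<partial>density (distr lborel borel (\<lambda>x. 0 + c *\<^sub>R x)) (\<lambda>_. \<bar>c\<bar>^DIM('b)))"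
    using lborel_affine[OF assms(2), of "0::'b"] by simp
  also have "\<dots> = ennreal (\<bar>c\<bar> ^ DIM('b)) * (\<integral>\<^sup>+z. f (c *\<^sub>R z) \<partial>lborel)"
    by (simp add: nn_integral_density nn_integral_distr nn_integral_cmult)
  finally show ?thesis .
qed

lemma nn_integral_gaussian:
  assumes "std_complex_gaussian P g" and [measurable]: "f \<in> borel_measurable borel"
  shows "(\<integral>\<^sup>+\<omega>. f (g \<omega>) \<partial>P) = (\<integral>\<^sup>+z. ennreal (exp (- (cmod z)\<^sup>2) / pi) * f z \<partial>lborel)"
  using distributed_nn_integral[of P lborel g "\<lambda>z. ennreal (exp (- (cmod z)\<^sup>2) / pi)" f] assms
  by (simp add: std_complex_gaussian_def)

lemma gaussian_measurable: "std_complex_gaussian P g \<Longrightarrow> g \<in> borel_measurable P"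
  using distributed_measurable[of P lborel g] by (auto simp: std_complex_gaussian_def)

lemma gaussian_nn_integral_uminus:
  assumes g: "std_complex_gaussian P g" and [measurable]: "f \<in> borel_measurable borel"
  shows "(\<integral>\<^sup>+\<omega>. f (- g \<omega>) \<partial>P) = (\<integral>\<^sup>+\<omega>. f (g \<omega>) \<partial>P)"
proof -
  have "(\<integral>\<^sup>+\<omega>. f (- g \<omega>) \<partial>P) = (\<integral>\<^sup>+z. ennreal (exp (- (cmod z)\<^sup>2) / pi) * f (- z) \<partial>lborel)"
    by (rule nn_integral_gaussian[OF g]) measurable
  also have "\<dots> = (\<integral>\<^sup>+z. ennreal (exp (- (cmod z)\<^sup>2) / pi) * f z \<partial>lborel)"
    using nn_integral_lborel_scale[of "\<lambda>z. ennreal (exp (- (cmod z)\<^sup>2) / pi) * f z" "-1"] by simp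
  also have "\<dots> = (\<integral>\<^sup>+\<omega>. f (g \<omega>) \<partial>P)" by (rule nn_integral_gaussian[OF g, symmetric]) measurable
  finally show ?thesis .
qed

lemma gaussian_distr_uminus:
  assumes g: "std_complex_gaussian P g"
  shows "distr P borel (\<lambda>\<omega>. - g \<omega>) = distr P borel g"
proof (rule measure_eqI)
  have [measurable]: "g \<in> borel_measurable P" by (rule gaussian_measurable[OF g])
  fix A assume "A \<in> sets (distr P borel (\<lambda>\<omega>. - g \<omega>))"
  then have [measurable]: "A \<in> sets borel" by simp
  have em: "emeasure (distr P borel h) A = (\<integral>\<^sup>+\<omega>. indicator A (h \<omega>) \<partial>P)"
    if [measurable]: "h \<in> borel_measurable P" for h
  proof -
    have "emeasure (distr P borel h) A = (\<integral>\<^sup>+z. indicator A z \<partial>distr P borel h)" by simp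
    also have "\<dots> = (\<integral>\<^sup>+\<omega>. indicator A (h \<omega>) \<partial>P)" by (rule nn_integral_distr) auto
    finally show ?thesis .
  qed
  have "emeasure (distr P borel (\<lambda>\<omega>. - g \<omega>)) A = (\<integral>\<^sup>+\<omega>. indicator A (- g \<omega>) \<partial>P)" by (rule em) measurable
  also have "\<dots> = (\<integral>\<^sup>+\<omega>. indicator A (g \<omega>) \<partial>P)" by (rule gaussian_nn_integral_uminus[OF g]) measurable
  also have "\<dots> = emeasure (distr P borel g) A" by (rule em[symmetric]) measurable
  finally show "emeasure (distr P borel (\<lambda>\<omega>. - g \<omega>)) A = emeasure (distr P borel g) A" .
qed simp

lemma gaussian_odd_integral:
  fixes f :: "complex \<Rightarrow> complex"
  assumes g: "std_complex_gaussian P g" and [measurable]: "f \<in> borel_measurable borel"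
    and odd: "\<And>z. f (- z) = - f z"
  shows "(\<integral>\<omega>. f (g \<omega>) \<partial>P) = 0"
proof -
  have [measurable]: "g \<in> borel_measurable P" by (rule gaussian_measurable[OF g])
  have "(\<integral>\<omega>. f (g \<omega>) \<partial>P) = (\<integral>z. f z \<partial>distr P borel g)" by (simp add: integral_distr)
  also have "\<dots> = (\<integral>z. f z \<partial>distr P borel (\<lambda>\<omega>. - g \<omega>))" by (simp add: gaussian_distr_uminus[OF g])
  also have "\<dots> = - (\<integral>\<omega>. f (g \<omega>) \<partial>P)" by (simp add: integral_distr odd)
  finally show ?thesis by simp
qed

text \<open>From \<open>x exp (-x) \<le> 2 exp (-x/2)\<close> with \<open>x = \<bar>z\<bar>\<^sup>2\<close>: the right-hand side is a Gaussian density again after rescaling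
  by \<open>sqrt 2\<close>, which doubles the integral. So no explicit Gaussian integral is computed.\<close>

lemma gaussian_second_moment:
  assumes P: "prob_space P" and g: "std_complex_gaussian P g"
  shows "(\<integral>\<^sup>+\<omega>. ennreal ((cmod (g \<omega>))\<^sup>2) \<partial>P) \<le> 4"
proof -
  interpret prob_space P by fact
  have x_le: "x * exp (- x) \<le> 2 * exp (- (x / 2))" for x :: real
  proof -
    have "x \<le> 2 * exp (x / 2)" using exp_ge_add_one_self[of "x / 2"] by linarith
    then have "x * exp (- x) \<le> 2 * exp (x / 2) * exp (- x)" by (intro mult_right_mono) auto
    also have "\<dots> = 2 * exp (- (x / 2))" by (simp flip: exp_add)
    finally show ?thesis .
  qed
  have "(\<integral>\<^sup>+\<omega>. ennreal ((cmod (g \<omega>))\<^sup>2) \<partial>P) = (\<integral>\<^sup>+z. ennreal (exp (- (cmod z)\<^sup>2) / pi) * ennreal ((cmod z)\<^sup>2) \<partial>lborel)"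
    by (rule nn_integral_gaussian[OF g]) measurable
  also have "\<dots> \<le> (\<integral>\<^sup>+z. 2 * ennreal (exp (- ((cmod z)\<^sup>2 / 2)) / pi) \<partial>lborel)"
  proof (rule nn_integral_mono)
    fix z :: complex
    have "exp (- (cmod z)\<^sup>2) / pi * (cmod z)\<^sup>2 \<le> 2 * (exp (- ((cmod z)\<^sup>2 / 2)) / pi)"
      using x_le[of "(cmod z)\<^sup>2"] by (simp add: field_simps)
    then show "ennreal (exp (- (cmod z)\<^sup>2) / pi) * ennreal ((cmod z)\<^sup>2) \<le> 2 * ennreal (exp (- ((cmod z)\<^sup>2 / 2)) / pi)"
      by (simp add: ennreal_mult[symmetric] ennreal_leI flip: ennreal_numeral)
  qed
  also have "\<dots> = 2 * (\<integral>\<^sup>+(z::complex). ennreal (exp (- ((cmod z)\<^sup>2 / 2)) / pi) \<partial>lborel)"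
    by (rule nn_integral_cmult) measurable
  also have "(\<integral>\<^sup>+(z::complex). ennreal (exp (- ((cmod z)\<^sup>2 / 2)) / pi) \<partial>lborel)
     = 2 * (\<integral>\<^sup>+(z::complex). ennreal (exp (- (cmod z)\<^sup>2) / pi) * 1 \<partial>lborel)"
    by (subst nn_integral_lborel_scale[where c="sqrt 2"]) (auto simp: power_mult_distrib norm_mult)
  also have "(\<integral>\<^sup>+(z::complex). ennreal (exp (- (cmod z)\<^sup>2) / pi) * 1 \<partial>lborel) = (\<integral>\<^sup>+\<omega>. 1 \<partial>P)"
    by (rule nn_integral_gaussian[OF g, symmetric]) measurable
  finally show ?thesis by (simp add: emeasure_space_1)
qed

lemma gaussian_integrable:
  assumes P: "prob_space P" and g: "std_complex_gaussian P g"
  shows "integrable P (\<lambda>\<omega>. (cmod (g \<omega>))\<^sup>2)" "integrable P g" "(\<integral>\<omega>. (cmod (g \<omega>))\<^sup>2 \<partial>P) \<le> 4"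
proof -
  interpret prob_space P by fact
  have [measurable]: "g \<in> borel_measurable P" by (rule gaussian_measurable[OF g])
  show i: "integrable P (\<lambda>\<omega>. (cmod (g \<omega>))\<^sup>2)"
    using gaussian_second_moment[OF P g] by (intro integrableI_bounded) (auto intro: le_less_trans)
  show "integrable P g"
  proof (rule Bochner_Integration.integrable_bound)
    show "integrable P (\<lambda>\<omega>. 1 + (cmod (g \<omega>))\<^sup>2)" using i by simp
    have "x \<le> 1 + x\<^sup>2" for x :: real
    proof -
      have "2 * x \<le> 1 + x\<^sup>2" using zero_le_power2[of "x - 1"] by (simp add: power2_diff)
      then show ?thesis using zero_le_power2[of x] by linarith
    qed
    then show "AE \<omega> in P. norm (g \<omega>) \<le> norm (1 + (cmod (g \<omega>))\<^sup>2)" by (auto intro!: AE_I2)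
  qed simp
  have "ennreal (\<integral>\<omega>. (cmod (g \<omega>))\<^sup>2 \<partial>P) \<le> ennreal 4"
    using gaussian_second_moment[OF P g] i by (simp add: nn_integral_eq_integral)
  then show "(\<integral>\<omega>. (cmod (g \<omega>))\<^sup>2 \<partial>P) \<le> 4" by (subst (asm) ennreal_le_iff) auto
qed

lemma gaussian_tail:
  assumes P: "prob_space P" and g: "std_complex_gaussian P g" and K: "0 < K"
  shows "(\<integral>\<omega>. cmod (g \<omega> - (if cmod (g \<omega>) \<le> K then g \<omega> else 0)) \<partial>P) \<le> 4 / K"
proof -
  have [measurable]: "g \<in> borel_measurable P" by (rule gaussian_measurable[OF g])
  note i = gaussian_integrable[OF P g]
  have "(\<integral>\<omega>. cmod (g \<omega> - (if cmod (g \<omega>) \<le> K then g \<omega> else 0)) \<partial>P) \<le> (\<integral>\<omega>. (cmod (g \<omega>))\<^sup>2 / K \<partial>P)"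
  proof (rule integral_mono)
    show "integrable P (\<lambda>\<omega>. cmod (g \<omega> - (if cmod (g \<omega>) \<le> K then g \<omega> else 0)))"
      using i(2) by (intro Bochner_Integration.integrable_bound[OF i(2)]) auto
    show "cmod (g \<omega> - (if cmod (g \<omega>) \<le> K then g \<omega> else 0)) \<le> (cmod (g \<omega>))\<^sup>2 / K" for \<omega>
      using K by (auto simp: field_simps power2_eq_square intro!: mult_right_mono)
  qed (use i in auto)
  also have "\<dots> \<le> 4 / K" using i(3) K by (simp add: divide_right_mono)
  finally show ?thesis .
qed

lemma gaussian_abs_mean_pos:
  assumes P: "prob_space P" and g: "std_complex_gaussian P g"
  shows "0 < (\<integral>\<omega>. cmod (g \<omega>) \<partial>P)"
proof -
  interpret prob_space P by fact
  have [measurable]: "g \<in> borel_measurable P" by (rule gaussian_measurable[OF g])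
  note i = gaussian_integrable[OF P g]
  have "(\<integral>\<omega>. cmod (g \<omega>) \<partial>P) \<noteq> 0"
  proof
    assume "(\<integral>\<omega>. cmod (g \<omega>) \<partial>P) = 0"
    then have "AE \<omega> in P. g \<omega> = 0"
      using i(2) by (subst (asm) integral_nonneg_eq_0_iff_AE) auto
    then have "(\<integral>\<^sup>+\<omega>. 1 \<partial>P) = (\<integral>\<^sup>+\<omega>. indicator {0} (g \<omega>) \<partial>P)"
      by (intro nn_integral_cong_AE) auto
    also have "(\<integral>\<^sup>+\<omega>. indicator {0} (g \<omega>) \<partial>P) = (\<integral>\<^sup>+z. ennreal (exp (- (cmod z)\<^sup>2) / pi) * indicator {0} z \<partial>lborel)"
      by (rule nn_integral_gaussian[OF g]) measurable
    also have "\<dots> = (\<integral>\<^sup>+(z::complex). 0 \<partial>lborel)"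
      using AE_lborel_singleton[of "0::complex"] by (intro nn_integral_cong_AE) (auto elim: eventually_mono)
    finally show False by (simp add: emeasure_space_1)
  qed
  then show ?thesis by (simp add: order_less_le)
qed

text \<open>The joint law of finitely or infinitely many independent variables is the product of the marginal laws.\<close>

lemma (in prob_space) nn_integral_indep_eq:
  fixes X Y :: "'i \<Rightarrow> 'a \<Rightarrow> complex"
  assumes I: "I \<noteq> {}"
    and X: "indep_vars (\<lambda>_. borel) X I" and Y: "indep_vars (\<lambda>_. borel) Y I"
    and eq: "\<And>i. i \<in> I \<Longrightarrow> distr M borel (X i) = distr M borel (Y i)"
    and F[measurable]: "F \<in> borel_measurable (PiM I (\<lambda>_. borel))"
  shows "(\<integral>\<^sup>+\<omega>. F (\<lambda>i\<in>I. X i \<omega>) \<partial>M) = (\<integral>\<^sup>+\<omega>. F (\<lambda>i\<in>I. Y i \<omega>) \<partial>M)"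
proof -
  have rv: "X i \<in> borel_measurable M" "Y i \<in> borel_measurable M" if "i \<in> I" for i
    using X Y that by (auto simp: indep_vars_def)
  have m: "(\<lambda>\<omega>. \<lambda>i\<in>I. X i \<omega>) \<in> measurable M (PiM I (\<lambda>_. borel))"
     "(\<lambda>\<omega>. \<lambda>i\<in>I. Y i \<omega>) \<in> measurable M (PiM I (\<lambda>_. borel))"
    using rv by (auto intro!: measurable_restrict)
  have "distr M (PiM I (\<lambda>_. borel)) (\<lambda>\<omega>. \<lambda>i\<in>I. X i \<omega>) = PiM I (\<lambda>i. distr M borel (X i))"
    using indep_vars_iff_distr_eq_PiM'[OF I rv(1)] X by simp
  also have "\<dots> = PiM I (\<lambda>i. distr M borel (Y i))" by (rule PiM_cong) (auto simp: eq)
  also have "\<dots> = distr M (PiM I (\<lambda>_. borel)) (\<lambda>\<omega>. \<lambda>i\<in>I. Y i \<omega>)"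
    using indep_vars_iff_distr_eq_PiM'[OF I rv(2)] Y by simp
  finally show ?thesis
    using nn_integral_distr[OF m(1), of F] nn_integral_distr[OF m(2), of F] F by simp
qed

section \<open>Tensor powers control random sums\<close>

text \<open>Off a null set, all the finitely many signed sums are bounded pointwise by their norms. So
  the norms can be replaced by suprema over the set \<open>V\<close> of vectors \<open>(\<psi>\<^sub>n(t))\<^sub>n\<close>, to which the contraction
  for products of vectors applies.\<close>

lemma Rademacher_tensor_contraction:
  fixes \<psi> :: "'i \<Rightarrow> 'a \<Rightarrow> complex"
  assumes m: "prob_space m" and fin: "finite I" and c: "\<And>n. n \<in> I \<Longrightarrow> 0 \<le> c n"
    and [measurable]: "\<And>n. \<psi> n \<in> borel_measurable m"
    and bd: "\<And>n. AE t in m. cmod (\<psi> n t) \<le> 1"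
  shows "(\<Sum>X\<in>Pow I. Linf_norm (PiM {..k} (\<lambda>_. m))
            (\<lambda>t. \<Sum>n\<in>I. of_real (sgn_of X n * c n) * (\<Prod>i\<le>k. \<psi> n (t i))))
     \<le> ennreal (32 ^ k) * (\<Sum>X\<in>Pow I. Linf_norm m (\<lambda>t. \<Sum>n\<in>I. of_real (sgn_of X n * c n) * \<psi> n t))"
proof -
  define h where "h X t = (\<Sum>n\<in>I. of_real (sgn_of X n * c n) * \<psi> n t)" for X t
  define L where "L X = enn2real (Linf_norm m (h X))" for X
  have [measurable]: "h X \<in> borel_measurable m" for X unfolding h_def by measurable
  have bd_all: "AE t in m. \<forall>n\<in>I. cmod (\<psi> n t) \<le> 1"
    by (rule AE_ball_countable') (use fin bd in \<open>auto intro: countable_finite\<close>)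
  have "AE t in m. cmod (h X t) \<le> (\<Sum>n\<in>I. c n)" for X
    using bd_all
  proof eventually_elim
    case (elim t)
    have "cmod (h X t) \<le> (\<Sum>n\<in>I. c n * 1)"
      unfolding h_def using elim c
      by (intro order_trans[OF norm_sum sum_mono]) (auto simp: norm_mult sgn_of_def abs_mult intro!: mult_left_le)
    then show ?case by simp
  qed
  then have "Linf_norm m (h X) \<le> ennreal (\<Sum>n\<in>I. c n)" for X by (intro Linf_norm_le) auto
  then have L: "Linf_norm m (h X) = ennreal (L X)" for X
    unfolding L_def using le_less_trans[OF _ ennreal_less_top] by (intro ennreal_enn2real[symmetric]) blast
  have L0: "0 \<le> L X" for X by (simp add: L_def)
  define T0 where "T0 = {t. (\<forall>n\<in>I. cmod (\<psi> n t) \<le> 1) \<and> (\<forall>X\<in>Pow I. cmod (h X t) \<le> L X)}"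
  have "AE t in m. \<forall>X\<in>Pow I. cmod (h X t) \<le> L X"
    by (rule AE_ball_countable', rule Linf_norm_AE) (use fin L L0 in \<open>auto intro: countable_finite\<close>)
  then have T0: "AE t in m. t \<in> T0" using bd_all unfolding T0_def by eventually_elim auto
  \<comment> \<open>The zero vector is the point that the contraction asks for; it does not change the suprema.\<close>
  define V where "V = insert (\<lambda>_. 0) ((\<lambda>t n. if n \<in> I then \<psi> n t else 0) ` T0)"
  have V: "\<And>n v. n \<in> I \<Longrightarrow> v \<in> V \<Longrightarrow> cmod (v n) \<le> 1" "(\<lambda>_. 0) \<in> V"
    by (auto simp: V_def T0_def)
  have V_le: "signed_sup I c V X \<le> L X" if "X \<in> Pow I" for X
    unfolding signed_sup_def
  proof (rule cSUP_least)
    fix v assume "v \<in> V"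
    then consider "v = (\<lambda>_. 0)" | t where "t \<in> T0" "v = (\<lambda>n. if n \<in> I then \<psi> n t else 0)" by (auto simp: V_def)
    then show "cmod (\<Sum>n\<in>I. of_real (sgn_of X n * c n) * v n) \<le> L X"
    proof cases
      case (2 t)
      then have "(\<Sum>n\<in>I. of_real (sgn_of X n * c n) * v n) = h X t"
        unfolding h_def by (intro sum.cong) auto
      then show ?thesis using 2(1) that by (auto simp: T0_def)
    qed (simp add: L0)
  qed (use V in auto)
  have PV: "cmod (u n) \<le> 1" if "n \<in> I" "u \<in> prod_vectors V k" for n u
    using prod_vectors_le_1[of I V, OF _ that] V(1) by blast
  have PV0: "(\<lambda>_. 0) \<in> prod_vectors V k" by (rule zero_in_prod_vectors[OF V(2)])
  have R0: "0 \<le> signed_sup I c (prod_vectors V k) X" for X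
    by (rule order_trans[OF norm_ge_zero signed_sup_upper[where v="\<lambda>_. 0"]]) (use fin c PV PV0 in auto)
  have tensor: "Linf_norm (PiM {..k} (\<lambda>_. m)) (\<lambda>t. \<Sum>n\<in>I. of_real (sgn_of X n * c n) * (\<Prod>i\<le>k. \<psi> n (t i)))
      \<le> ennreal (signed_sup I c (prod_vectors V k) X)" for X
  proof (rule Linf_norm_le)
    have "AE t in PiM {..k} (\<lambda>_. m). \<forall>i\<in>{..k}. t i \<in> T0"
      by (rule AE_ball_countable', rule AE_PiM_component) (use m T0 in auto)
    then show "AE t in PiM {..k} (\<lambda>_. m). cmod (\<Sum>n\<in>I. of_real (sgn_of X n * c n) * (\<Prod>i\<le>k. \<psi> n (t i)))
        \<le> signed_sup I c (prod_vectors V k) X"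
    proof eventually_elim
      case (elim t)
      define u where "u n = (\<Prod>i\<le>k. if n \<in> I then \<psi> n (t i) else 0)" for n
      have "u \<in> prod_vectors V k"
        unfolding u_def[abs_def] by (rule prod_in_prod_vectors) (use elim in \<open>auto simp: V_def\<close>)
      then have "cmod (\<Sum>n\<in>I. of_real (sgn_of X n * c n) * u n) \<le> signed_sup I c (prod_vectors V k) X"
        using fin c PV by (intro signed_sup_upper) auto
      moreover have "(\<Sum>n\<in>I. of_real (sgn_of X n * c n) * u n) = (\<Sum>n\<in>I. of_real (sgn_of X n * c n) * (\<Prod>i\<le>k. \<psi> n (t i)))"
        by (rule sum.cong) (auto simp: u_def)
      ultimately show ?case by simp
    qed
  qed measurable
  have "(\<Sum>X\<in>Pow I. Linf_norm (PiM {..k} (\<lambda>_. m)) (\<lambda>t. \<Sum>n\<in>I. of_real (sgn_of X n * c n) * (\<Prod>i\<le>k. \<psi> n (t i))))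
     \<le> (\<Sum>X\<in>Pow I. ennreal (signed_sup I c (prod_vectors V k) X))"
    by (rule sum_mono[OF tensor])
  also have "\<dots> = ennreal (\<Sum>X\<in>Pow I. signed_sup I c (prod_vectors V k) X)"
    using R0 by (intro sum_ennreal) auto
  also have "\<dots> \<le> ennreal (32 ^ k * (\<Sum>X\<in>Pow I. L X))"
  proof (rule ennreal_leI)
    have "(\<Sum>X\<in>Pow I. signed_sup I c (prod_vectors V k) X) \<le> 32 ^ k * (\<Sum>X\<in>Pow I. signed_sup I c V X)"
      using V by (intro signed_sup_prod_vectors fin c) auto
    also have "\<dots> \<le> 32 ^ k * (\<Sum>X\<in>Pow I. L X)"
      using V_le by (intro mult_left_mono sum_mono) auto
    finally show "(\<Sum>X\<in>Pow I. signed_sup I c (prod_vectors V k) X) \<le> 32 ^ k * (\<Sum>X\<in>Pow I. L X)" .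
  qed
  also have "\<dots> = ennreal (32 ^ k) * (\<Sum>X\<in>Pow I. ennreal (L X))"
    using L0 by (simp add: ennreal_mult sum_nonneg sum_ennreal)
  finally show ?thesis unfolding L[symmetric] h_def .
qed

lemma tensor_SidonE:
  assumes "tensor_Sidon k m \<psi>"
  obtains \<alpha> where "0 < \<alpha>" "\<And>(a :: nat \<Rightarrow> complex) J. finite J \<Longrightarrow> ennreal (\<Sum>n\<in>J. cmod (a n))
      \<le> ennreal \<alpha> * Linf_norm (PiM {..<k} (\<lambda>_. m)) (\<lambda>t. \<Sum>n\<in>J. a n * (\<Prod>i<k. \<psi> n (t i)))"
proof -
  obtain \<alpha> :: real where \<alpha>: "\<And>a :: nat \<Rightarrow> complex. finite {n. a n \<noteq> 0} \<Longrightarrow> ennreal (\<Sum>n | a n \<noteq> 0. cmod (a n))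
      \<le> ennreal \<alpha> * Linf_norm (PiM {..<k} (\<lambda>_. m)) (\<lambda>t. \<Sum>n | a n \<noteq> 0. a n * (\<Prod>i<k. \<psi> n (t i)))"
    using assms unfolding tensor_Sidon_def by blast
  show ?thesis
  proof (rule that[of "max 1 \<alpha>"])
    fix a :: "nat \<Rightarrow> complex" and J :: "nat set" assume J: "finite J"
    define b where "b n = (if n \<in> J then a n else 0)" for n
    have supp: "{n. b n \<noteq> 0} \<subseteq> J" by (auto simp: b_def)
    have sums: "(\<Sum>n | b n \<noteq> 0. cmod (b n)) = (\<Sum>n\<in>J. cmod (a n))"
      "(\<Sum>n | b n \<noteq> 0. b n * f n) = (\<Sum>n\<in>J. a n * f n)" for f
      by (rule sum.mono_neutral_cong_left; use J supp in \<open>auto simp: b_def\<close>)+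
    have "ennreal (\<Sum>n\<in>J. cmod (a n))
      \<le> ennreal \<alpha> * Linf_norm (PiM {..<k} (\<lambda>_. m)) (\<lambda>t. \<Sum>n\<in>J. a n * (\<Prod>i<k. \<psi> n (t i)))"
      using \<alpha>[of b] finite_subset[OF supp J] unfolding sums by simp
    also have "\<dots> \<le> ennreal (max 1 \<alpha>) * Linf_norm (PiM {..<k} (\<lambda>_. m)) (\<lambda>t. \<Sum>n\<in>J. a n * (\<Prod>i<k. \<psi> n (t i)))"
      by (intro mult_right_mono ennreal_leI) auto
    finally show "ennreal (\<Sum>n\<in>J. cmod (a n))
      \<le> ennreal (max 1 \<alpha>) * Linf_norm (PiM {..<k} (\<lambda>_. m)) (\<lambda>t. \<Sum>n\<in>J. a n * (\<Prod>i<k. \<psi> n (t i)))" .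
  qed simp
qed

text \<open>The phase of \<open>x\<^sub>n\<close> is moved into \<open>\<psi>' n\<close>, so that the contraction applies with the nonnegative weights
  \<open>c n = \<bar>x\<^sub>n\<bar> B\<close>. The tensor product of \<open>\<psi>' n\<close> then carries a power of this phase, which the tensor
  inequality ignores because it allows arbitrary coefficients.\<close>

lemma tensor_Sidon_imp_signed_average:
  fixes x :: "nat \<Rightarrow> complex"
  assumes m: "prob_space m" and [measurable]: "\<And>n. \<psi> n \<in> borel_measurable m"
    and B: "1 \<le> B" "\<And>n. AE t in m. cmod (\<psi> n t) \<le> B"
    and \<alpha>: "0 < \<alpha>" "\<And>a J. finite J \<Longrightarrow> ennreal (\<Sum>n\<in>J. cmod (a n))
      \<le> ennreal \<alpha> * Linf_norm (PiM {..<Suc k} (\<lambda>_. m)) (\<lambda>t. \<Sum>n\<in>J. a n * (\<Prod>i<Suc k. \<psi> n (t i)))"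
    and J: "finite J"
  shows "ennreal (card (Pow J) * (\<Sum>n\<in>J. cmod (x n)))
     \<le> ennreal (\<alpha> * 32 ^ k * B ^ k) * (\<Sum>X\<in>Pow J. Linf_norm m (\<lambda>t. \<Sum>n\<in>J. of_real (sgn_of X n) * x n * \<psi> n t))"
proof -
  define c where "c n = cmod (x n) * B" for n
  define \<psi>' where "\<psi>' n t = sgn (x n) * \<psi> n t / of_real B" for n t
  define a where "a X n = of_real (sgn_of X n * c n) * (sgn (x n) / of_real B) ^ Suc k" for X n
  have [measurable]: "\<psi>' n \<in> borel_measurable m" for n unfolding \<psi>'_def by measurable
  have bd: "AE t in m. cmod (\<psi>' n t) \<le> 1" for n
    using B(2)[of n] by eventually_elim (use B(1) in \<open>auto simp: \<psi>'_def norm_mult norm_divide norm_sgn\<close>)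
  have cmod_a: "cmod (a X n) = cmod (x n) / B ^ k" for X n
    using B(1) by (auto simp: a_def c_def norm_mult norm_power norm_divide norm_sgn sgn_of_def power_divide field_simps)
  have tens: "a X n * (\<Prod>i<Suc k. \<psi> n (t i)) = of_real (sgn_of X n * c n) * (\<Prod>i\<le>k. \<psi>' n (t i))" for X n t
    by (simp add: a_def \<psi>'_def lessThan_Suc_atMost prod_dividef prod.distrib power_divide field_simps)
  have lin: "of_real (sgn_of X n * c n) * \<psi>' n t = of_real (sgn_of X n) * x n * \<psi> n t" for X n t
    using B(1) by (simp add: c_def \<psi>'_def sgn_eq)
  have "ennreal (card (Pow J) * (\<Sum>n\<in>J. cmod (x n) / B ^ k)) = (\<Sum>X\<in>Pow J. ennreal (\<Sum>n\<in>J. cmod (a X n)))"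
    using B(1) by (simp add: cmod_a ennreal_mult sum_nonneg ennreal_of_nat_eq_real_of_nat)
  also have "\<dots> \<le> (\<Sum>X\<in>Pow J. ennreal \<alpha> * Linf_norm (PiM {..<Suc k} (\<lambda>_. m)) (\<lambda>t. \<Sum>n\<in>J. a X n * (\<Prod>i<Suc k. \<psi> n (t i))))"
    by (rule sum_mono[OF \<alpha>(2)[OF J]])
  also have "\<dots> = ennreal \<alpha> * (\<Sum>X\<in>Pow J. Linf_norm (PiM {..k} (\<lambda>_. m)) (\<lambda>t. \<Sum>n\<in>J. of_real (sgn_of X n * c n) * (\<Prod>i\<le>k. \<psi>' n (t i))))"
    unfolding tens by (simp add: sum_distrib_left lessThan_Suc_atMost)
  also have "\<dots> \<le> ennreal \<alpha> * (ennreal (32 ^ k) * (\<Sum>X\<in>Pow J. Linf_norm m (\<lambda>t. \<Sum>n\<in>J. of_real (sgn_of X n * c n) * \<psi>' n t)))"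
    by (intro mult_left_mono Rademacher_tensor_contraction m J bd) (use B(1) in \<open>auto simp: c_def\<close>)
  finally have *: "ennreal (card (Pow J) * (\<Sum>n\<in>J. cmod (x n) / B ^ k))
     \<le> ennreal \<alpha> * (ennreal (32 ^ k) * (\<Sum>X\<in>Pow J. Linf_norm m (\<lambda>t. \<Sum>n\<in>J. of_real (sgn_of X n) * x n * \<psi> n t)))"
    unfolding lin .
  have "ennreal (card (Pow J) * (\<Sum>n\<in>J. cmod (x n))) = ennreal (B ^ k) * ennreal (card (Pow J) * (\<Sum>n\<in>J. cmod (x n) / B ^ k))"
    using B(1) by (simp add: ennreal_mult[symmetric] sum_nonneg sum_divide_distrib[symmetric])
  also have "\<dots> \<le> ennreal (B ^ k) * (ennreal \<alpha> * (ennreal (32 ^ k) * (\<Sum>X\<in>Pow J. Linf_norm m (\<lambda>t. \<Sum>n\<in>J. of_real (sgn_of X n) * x n * \<psi> n t))))"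
    by (rule mult_left_mono[OF *]) simp
  also have "\<dots> = ennreal (\<alpha> * 32 ^ k * B ^ k) * (\<Sum>X\<in>Pow J. Linf_norm m (\<lambda>t. \<Sum>n\<in>J. of_real (sgn_of X n) * x n * \<psi> n t))"
    using B(1) \<alpha>(1) by (simp add: ennreal_mult mult_ac)
  finally show ?thesis .
qed

text \<open>The signed inequality holds for each realisation of the Gaussian variables. After integration, all sign patterns
  contribute the same amount, because \<open>(\<plusminus> g\<^sub>n)\<close> has the same joint law as \<open>(g\<^sub>n)\<close>.\<close>

lemma tensor_Sidon_imp_randomly_Sidon:
  assumes g: "iid_std_complex_gaussian P g" and m: "prob_space m" and bdd: "bounded_in_Linf m \<psi>"
    and tensor: "tensor_Sidon (Suc k) m \<psi>"
  shows "randomly_Sidon P g m \<psi>"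
proof -
  interpret P: prob_space P using g by (simp add: iid_std_complex_gaussian_def)
  interpret m: prob_space m by fact
  have gauss: "std_complex_gaussian P (g n)" and ind: "P.indep_vars (\<lambda>_. borel) g UNIV" for n
    using g by (auto simp: iid_std_complex_gaussian_def)
  have [measurable]: "g n \<in> borel_measurable P" for n by (rule gaussian_measurable[OF gauss])
  obtain B where B: "1 \<le> B" and [measurable]: "\<And>n. \<psi> n \<in> borel_measurable m"
      and B_le: "\<And>n. AE t in m. cmod (\<psi> n t) \<le> B"
    by (rule bounded_in_LinfE[OF bdd]) blast
  obtain \<alpha> where \<alpha>: "0 < \<alpha>" "\<And>(a :: nat \<Rightarrow> complex) J. finite J \<Longrightarrow> ennreal (\<Sum>n\<in>J. cmod (a n))
      \<le> ennreal \<alpha> * Linf_norm (PiM {..<Suc k} (\<lambda>_. m)) (\<lambda>t. \<Sum>n\<in>J. a n * (\<Prod>i<Suc k. \<psi> n (t i)))"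
    by (rule tensor_SidonE[OF tensor]) blast
  define \<mu> where "\<mu> = (\<integral>\<omega>. cmod (g 0 \<omega>) \<partial>P)"
  have \<mu>: "0 < \<mu>" unfolding \<mu>_def by (rule gaussian_abs_mean_pos[OF P.prob_space_axioms gauss])
  have \<mu>_eq: "(\<integral>\<^sup>+\<omega>. ennreal (cmod (g n \<omega>)) \<partial>P) = ennreal \<mu>" for n
  proof -
    have "(\<integral>\<^sup>+\<omega>. ennreal (cmod (g n \<omega>)) \<partial>P) = (\<integral>\<^sup>+\<omega>. ennreal (cmod (g 0 \<omega>)) \<partial>P)"
      using nn_integral_gaussian[OF gauss, of "\<lambda>z. ennreal (cmod z)"] by simp
    also have "\<dots> = ennreal \<mu>"
      unfolding \<mu>_def using gaussian_integrable(2)[OF P.prob_space_axioms gauss] by (intro nn_integral_eq_integral) auto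
    finally show ?thesis .
  qed
  define D where "D = \<alpha> * 32 ^ k * B ^ k"
  have D: "0 < D" using \<alpha>(1) B by (simp add: D_def)
  show ?thesis unfolding randomly_Sidon_def
  proof (intro exI[of _ "D / \<mu>"] allI impI)
    fix a :: "nat \<Rightarrow> complex" assume fin: "finite {n. a n \<noteq> 0}"
    define J where "J = {n. a n \<noteq> 0}"
    have J: "finite J" using fin by (simp add: J_def)
    define F where "F y = Linf_norm m (\<lambda>t. \<Sum>n\<in>J. y n * a n * \<psi> n t)" for y
    have F_meas[measurable]: "F \<in> borel_measurable (PiM J (\<lambda>_. borel))"
      unfolding F_def by (rule borel_measurable_Linf_norm[OF m.sigma_finite_measure_axioms]) measurable
    have F_restrict: "F (\<lambda>i\<in>J. y i) = F y" for y
      unfolding F_def by (intro arg_cong[where f="Linf_norm m"] ext sum.cong) auto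
    define E where "E = (\<integral>\<^sup>+\<omega>. F (\<lambda>n. g n \<omega>) \<partial>P)"
    have E_signed: "(\<integral>\<^sup>+\<omega>. F (\<lambda>n. of_real (sgn_of X n) * g n \<omega>) \<partial>P) = E" for X
    proof (cases "J = {}")
      case False
      have "(\<integral>\<^sup>+\<omega>. F (\<lambda>i\<in>J. of_real (sgn_of X i) * g i \<omega>) \<partial>P) = (\<integral>\<^sup>+\<omega>. F (\<lambda>i\<in>J. g i \<omega>) \<partial>P)"
      proof (rule P.nn_integral_indep_eq[OF False _ _ _ F_meas])
        show "P.indep_vars (\<lambda>_. borel) g J" using ind by (rule P.indep_vars_subset) simp
        then show "P.indep_vars (\<lambda>_. borel) (\<lambda>i \<omega>. of_real (sgn_of X i) * g i \<omega>) J"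
          by (rule P.indep_vars_compose2) measurable
        show "distr P borel (\<lambda>\<omega>. of_real (sgn_of X i) * g i \<omega>) = distr P borel (g i)" for i
          using gaussian_distr_uminus[OF gauss, of i] by (simp add: sgn_of_def)
      qed
      then show ?thesis unfolding F_restrict E_def .
    qed (simp add: F_def E_def)
    have F_signed_meas: "(\<lambda>\<omega>. F (\<lambda>n. of_real (sgn_of X n) * g n \<omega>)) \<in> borel_measurable P" for X
    proof -
      have "(\<lambda>\<omega>. F (\<lambda>i\<in>J. of_real (sgn_of X i) * g i \<omega>)) \<in> borel_measurable P" by measurable
      then show ?thesis unfolding F_restrict .
    qed
    have "ennreal (card (Pow J) * (\<mu> * (\<Sum>n\<in>J. cmod (a n))))
       = ennreal (card (Pow J)) * (\<Sum>n\<in>J. ennreal (cmod (a n)) * ennreal \<mu>)"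
      using \<mu> by (simp add: ennreal_mult sum_nonneg sum_ennreal flip: sum_distrib_right) (simp add: mult_ac)
    also have "\<dots> = (\<integral>\<^sup>+\<omega>. ennreal (card (Pow J)) * (\<Sum>n\<in>J. ennreal (cmod (a n)) * ennreal (cmod (g n \<omega>))) \<partial>P)"
      by (simp add: nn_integral_cmult nn_integral_sum \<mu>_eq)
    also have "\<dots> = (\<integral>\<^sup>+\<omega>. ennreal (card (Pow J) * (\<Sum>n\<in>J. cmod (g n \<omega> * a n))) \<partial>P)"
      by (intro nn_integral_cong)
         (simp add: ennreal_mult sum_nonneg norm_mult mult.commute flip: sum_ennreal)
    also have "\<dots> \<le> (\<integral>\<^sup>+\<omega>. ennreal D * (\<Sum>X\<in>Pow J. F (\<lambda>n. of_real (sgn_of X n) * g n \<omega>)) \<partial>P)"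
      unfolding D_def F_def mult.assoc[of "of_real _" "g _ _" "a _"]
      by (intro nn_integral_mono tensor_Sidon_imp_signed_average[OF m _ B B_le \<alpha> J]) measurable
    also have "\<dots> = ennreal D * (\<Sum>X\<in>Pow J. E)"
      using F_signed_meas by (simp add: nn_integral_cmult nn_integral_sum E_signed)
    also have "\<dots> = ennreal (card (Pow J)) * (ennreal D * E)"
      by (simp add: ennreal_of_nat_eq_real_of_nat mult_ac)
    finally have "ennreal (card (Pow J)) * ennreal (\<mu> * (\<Sum>n\<in>J. cmod (a n))) \<le> ennreal (card (Pow J)) * (ennreal D * E)"
      using \<mu> by (simp add: ennreal_mult sum_nonneg)
    moreover have "card (Pow J) \<noteq> 0" using J by (simp add: card_Pow)
    ultimately have **: "ennreal (\<mu> * (\<Sum>n\<in>J. cmod (a n))) \<le> ennreal D * E"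
      by (subst (asm) ennreal_mult_le_mult_iff) auto
    have "ennreal (\<Sum>n\<in>J. cmod (a n)) = ennreal (1 / \<mu>) * ennreal (\<mu> * (\<Sum>n\<in>J. cmod (a n)))"
      using \<mu> by (simp add: ennreal_mult[symmetric] sum_nonneg)
    also have "\<dots> \<le> ennreal (1 / \<mu>) * (ennreal D * E)" by (rule mult_left_mono[OF **]) simp
    also have "\<dots> = ennreal (D / \<mu>) * E"
      using \<mu> D by (simp add: mult.assoc[symmetric] ennreal_mult[symmetric])
    finally show "ennreal (\<Sum>n | a n \<noteq> 0. cmod (a n))
      \<le> ennreal (D / \<mu>) * (\<integral>\<^sup>+\<omega>. Linf_norm m (\<lambda>t. \<Sum>n | a n \<noteq> 0. g n \<omega> * a n * \<psi> n t) \<partial>P)"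
      by (simp add: E_def F_def J_def)
  qed
qed

section \<open>Raising the tensor power\<close>

lemma bounded_integrable:
  fixes f :: "'a \<Rightarrow> complex"
  assumes "prob_space m" "f \<in> borel_measurable m" "AE t in m. cmod (f t) \<le> B"
  shows "integrable m f"
proof -
  interpret prob_space m by fact
  show ?thesis using assms by (intro integrable_const_bound[where B=B]) auto
qed

text \<open>\<open>1 = \<integral> \<psi>\<^sub>n cnj \<phi>\<^sub>n \<le> B' \<integral> \<bar>\<psi>\<^sub>n\<bar>\<close>.\<close>

lemma biorthogonal_integral_norm_ge:
  assumes m: "prob_space m" and [measurable]: "\<And>n. \<psi> n \<in> borel_measurable m" "\<And>n. \<phi> n \<in> borel_measurable m"
    and B: "\<And>n. AE t in m. cmod (\<psi> n t) \<le> B" and B': "0 < B'" "\<And>n. AE t in m. cmod (\<phi> n t) \<le> B'"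
    and bio: "biorthogonal m \<psi> \<phi>"
  shows "1 / B' \<le> (\<integral>t. cmod (\<psi> n t) \<partial>m)"
proof -
  have int: "integrable m (\<lambda>t. cmod (\<psi> n t))"
    by (intro integrable_norm bounded_integrable[OF m _ B]) measurable
  have "1 = cmod (\<integral>t. \<psi> n t * cnj (\<phi> n t) \<partial>m)" using bio by (simp add: biorthogonal_def)
  also have "\<dots> \<le> (\<integral>t. cmod (\<psi> n t * cnj (\<phi> n t)) \<partial>m)" by (rule integral_norm_bound)
  also have "\<dots> \<le> (\<integral>t. cmod (\<psi> n t) * B' \<partial>m)"
  proof (rule integral_mono_AE)
    have le: "AE t in m. cmod (\<psi> n t * cnj (\<phi> n t)) \<le> cmod (\<psi> n t) * B'"
      using B'(2)[of n] by eventually_elim (simp add: norm_mult mult_left_mono)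
    then show "AE t in m. cmod (\<psi> n t * cnj (\<phi> n t)) \<le> cmod (\<psi> n t) * B'" .
    show i: "integrable m (\<lambda>t. cmod (\<psi> n t) * B')" using int by simp
    have [measurable]: "cnj \<in> borel_measurable borel"
      by (intro borel_measurable_continuous_onI continuous_intros)
    show "integrable m (\<lambda>t. cmod (\<psi> n t * cnj (\<phi> n t)))"
      by (rule Bochner_Integration.integrable_bound[OF i]) (use le B'(1) in auto)
  qed
  also have "\<dots> = (\<integral>t. cmod (\<psi> n t) \<partial>m) * B'" by simp
  finally show ?thesis using B'(1) by (simp add: field_simps)
qed

text \<open>Freezing the last variable at \<open>y\<close> changes the coefficients to \<open>a\<^sub>n \<psi>\<^sub>n(y)\<close>. So
  \<open>\<Sum> \<bar>a\<^sub>n\<bar> \<bar>\<psi>\<^sub>n(y)\<bar>\<close> is bounded for almost every \<open>y\<close>, and integration over \<open>y\<close> finishes the proof.\<close>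

lemma tensor_Sidon_Suc:
  assumes m: "prob_space m" and psi: "bounded_in_Linf m \<psi>" and phi: "bounded_in_Linf m \<phi>"
    and bio: "biorthogonal m \<psi> \<phi>" and tensor: "tensor_Sidon k m \<psi>"
  shows "tensor_Sidon (Suc k) m \<psi>"
proof -
  interpret prob_space m by fact
  obtain B where B: "1 \<le> B" and [measurable]: "\<And>n. \<psi> n \<in> borel_measurable m"
      and B_le: "\<And>n. AE t in m. cmod (\<psi> n t) \<le> B"
    by (rule bounded_in_LinfE[OF psi]) blast
  obtain B' where B': "1 \<le> B'" and [measurable]: "\<And>n. \<phi> n \<in> borel_measurable m"
      and B'_le: "\<And>n. AE t in m. cmod (\<phi> n t) \<le> B'"
    by (rule bounded_in_LinfE[OF phi]) blast
  obtain \<alpha> where \<alpha>: "0 < \<alpha>" "\<And>(a :: nat \<Rightarrow> complex) J. finite J \<Longrightarrow> ennreal (\<Sum>n\<in>J. cmod (a n))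
      \<le> ennreal \<alpha> * Linf_norm (PiM {..<k} (\<lambda>_. m)) (\<lambda>t. \<Sum>n\<in>J. a n * (\<Prod>i<k. \<psi> n (t i)))"
    by (rule tensor_SidonE[OF tensor]) blast
  have low: "1 / B' \<le> (\<integral>t. cmod (\<psi> n t) \<partial>m)" for n
    by (rule biorthogonal_integral_norm_ge[OF m _ _ B_le _ B'_le bio]) (use B' in auto)
  have int: "integrable m (\<lambda>t. cmod (\<psi> n t))" for n
    by (intro integrable_norm bounded_integrable[OF m _ B_le]) measurable
  show ?thesis unfolding tensor_Sidon_def
  proof (intro exI[of _ "\<alpha> * B'"] allI impI)
    fix a :: "nat \<Rightarrow> complex" assume fin: "finite {n. a n \<noteq> 0}"
    define J where "J = {n. a n \<noteq> 0}"
    have J: "finite J" using fin by (simp add: J_def)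
    define S where "S = Linf_norm (PiM {..<Suc k} (\<lambda>_. m)) (\<lambda>t. \<Sum>n\<in>J. a n * (\<Prod>i<Suc k. \<psi> n (t i)))"
    have "ennreal (\<Sum>n\<in>J. cmod (a n)) \<le> ennreal (\<alpha> * B') * S"
    proof (cases S)
      case (real s)
      have "AE t in PiM {..<Suc k} (\<lambda>_. m). cmod (\<Sum>n\<in>J. a n * (\<Prod>i<Suc k. \<psi> n (t i))) \<le> s"
        by (rule tensor_Linf_norm_AE[OF m]) (use real in \<open>auto simp: S_def\<close>)
      then have "AE y in m. AE x in PiM {..<k} (\<lambda>_. m). cmod (\<Sum>n\<in>J. a n * (\<Prod>i<Suc k. \<psi> n ((x(k := y)) i))) \<le> s"
        by (rule AE_PiM_lessThan_Suc[OF m])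
      then have "AE y in m. (\<Sum>n\<in>J. cmod (a n) * cmod (\<psi> n y)) \<le> \<alpha> * s"
      proof eventually_elim
        case (elim y)
        have "AE x in PiM {..<k} (\<lambda>_. m). cmod (\<Sum>n\<in>J. (a n * \<psi> n y) * (\<Prod>i<k. \<psi> n (x i))) \<le> s"
          using elim by (simp add: mult_ac)
        then have "Linf_norm (PiM {..<k} (\<lambda>_. m)) (\<lambda>x. \<Sum>n\<in>J. (a n * \<psi> n y) * (\<Prod>i<k. \<psi> n (x i))) \<le> ennreal s"
          by (intro Linf_norm_le) measurable
        then have "ennreal (\<Sum>n\<in>J. cmod (a n * \<psi> n y)) \<le> ennreal \<alpha> * ennreal s"
          by (intro order_trans[OF \<alpha>(2)[OF J, of "\<lambda>n. a n * \<psi> n y"]] mult_left_mono) auto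
        then show ?case
          using \<alpha>(1) real(1) by (simp add: ennreal_mult[symmetric] ennreal_le_iff norm_mult)
      qed
      then have "(\<integral>y. (\<Sum>n\<in>J. cmod (a n) * cmod (\<psi> n y)) \<partial>m) \<le> (\<integral>y. \<alpha> * s \<partial>m)"
        using int by (intro integral_mono_AE) auto
      then have "(\<Sum>n\<in>J. cmod (a n) * (\<integral>y. cmod (\<psi> n y) \<partial>m)) \<le> \<alpha> * s"
        using int by (simp add: prob_space Bochner_Integration.integral_sum)
      moreover have "(\<Sum>n\<in>J. cmod (a n) * (1 / B')) \<le> (\<Sum>n\<in>J. cmod (a n) * (\<integral>y. cmod (\<psi> n y) \<partial>m))"
        by (intro sum_mono mult_left_mono low) auto
      ultimately have "(\<Sum>n\<in>J. cmod (a n)) * (1 / B') \<le> \<alpha> * s" by (simp only: sum_distrib_right)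
      then have "(\<Sum>n\<in>J. cmod (a n)) \<le> \<alpha> * B' * s" using B' by (simp add: field_simps)
      then show ?thesis using real \<alpha>(1) B' by (simp add: ennreal_mult[symmetric] ennreal_leI)
    next
      case top
      then show ?thesis using \<alpha>(1) B' by (simp add: ennreal_mult_top)
    qed
    then show "ennreal (\<Sum>n | a n \<noteq> 0. cmod (a n)) \<le> ennreal (\<alpha> * B') *
        Linf_norm (PiM {..<Suc k} (\<lambda>_. m)) (\<lambda>t. \<Sum>n | a n \<noteq> 0. a n * (\<Prod>i<Suc k. \<psi> n (t i)))"
      by (simp add: S_def J_def)
  qed
qed

section \<open>Random sums control the fourth tensor power\<close>

text \<open>The functional at \<open>\<omega>\<close> is integration against \<open>\<Phi> \<omega>\<close>: the conjugate sign of \<open>h \<omega> = \<Sum> x\<^sub>n(\<omega>) \<psi>\<^sub>n\<close> on the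
  set where \<open>\<bar>h \<omega>\<bar>\<close> exceeds half of its essential supremum, divided by the measure of that set. This choice depends
  measurably on \<open>\<omega>\<close>, and the loss of a factor 2 makes the set nonnull. Only the values
  \<open>U n \<omega>\<close> of the functional at the \<open>\<psi> n\<close> are kept.\<close>

lemma norming_functionals:
  fixes x :: "nat \<Rightarrow> 'w \<Rightarrow> complex"
  assumes m: "prob_space m" and J: "finite J"
    and x[measurable]: "\<And>n. x n \<in> borel_measurable P"
    and \<psi>[measurable]: "\<And>n. \<psi> n \<in> borel_measurable m" and B: "\<And>n. AE t in m. cmod (\<psi> n t) \<le> B"
  obtains U :: "nat \<Rightarrow> 'w \<Rightarrow> complex" where
    "\<And>n. U n \<in> borel_measurable P"
    "\<And>\<omega> d s. \<omega> \<in> space P \<Longrightarrow> AE t in m. cmod (\<Sum>n\<in>J. d n * \<psi> n t) \<le> s \<Longrightarrow> cmod (\<Sum>n\<in>J. d n * U n \<omega>) \<le> s"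
    "\<And>\<omega>. \<omega> \<in> space P \<Longrightarrow> Linf_norm m (\<lambda>t. \<Sum>n\<in>J. x n \<omega> * \<psi> n t) \<le> 2 * ennreal (Re (\<Sum>n\<in>J. x n \<omega> * U n \<omega>))"
    "\<And>\<omega>. \<omega> \<in> space P \<Longrightarrow> 0 \<le> Re (\<Sum>n\<in>J. x n \<omega> * U n \<omega>)"
proof -
  interpret prob_space m by fact
  define h where "h \<omega> t = (\<Sum>n\<in>J. x n \<omega> * \<psi> n t)" for \<omega> t
  have h_meas[measurable]: "(\<lambda>z. h (fst z) (snd z)) \<in> borel_measurable (P \<Otimes>\<^sub>M m)"
    unfolding h_def by measurable
  have h_meas1[measurable]: "h \<omega> \<in> borel_measurable m" for \<omega> unfolding h_def by measurable
  have \<psi>_int: "integrable m (\<psi> n)" for n by (rule bounded_integrable[OF m \<psi> B])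
  have h_int: "integrable m (h \<omega>)" for \<omega> unfolding h_def[abs_def] using \<psi>_int by auto
  have all_B: "AE t in m. \<forall>n\<in>J. cmod (\<psi> n t) \<le> B"
    by (rule AE_ball_countable') (use J B in \<open>auto intro: countable_finite\<close>)
  define N where "N \<omega> = enn2real (Linf_norm m (h \<omega>))" for \<omega>
  have N_meas[measurable]: "N \<in> borel_measurable P"
  proof -
    have "(\<lambda>\<omega>. Linf_norm m (h \<omega>)) \<in> borel_measurable P"
      by (rule borel_measurable_Linf_norm[OF sigma_finite_measure_axioms]) (simp add: case_prod_beta)
    then show ?thesis unfolding N_def by measurable
  qed
  have N: "Linf_norm m (h \<omega>) = ennreal (N \<omega>)" for \<omega>
  proof -
    have "AE t in m. cmod (h \<omega> t) \<le> (\<Sum>n\<in>J. cmod (x n \<omega>) * B)"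
      using all_B
    proof eventually_elim
      case (elim t)
      then show ?case unfolding h_def
        by (intro order_trans[OF norm_sum sum_mono]) (auto simp: norm_mult intro!: mult_left_mono)
    qed
    then have "Linf_norm m (h \<omega>) \<le> ennreal (\<Sum>n\<in>J. cmod (x n \<omega>) * B)" by (intro Linf_norm_le) auto
    then show ?thesis
      unfolding N_def using le_less_trans[OF _ ennreal_less_top] by (intro ennreal_enn2real[symmetric]) blast
  qed
  have N0: "0 \<le> N \<omega>" for \<omega> by (simp add: N_def)
  \<comment> \<open>If \<open>h \<omega>\<close> vanishes almost everywhere, the whole space is taken, so that \<open>w \<omega>\<close> is always positive.\<close>
  define A where "A \<omega> t \<longleftrightarrow> N \<omega> / 2 < cmod (h \<omega> t) \<or> N \<omega> = 0" for \<omega> t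
  define w where "w \<omega> = measure m {t \<in> space m. A \<omega> t}" for \<omega>
  have A_meas[measurable]: "Measurable.pred (P \<Otimes>\<^sub>M m) (\<lambda>z. A (fst z) (snd z))"
    unfolding A_def by measurable
  have A_meas1[measurable]: "Measurable.pred m (A \<omega>)" for \<omega>
    unfolding A_def by measurable
  have w_meas[measurable]: "w \<in> borel_measurable P"
    unfolding w_def measure_def by measurable
  have w_pos: "0 < w \<omega>" for \<omega>
  proof (cases "N \<omega> = 0")
    case True
    then show ?thesis by (simp add: w_def A_def prob_space)
  next
    case False
    then have "ennreal (N \<omega> / 2) < Linf_norm m (h \<omega>)"
      using N0[of \<omega>] unfolding N by (intro ennreal_lessI) auto
    then have "0 < emeasure m {t \<in> space m. ennreal (N \<omega> / 2) < ennreal (cmod (h \<omega> t))}"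
      unfolding Linf_norm_def by (intro esssup_pos_measure) measurable
    also have "{t \<in> space m. ennreal (N \<omega> / 2) < ennreal (cmod (h \<omega> t))} = {t \<in> space m. A \<omega> t}"
      using False N0[of \<omega>] by (auto simp: A_def ennreal_less_iff)
    finally show ?thesis by (simp add: w_def emeasure_eq_measure)
  qed
  define \<Phi> where "\<Phi> \<omega> t = (if A \<omega> t then cnj (sgn (h \<omega> t)) / of_real (w \<omega>) else 0)" for \<omega> t
  have sgn_meas: "(sgn :: complex \<Rightarrow> complex) \<in> borel_measurable borel"
    unfolding sgn_div_norm[abs_def] by measurable
  have cnj_meas: "cnj \<in> borel_measurable borel"
    by (intro borel_measurable_continuous_onI continuous_intros)
  have \<Phi>_meas[measurable]: "(\<lambda>z. \<Phi> (fst z) (snd z)) \<in> borel_measurable (P \<Otimes>\<^sub>M m)"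
    unfolding \<Phi>_def
    by (intro measurable_If borel_measurable_divide measurable_compose[OF measurable_compose[OF h_meas sgn_meas] cnj_meas]) measurable
  have \<Phi>_meas1[measurable]: "\<Phi> \<omega> \<in> borel_measurable m" for \<omega>
    unfolding \<Phi>_def
    by (intro measurable_If borel_measurable_divide measurable_compose[OF measurable_compose[OF h_meas1 sgn_meas] cnj_meas]) measurable
  have \<Phi>_le: "cmod (\<Phi> \<omega> t) \<le> indicator {t \<in> space m. A \<omega> t} t / w \<omega>" if "t \<in> space m" for \<omega> t
    using w_pos[of \<omega>] that by (auto simp: \<Phi>_def norm_divide norm_sgn divide_right_mono)
  have ind_int: "integrable m (\<lambda>t. indicator {t \<in> space m. A \<omega> t} t / w \<omega> :: real)" for \<omega>
    by (intro integrable_divide_zero integrable_real_indicator) (auto simp: emeasure_eq_measure)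
  have ind_one: "(\<integral>t. indicator {t \<in> space m. A \<omega> t} t / w \<omega> \<partial>m) = 1" for \<omega>
    using w_pos[of \<omega>] by (simp add: w_def)
  have w_le: "indicator {t \<in> space m. A \<omega> t} t / w \<omega> \<le> 1 / w \<omega>" for \<omega> t
    using w_pos[of \<omega>] by (auto simp: indicator_def divide_right_mono)
  have \<Phi>_bd: "cmod (\<Phi> \<omega> t) \<le> 1 / w \<omega>" if "t \<in> space m" for \<omega> t
    using \<Phi>_le[OF that] w_le order_trans by blast
  have \<Phi>f_int: "integrable m (\<lambda>t. \<Phi> \<omega> t * f t)" if "integrable m f" for f \<omega>
  proof (rule Bochner_Integration.integrable_bound)
    show "integrable m (\<lambda>t. (1 / w \<omega>) *\<^sub>R f t)" using that by simp
    show "(\<lambda>t. \<Phi> \<omega> t * f t) \<in> borel_measurable m" using that by measurable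
    show "AE t in m. norm (\<Phi> \<omega> t * f t) \<le> norm ((1 / w \<omega>) *\<^sub>R f t)"
    proof (rule AE_I2)
      fix t assume "t \<in> space m"
      then have "cmod (\<Phi> \<omega> t) * cmod (f t) \<le> (1 / w \<omega>) * cmod (f t)"
        by (intro mult_right_mono \<Phi>_bd) auto
      then show "norm (\<Phi> \<omega> t * f t) \<le> norm ((1 / w \<omega>) *\<^sub>R f t)"
        using w_pos[of \<omega>] by (simp add: norm_mult)
    qed
  qed
  define U where "U n \<omega> = (\<integral>t. \<Phi> \<omega> t * \<psi> n t \<partial>m)" for n \<omega>
  have sumU: "(\<Sum>n\<in>J. d n * U n \<omega>) = (\<integral>t. \<Phi> \<omega> t * (\<Sum>n\<in>J. d n * \<psi> n t) \<partial>m)" for d \<omega>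
  proof -
    have "(\<integral>t. \<Phi> \<omega> t * (\<Sum>n\<in>J. d n * \<psi> n t) \<partial>m) = (\<integral>t. (\<Sum>n\<in>J. d n * (\<Phi> \<omega> t * \<psi> n t)) \<partial>m)"
      by (simp add: sum_distrib_left mult_ac)
    also have "\<dots> = (\<Sum>n\<in>J. d n * U n \<omega>)"
      using \<Phi>f_int[OF \<psi>_int] by (simp add: U_def Bochner_Integration.integral_sum)
    finally show ?thesis by simp
  qed
  have lower: "N \<omega> / 2 \<le> Re (\<Sum>n\<in>J. x n \<omega> * U n \<omega>)" for \<omega>
  proof -
    have Re_eq: "Re (\<Phi> \<omega> t * h \<omega> t) = (if A \<omega> t then cmod (h \<omega> t) / w \<omega> else 0)" for t
    proof -
      have "cnj (sgn z) * z = of_real (cmod z)" for z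
        by (cases "z = 0") (auto simp: sgn_eq complex_norm_square[symmetric] power2_eq_square mult.commute[of "cnj z"])
      then have "cnj (sgn (h \<omega> t)) / of_real (w \<omega>) * h \<omega> t = of_real (cmod (h \<omega> t) / w \<omega>)" by simp
      then have "\<Phi> \<omega> t * h \<omega> t = (if A \<omega> t then of_real (cmod (h \<omega> t) / w \<omega>) else 0)" 
        by (cases "A \<omega> t") (simp_all only: \<Phi>_def if_True if_False mult_zero_left)
      then show ?thesis by (simp only: if_distrib[of Re] Re_complex_of_real zero_complex.sel)
    qed
    have "N \<omega> / 2 = (\<integral>t. (N \<omega> / 2) * (indicator {t \<in> space m. A \<omega> t} t / w \<omega>) \<partial>m)"
      using ind_one[of \<omega>] by (simp only: integral_mult_right_zero mult_1_right)
    also have "\<dots> \<le> (\<integral>t. Re (\<Phi> \<omega> t * h \<omega> t) \<partial>m)"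
    proof (rule integral_mono)
      show "integrable m (\<lambda>t. (N \<omega> / 2) * (indicator {t \<in> space m. A \<omega> t} t / w \<omega>))"
        using ind_int by (intro integrable_mult_right)
      show "integrable m (\<lambda>t. Re (\<Phi> \<omega> t * h \<omega> t))"
        by (intro integrable_Re \<Phi>f_int h_int)
      show "(N \<omega> / 2) * (indicator {t \<in> space m. A \<omega> t} t / w \<omega>) \<le> Re (\<Phi> \<omega> t * h \<omega> t)" if "t \<in> space m" for t
        unfolding Re_eq using that w_pos[of \<omega>] by (auto simp: indicator_def A_def field_simps)
    qed
    also have "\<dots> = Re (\<Sum>n\<in>J. x n \<omega> * U n \<omega>)"
      unfolding sumU h_def[symmetric] by (rule integral_Re[OF \<Phi>f_int[OF h_int]])
    finally show ?thesis .
  qed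
  show ?thesis
  proof (rule that[of U])
    show "U n \<in> borel_measurable P" for n
      unfolding U_def by (rule borel_measurable_lebesgue_integral) (simp add: case_prod_beta)
    show "cmod (\<Sum>n\<in>J. d n * U n \<omega>) \<le> s" if ae: "AE t in m. cmod (\<Sum>n\<in>J. d n * \<psi> n t) \<le> s" for \<omega> d s
    proof -
      have "\<exists>t. cmod (\<Sum>n\<in>J. d n * \<psi> n t) \<le> s" by (rule eventually_happens'[OF ae_filter_bot ae])
      then have s0: "0 \<le> s" using norm_ge_zero order_trans by blast
      have int: "integrable m (\<lambda>t. \<Phi> \<omega> t * (\<Sum>n\<in>J. d n * \<psi> n t))" using \<psi>_int by (intro \<Phi>f_int) auto
      have "cmod (\<Sum>n\<in>J. d n * U n \<omega>) \<le> (\<integral>t. cmod (\<Phi> \<omega> t * (\<Sum>n\<in>J. d n * \<psi> n t)) \<partial>m)"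
        unfolding sumU by (rule integral_norm_bound)
      also have "\<dots> \<le> (\<integral>t. s * (indicator {t \<in> space m. A \<omega> t} t / w \<omega>) \<partial>m)"
      proof (rule integral_mono_AE)
        show "AE t in m. cmod (\<Phi> \<omega> t * (\<Sum>n\<in>J. d n * \<psi> n t)) \<le> s * (indicator {t \<in> space m. A \<omega> t} t / w \<omega>)"
          using ae AE_space
        proof eventually_elim
          case (elim t)
          have "cmod (\<Sum>n\<in>J. d n * \<psi> n t) * cmod (\<Phi> \<omega> t) \<le> s * (indicator {t \<in> space m. A \<omega> t} t / w \<omega>)"
            using elim \<Phi>_le[of t \<omega>] s0 by (intro mult_mono) auto
          then show ?case by (simp add: norm_mult mult.commute)
        qed
      qed (use int ind_int in \<open>auto intro: integrable_mult_right simp del: times_divide_eq_right\<close>)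
      also have "\<dots> = s" using ind_one[of \<omega>] by (simp only: integral_mult_right_zero mult_1_right)
      finally show ?thesis .
    qed
    show "Linf_norm m (\<lambda>t. \<Sum>n\<in>J. x n \<omega> * \<psi> n t) \<le> 2 * ennreal (Re (\<Sum>n\<in>J. x n \<omega> * U n \<omega>))" for \<omega>
    proof -
      have "Linf_norm m (h \<omega>) = 2 * ennreal (N \<omega> / 2)"
        unfolding N using N0[of \<omega>] by (simp add: ennreal_mult[symmetric] flip: ennreal_numeral)
      also have "\<dots> \<le> 2 * ennreal (Re (\<Sum>n\<in>J. x n \<omega> * U n \<omega>))"
        by (intro mult_left_mono ennreal_leI lower) auto
      finally show ?thesis unfolding h_def .
    qed
    show "0 \<le> Re (\<Sum>n\<in>J. x n \<omega> * U n \<omega>)" for \<omega> using lower[of \<omega>] N0[of \<omega>] by linarith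
  qed
qed

text \<open>A functional of norm at most 1 may be applied in one variable at a time. The exceptional null sets in \<open>p\<close> and
  \<open>q\<close> do not depend on \<open>\<omega>\<close> and \<open>\<omega>'\<close>, because each step works for a fixed value of the other variables.\<close>

lemma four_fold_bound_functionals:
  fixes a :: "nat \<Rightarrow> complex"
  assumes ae: "AE p in m. AE q in m. AE u in m. AE v in m. cmod (\<Sum>n\<in>J. a n * (\<psi> n p * \<psi> n q * \<psi> n u * \<psi> n v)) \<le> S"
    and U: "\<And>\<omega> d s. \<omega> \<in> \<Omega> \<Longrightarrow> AE t in m. cmod (\<Sum>n\<in>J. d n * \<psi> n t) \<le> s \<Longrightarrow> cmod (\<Sum>n\<in>J. d n * U n \<omega>) \<le> (s::real)"
  shows "AE p in m. AE q in m. \<forall>\<omega>\<in>\<Omega>. \<forall>\<omega>'\<in>\<Omega>. cmod (\<Sum>n\<in>J. (a n * \<psi> n p * \<psi> n q) * (U n \<omega> * U n \<omega>')) \<le> S"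
proof -
  have last: "\<forall>\<omega>\<in>\<Omega>. \<forall>\<omega>'\<in>\<Omega>. cmod (\<Sum>n\<in>J. (a n * \<psi> n p * \<psi> n q) * (U n \<omega> * U n \<omega>')) \<le> S"
    if *: "AE u in m. AE v in m. cmod (\<Sum>n\<in>J. a n * (\<psi> n p * \<psi> n q * \<psi> n u * \<psi> n v)) \<le> S" for p q
  proof (intro ballI)
    fix \<omega> \<omega>' assume w: "\<omega> \<in> \<Omega>" "\<omega>' \<in> \<Omega>"
    from * have "AE u in m. cmod (\<Sum>n\<in>J. (a n * \<psi> n p * \<psi> n q * U n \<omega>') * \<psi> n u) \<le> S"
    proof eventually_elim
      case (elim u)
      then have "AE v in m. cmod (\<Sum>n\<in>J. (a n * \<psi> n p * \<psi> n q * \<psi> n u) * \<psi> n v) \<le> S"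
        by (simp add: mult_ac)
      from U[OF w(2) this] show ?case by (simp add: mult_ac)
    qed
    from U[OF w(1) this] show "cmod (\<Sum>n\<in>J. (a n * \<psi> n p * \<psi> n q) * (U n \<omega> * U n \<omega>')) \<le> S"
      by (simp add: mult_ac)
  qed
  from ae show ?thesis
  proof eventually_elim
    case (elim p)
    then show ?case by eventually_elim (rule last)
  qed
qed

text \<open>Integration in one variable replaces the factor \<open>\<psi>\<^sub>n cnj \<phi>\<^sub>k\<close> in that variable by 1 if \<open>n = k\<close> and by 0 otherwise.\<close>

lemma double_integral_biorthogonal:
  fixes w :: "nat \<Rightarrow> nat \<Rightarrow> complex"
  assumes m: "prob_space m" and J: "finite J"
    and int: "\<And>n k. integrable m (\<lambda>t. \<psi> n t * cnj (\<phi> k t))" and bio: "biorthogonal m \<psi> \<phi>"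
    and le: "AE p in m. AE q in m. cmod (\<Sum>n\<in>J. \<Sum>k\<in>J. w n k * (\<psi> n p * cnj (\<phi> k p)) * (\<psi> n q * cnj (\<phi> k q))) \<le> R"
  shows "cmod (\<Sum>n\<in>J. w n n) \<le> R"
proof -
  interpret prob_space m by fact
  define f where "f n k t = \<psi> n t * cnj (\<phi> k t)" for n k t
  have f_int: "integrable m (f n k)" for n k unfolding f_def by (rule int)
  have f_bio: "(\<integral>t. f n k t \<partial>m) = (if n = k then 1 else 0)" for n k
    using bio by (simp add: f_def biorthogonal_def)
  have avg: "cmod (\<integral>t. h t \<partial>m) \<le> R" if "integrable m h" "AE t in m. cmod (h t) \<le> R" for h :: "_ \<Rightarrow> complex"
  proof -
    have "cmod (\<integral>t. h t \<partial>m) \<le> (\<integral>t. cmod (h t) \<partial>m)" by (rule integral_norm_bound)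
    also have "\<dots> \<le> (\<integral>t. R \<partial>m)" using that by (intro integral_mono_AE) auto
    finally show ?thesis by (simp add: prob_space)
  qed
  have inner: "(\<integral>q. (\<Sum>n\<in>J. \<Sum>k\<in>J. (w n k * f n k p) * f n k q) \<partial>m) = (\<Sum>n\<in>J. w n n * f n n p)" for p
    unfolding integral_double_sum[OF f_int] f_bio using J by (simp add: if_distrib cong: if_cong)
  have "AE p in m. cmod (\<Sum>n\<in>J. w n n * f n n p) \<le> R"
    using le
  proof eventually_elim
    case (elim p)
    show ?case unfolding inner[symmetric]
    proof (rule avg)
      show "integrable m (\<lambda>q. \<Sum>n\<in>J. \<Sum>k\<in>J. (w n k * f n k p) * f n k q)"
        by (intro Bochner_Integration.integrable_sum integrable_mult_right f_int)
    qed (use elim in \<open>simp add: f_def\<close>)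
  qed
  then have "cmod (\<integral>p. (\<Sum>n\<in>J. w n n * f n n p) \<partial>m) \<le> R" using f_int by (intro avg) auto
  then show ?thesis using f_int by (simp add: Bochner_Integration.integral_sum f_bio)
qed

text \<open>The argument described at the beginning. The constants are chosen backwards: the tail of a Gaussian variable beyond \<open>K\<close> costs
  at most \<open>4 B / K = 1 / (4 C)\<close>, half of the lower bound \<open>1 / (2 C)\<close> that the hypothesis provides, and \<open>\<rho>\<close> is such that
  the error of the Riesz product is at most half of \<open>\<kappa>\<^sup>2 \<Sum> \<bar>a\<^sub>n\<bar>\<close>.\<close>

lemma randomly_Sidon_imp_tensor_Sidon_4:
  assumes g: "iid_std_complex_gaussian P g" and m: "prob_space m"
    and psi: "bounded_in_Linf m \<psi>" and phi: "bounded_in_Linf m \<phi>"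
    and bio: "biorthogonal m \<psi> \<phi>" and rand: "randomly_Sidon P g m \<psi>"
  shows "tensor_Sidon 4 m \<psi>"
proof -
  interpret P: prob_space P using g by (simp add: iid_std_complex_gaussian_def)
  have gauss: "std_complex_gaussian P (g n)" and ind: "P.indep_vars (\<lambda>_. borel) g UNIV" for n
    using g by (auto simp: iid_std_complex_gaussian_def)
  have g_meas[measurable]: "g n \<in> borel_measurable P" for n by (rule gaussian_measurable[OF gauss])
  note g_int = gaussian_integrable(2)[OF P.prob_space_axioms gauss]
  obtain B where B: "1 \<le> B" and \<psi>_meas[measurable]: "\<And>n. \<psi> n \<in> borel_measurable m"
      and B_le: "\<And>n. AE t in m. cmod (\<psi> n t) \<le> B"
    by (rule bounded_in_LinfE[OF psi]) blast
  obtain B' where B': "1 \<le> B'" and \<phi>_meas[measurable]: "\<And>n. \<phi> n \<in> borel_measurable m"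
      and B'_le: "\<And>n. AE t in m. cmod (\<phi> n t) \<le> B'"
    by (rule bounded_in_LinfE[OF phi]) blast
  obtain C where C: "1 \<le> C" "\<And>a :: nat \<Rightarrow> complex. finite {n. a n \<noteq> 0} \<Longrightarrow> ennreal (\<Sum>n | a n \<noteq> 0. cmod (a n))
          \<le> ennreal C * (\<integral>\<^sup>+\<omega>. Linf_norm m (\<lambda>t. \<Sum>n | a n \<noteq> 0. g n \<omega> * a n * \<psi> n t) \<partial>P)"
  proof -
    obtain C :: real where C: "\<And>a :: nat \<Rightarrow> complex. finite {n. a n \<noteq> 0} \<Longrightarrow> ennreal (\<Sum>n | a n \<noteq> 0. cmod (a n))
          \<le> ennreal C * (\<integral>\<^sup>+\<omega>. Linf_norm m (\<lambda>t. \<Sum>n | a n \<noteq> 0. g n \<omega> * a n * \<psi> n t) \<partial>P)"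
      using rand unfolding randomly_Sidon_def by blast
    show ?thesis
      by (rule that[of "max 1 C"], simp) (rule order_trans[OF C mult_right_mono[OF ennreal_leI]]; simp)
  qed
  define K where "K = 16 * C * B"
  define \<kappa> where "\<kappa> = 1 / (4 * C * K)"
  define \<rho> where "\<rho> = min 1 (\<kappa>\<^sup>2 / (8 * B'\<^sup>2 * B ^ 4))"
  have K: "0 < K" and \<kappa>: "0 < \<kappa>" using B C(1) by (auto simp: K_def \<kappa>_def)
  have \<rho>: "0 < \<rho>" "\<rho> \<le> 1" using B B' \<kappa> by (auto simp: \<rho>_def)
  have \<rho>_small: "8 * B'\<^sup>2 * B ^ 4 * \<rho> \<le> \<kappa>\<^sup>2"
  proof -
    have "\<rho> \<le> \<kappa>\<^sup>2 / (8 * B'\<^sup>2 * B ^ 4)" by (simp add: \<rho>_def)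
    then show ?thesis using B B' by (simp add: field_simps)
  qed
  define trunc where "trunc z = (if cmod z \<le> K then z else 0) / of_real K" for z
  have trunc_meas[measurable]: "trunc \<in> borel_measurable borel" unfolding trunc_def by measurable
  define c where "c n \<omega> = trunc (g n \<omega>)" for n \<omega>
  have c_meas[measurable]: "c n \<in> borel_measurable P" for n unfolding c_def by measurable
  have c_ind: "P.indep_vars (\<lambda>_. borel) c J" for J
    unfolding c_def by (rule P.indep_vars_compose2[OF P.indep_vars_subset[OF ind]]) auto
  have c_le: "cmod (c n \<omega>) \<le> 1" for n \<omega>
    using K by (auto simp: c_def trunc_def norm_divide)
  have c_mean: "P.expectation (c n) = 0" for n
    unfolding c_def by (rule gaussian_odd_integral[OF gauss]) (auto simp: trunc_def)
  show ?thesis unfolding tensor_Sidon_def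
  proof (intro exI[of _ "16 * B'\<^sup>2 / (\<rho> * \<kappa>\<^sup>2)"] allI impI)
    fix a :: "nat \<Rightarrow> complex" assume fin: "finite {n. a n \<noteq> 0}"
    define J where "J = {n. a n \<noteq> 0}"
    have J: "finite J" using fin by (simp add: J_def)
    define A where "A = (\<Sum>n\<in>J. cmod (a n))"
    have A0: "0 \<le> A" unfolding A_def by (simp add: sum_nonneg)
    define S where "S = Linf_norm (PiM {..<4::nat} (\<lambda>_. m)) (\<lambda>t. \<Sum>n\<in>J. a n * (\<Prod>i<4::nat. \<psi> n (t i)))"
    obtain U :: "nat \<Rightarrow> _ \<Rightarrow> complex" where U_meas[measurable]: "\<And>n. U n \<in> borel_measurable P"
      and U_norm: "\<And>\<omega> d s. \<omega> \<in> space P \<Longrightarrow> AE t in m. cmod (\<Sum>n\<in>J. d n * \<psi> n t) \<le> s \<Longrightarrow> cmod (\<Sum>n\<in>J. d n * U n \<omega>) \<le> s"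
      and U_max: "\<And>\<omega>. \<omega> \<in> space P \<Longrightarrow> Linf_norm m (\<lambda>t. \<Sum>n\<in>J. g n \<omega> * a n * \<psi> n t) \<le> 2 * ennreal (Re (\<Sum>n\<in>J. g n \<omega> * a n * U n \<omega>))"
      and U_pos: "\<And>\<omega>. \<omega> \<in> space P \<Longrightarrow> 0 \<le> Re (\<Sum>n\<in>J. g n \<omega> * a n * U n \<omega>)"
      by (rule norming_functionals[OF m J, of "\<lambda>n \<omega>. g n \<omega> * a n" P \<psi> B]) (auto simp: B_le)
    \<comment> \<open>A single \<open>\<psi>\<^sub>n\<close> is the case of unit vectors \<open>d\<close>.\<close>
    have U_le: "cmod (U n \<omega>) \<le> B" if "n \<in> J" "\<omega> \<in> space P" for n \<omega>
    proof -
      have delta: "(\<Sum>k\<in>J. (if k = n then 1 else 0) * f k) = f n" for f :: "nat \<Rightarrow> complex"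
        using J that(1) by (simp add: if_distrib if_distribR cong: if_cong)
      have "cmod (\<Sum>k\<in>J. (if k = n then 1 else 0) * U k \<omega>) \<le> B"
        by (rule U_norm[OF that(2)]) (use B_le[of n] in \<open>simp only: delta\<close>)
      then show ?thesis by (simp only: delta)
    qed
    have gU_int: "integrable P (\<lambda>\<omega>. g n \<omega> * U n \<omega>)" if "n \<in> J" for n
    proof (rule Bochner_Integration.integrable_bound)
      show "integrable P (\<lambda>\<omega>. of_real B * g n \<omega>)" using g_int by simp
      show "AE \<omega> in P. norm (g n \<omega> * U n \<omega>) \<le> norm (of_real B * g n \<omega>)"
        using U_le[OF that] B by (intro AE_I2) (auto simp: norm_mult mult.commute[of B] intro!: mult_left_mono)
    qed measurable
    have cU_int: "integrable P (\<lambda>\<omega>. c n \<omega> * U n \<omega>)" if "n \<in> J" for n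
    proof (rule P.integrable_const_bound[where B=B])
      show "AE \<omega> in P. norm (c n \<omega> * U n \<omega>) \<le> B"
        using U_le[OF that] c_le by (intro AE_I2) (auto simp: norm_mult intro!: order_trans[OF mult_left_le_one_le])
    qed measurable
    define W where "W n = P.expectation (\<lambda>\<omega>. c n \<omega> * U n \<omega>)" for n
    have W_low: "cmod (P.expectation (\<lambda>\<omega>. g n \<omega> * U n \<omega>)) \<le> K * cmod (W n) + 1 / (4 * C)" if n: "n \<in> J" for n
    proof -
      define r where "r \<omega> = g n \<omega> - (if cmod (g n \<omega>) \<le> K then g n \<omega> else 0)" for \<omega>
      have [measurable]: "r \<in> borel_measurable P" unfolding r_def by measurable
      have split: "g n \<omega> * U n \<omega> = of_real K * (c n \<omega> * U n \<omega>) + r \<omega> * U n \<omega>" for \<omega>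
        using K by (simp add: c_def trunc_def r_def)
      have r_int: "integrable P r"
        using g_int[of n] unfolding r_def by (intro Bochner_Integration.integrable_bound[OF g_int[of n]]) auto
      have rU_int: "integrable P (\<lambda>\<omega>. r \<omega> * U n \<omega>)"
      proof (rule Bochner_Integration.integrable_bound)
        show "integrable P (\<lambda>\<omega>. of_real B * r \<omega>)" using r_int by simp
        show "AE \<omega> in P. norm (r \<omega> * U n \<omega>) \<le> norm (of_real B * r \<omega>)"
          using U_le[OF n] B by (intro AE_I2) (auto simp: norm_mult mult.commute[of B] intro!: mult_left_mono)
      qed measurable
      have "P.expectation (\<lambda>\<omega>. g n \<omega> * U n \<omega>) = of_real K * W n + P.expectation (\<lambda>\<omega>. r \<omega> * U n \<omega>)"
        unfolding split W_def using cU_int[OF n] rU_int by simp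
      also have "cmod \<dots> \<le> K * cmod (W n) + cmod (P.expectation (\<lambda>\<omega>. r \<omega> * U n \<omega>))"
        using K by (intro order_trans[OF norm_triangle_ineq]) (simp add: norm_mult)
      also have "cmod (P.expectation (\<lambda>\<omega>. r \<omega> * U n \<omega>)) \<le> P.expectation (\<lambda>\<omega>. cmod (r \<omega>) * B)"
      proof (rule norm_integral_le)
        show "integrable P (\<lambda>\<omega>. cmod (r \<omega>) * B)" using r_int by simp
        show "norm (r \<omega> * U n \<omega>) \<le> cmod (r \<omega>) * B" if "\<omega> \<in> space P" for \<omega>
          using U_le[OF n that] by (simp add: norm_mult mult_left_mono)
      qed (rule rU_int)
      also have "\<dots> = P.expectation (\<lambda>\<omega>. cmod (r \<omega>)) * B" by simp
      also have "\<dots> \<le> (4 / K) * B"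
        using gaussian_tail[OF P.prob_space_axioms gauss K, of n] B unfolding r_def by (intro mult_right_mono) auto
      also have "(4 / K) * B = 1 / (4 * C)" using B C(1) by (simp add: K_def)
      finally show ?thesis by simp
    qed
    have W_sum: "\<kappa> * A \<le> (\<Sum>n\<in>J. cmod (a n) * cmod (W n))"
    proof -
      have re_int: "integrable P (\<lambda>\<omega>. \<Sum>n\<in>J. g n \<omega> * a n * U n \<omega>)"
      proof (rule Bochner_Integration.integrable_sum)
        fix n assume "n \<in> J"
        then have "integrable P (\<lambda>\<omega>. a n * (g n \<omega> * U n \<omega>))" using gU_int by simp
        then show "integrable P (\<lambda>\<omega>. g n \<omega> * a n * U n \<omega>)" by (simp add: mult_ac)
      qed
      have "ennreal A \<le> ennreal C * (\<integral>\<^sup>+\<omega>. Linf_norm m (\<lambda>t. \<Sum>n\<in>J. g n \<omega> * a n * \<psi> n t) \<partial>P)"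
        unfolding A_def J_def by (rule C(2)[OF fin])
      also have "\<dots> \<le> ennreal C * (\<integral>\<^sup>+\<omega>. 2 * ennreal (Re (\<Sum>n\<in>J. g n \<omega> * a n * U n \<omega>)) \<partial>P)"
        by (intro mult_left_mono nn_integral_mono U_max) auto
      also have "(\<integral>\<^sup>+\<omega>. 2 * ennreal (Re (\<Sum>n\<in>J. g n \<omega> * a n * U n \<omega>)) \<partial>P)
          = 2 * (\<integral>\<^sup>+\<omega>. ennreal (Re (\<Sum>n\<in>J. g n \<omega> * a n * U n \<omega>)) \<partial>P)"
        by (rule nn_integral_cmult) measurable
      also have "(\<integral>\<^sup>+\<omega>. ennreal (Re (\<Sum>n\<in>J. g n \<omega> * a n * U n \<omega>)) \<partial>P)
          = ennreal (P.expectation (\<lambda>\<omega>. Re (\<Sum>n\<in>J. g n \<omega> * a n * U n \<omega>)))"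
        by (rule nn_integral_eq_integral[OF integrable_Re[OF re_int] AE_I2[OF U_pos]])
      also have "P.expectation (\<lambda>\<omega>. Re (\<Sum>n\<in>J. g n \<omega> * a n * U n \<omega>)) = Re (P.expectation (\<lambda>\<omega>. \<Sum>n\<in>J. g n \<omega> * a n * U n \<omega>))"
        using re_int by (rule integral_Re)
      also have "ennreal C * (2 * ennreal (Re (P.expectation (\<lambda>\<omega>. \<Sum>n\<in>J. g n \<omega> * a n * U n \<omega>))))
        \<le> ennreal C * (2 * ennreal (cmod (P.expectation (\<lambda>\<omega>. \<Sum>n\<in>J. g n \<omega> * a n * U n \<omega>))))"
        by (intro mult_left_mono ennreal_leI complex_Re_le_cmod) auto
      also have "\<dots> = ennreal (2 * C * cmod (P.expectation (\<lambda>\<omega>. \<Sum>n\<in>J. g n \<omega> * a n * U n \<omega>)))"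
        using C(1) by (simp add: ennreal_mult mult_ac)
      finally have "A \<le> 2 * C * cmod (P.expectation (\<lambda>\<omega>. \<Sum>n\<in>J. g n \<omega> * a n * U n \<omega>))"
        using C(1) by (simp add: ennreal_le_iff)
      also have "P.expectation (\<lambda>\<omega>. \<Sum>n\<in>J. g n \<omega> * a n * U n \<omega>) = P.expectation (\<lambda>\<omega>. \<Sum>n\<in>J. a n * (g n \<omega> * U n \<omega>))"
        by (simp add: mult_ac)
      also have "\<dots> = (\<Sum>n\<in>J. a n * P.expectation (\<lambda>\<omega>. g n \<omega> * U n \<omega>))"
        using gU_int by (simp add: Bochner_Integration.integral_sum)
      also have "cmod \<dots> \<le> (\<Sum>n\<in>J. cmod (a n) * (K * cmod (W n) + 1 / (4 * C)))"
        by (rule sum_norm_le) (auto simp: norm_mult intro!: mult_left_mono W_low)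
      also have "\<dots> = K * (\<Sum>n\<in>J. cmod (a n) * cmod (W n)) + A / (4 * C)"
        by (simp add: A_def distrib_left sum.distrib sum_distrib_left sum_divide_distrib mult_ac)
      finally have "A \<le> 2 * C * (K * (\<Sum>n\<in>J. cmod (a n) * cmod (W n)) + A / (4 * C))"
        using C(1) by simp
      also have "\<dots> = 2 * C * K * (\<Sum>n\<in>J. cmod (a n) * cmod (W n)) + A / 2"
        using C(1) by (simp add: field_simps)
      finally show ?thesis using C(1) K by (simp add: \<kappa>_def field_simps)
    qed
    have "ennreal A \<le> ennreal (16 * B'\<^sup>2 / (\<rho> * \<kappa>\<^sup>2)) * S"
    proof (cases S)
      case (real s)
      have "AE t in PiM {..<4::nat} (\<lambda>_. m). cmod (\<Sum>n\<in>J. a n * (\<Prod>i<4::nat. \<psi> n (t i))) \<le> s"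
        by (rule tensor_Linf_norm_AE[OF m]) (use real in \<open>auto simp: S_def\<close>)
      then have "AE t in PiM {..<4::nat} (\<lambda>_. m). cmod (\<Sum>n\<in>J. a n * (\<psi> n (t 3) * \<psi> n (t 2) * \<psi> n (t 1) * \<psi> n (t 0))) \<le> s"
        by (simp add: eval_nat_numeral lessThan_Suc mult_ac)
      from AE_PiM_four[OF m, where Q="\<lambda>p q u v. cmod (\<Sum>n\<in>J. a n * (\<psi> n p * \<psi> n q * \<psi> n u * \<psi> n v)) \<le> s", OF this]
      have G: "AE p in m. AE q in m. \<forall>\<omega>\<in>space P. \<forall>\<omega>'\<in>space P.
          cmod (\<Sum>n\<in>J. (a n * \<psi> n p * \<psi> n q) * (U n \<omega> * U n \<omega>')) \<le> s"
        by (rule four_fold_bound_functionals) (rule U_norm)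
      \<comment> \<open>These phases make the diagonal terms \<open>z\<^sub>k a\<^sub>k W\<^sub>k\<^sup>2\<close> nonnegative.\<close>
      define z where "z k = cnj (sgn (a k * (W k)\<^sup>2))" for k
      have z_le: "cmod (z k) \<le> 1" for k by (simp add: z_def norm_sgn)
      have z_eq: "z k * (a k * (W k)\<^sup>2) = of_real (cmod (a k) * (cmod (W k))\<^sup>2)" for k
      proof -
        have "cnj (sgn x) * x = of_real (cmod x)" for x
          by (cases "x = 0") (auto simp: sgn_eq complex_norm_square[symmetric] power2_eq_square mult.commute[of "cnj x"])
        then show ?thesis by (simp add: z_def norm_mult norm_power)
      qed
      define V where "V n k = P.expectation (\<lambda>\<omega>. c k \<omega> * U n \<omega>)" for n k
      define R where "R = 4 * (2 * s / \<rho> + \<rho> * B\<^sup>2 * (A * B\<^sup>2))"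
      have bdd_all: "AE t in m. \<forall>n\<in>J. cmod (\<psi> n t) \<le> B \<and> cmod (\<phi> n t) \<le> B'"
        by (rule AE_ball_countable') (use J B_le B'_le in \<open>auto intro: countable_finite\<close>)
      have "AE p in m. AE q in m. cmod (\<Sum>n\<in>J. \<Sum>k\<in>J. (a n * z k * (V n k)\<^sup>2 / of_real (B'\<^sup>2))
          * (\<psi> n p * cnj (\<phi> k p)) * (\<psi> n q * cnj (\<phi> k q))) \<le> R"
        using G bdd_all
      proof eventually_elim
        case (elim p)
        note p = elim(2)
        from elim(1) bdd_all show ?case
        proof eventually_elim
          case (elim q)
          have A_le: "(\<Sum>n\<in>J. cmod (a n * \<psi> n p * \<psi> n q)) \<le> A * B\<^sup>2"
            unfolding A_def sum_distrib_right norm_mult mult.assoc power2_eq_square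
            using p elim(2) B by (intro sum_mono mult_left_mono mult_mono) auto
          have "cmod (\<Sum>n\<in>J. (a n * \<psi> n p * \<psi> n q) *
              (\<Sum>k\<in>J. (cnj (\<phi> k p) / of_real B') * (z k * cnj (\<phi> k q) / of_real B') * (V n k)\<^sup>2))
            \<le> 4 * (2 * s / \<rho> + \<rho> * B\<^sup>2 * (\<Sum>n\<in>J. cmod (a n * \<psi> n p * \<psi> n q)))"
            unfolding V_def
          proof (rule P.riesz_product_estimate_complex[OF J c_ind c_le c_mean _ _ U_meas U_le _ \<rho>])
            show "cmod (cnj (\<phi> k p) / of_real B') \<le> 1" if "k \<in> J" for k
              using p that B' by (simp add: norm_divide)
            show "cmod (z k * cnj (\<phi> k q) / of_real B') \<le> 1" if "k \<in> J" for k
            proof -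
              have "cmod (z k) * cmod (\<phi> k q) \<le> 1 * B'"
                using elim(2) that z_le by (intro mult_mono) auto
              then show ?thesis using B' by (simp add: norm_divide norm_mult)
            qed
            show "cmod (\<Sum>n\<in>J. (a n * \<psi> n p * \<psi> n q) * (U n \<omega> * U n \<omega>')) \<le> s"
              if "\<omega> \<in> space P" "\<omega>' \<in> space P" for \<omega> \<omega>'
              using elim(1) that by blast
          qed
          also have "\<dots> \<le> R"
            unfolding R_def using A_le \<rho> by (intro mult_left_mono add_left_mono) auto
          finally show ?case
            by (simp add: sum_distrib_left power2_eq_square mult_ac)
        qed
      qed
      then have "cmod (\<Sum>n\<in>J. a n * z n * (V n n)\<^sup>2 / of_real (B'\<^sup>2)) \<le> R"
      proof (rule double_integral_biorthogonal[OF m J _ bio, rotated])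
        show "integrable m (\<lambda>t. \<psi> n t * cnj (\<phi> k t))" for n k
        proof (rule bounded_integrable[OF m, where B="B * B'"])
          have [measurable]: "cnj \<in> borel_measurable borel"
            by (intro borel_measurable_continuous_onI continuous_intros)
          show "(\<lambda>t. \<psi> n t * cnj (\<phi> k t)) \<in> borel_measurable m" by measurable
          show "AE t in m. cmod (\<psi> n t * cnj (\<phi> k t)) \<le> B * B'"
            using B_le[of n] B'_le[of k] by eventually_elim (use B in \<open>auto simp: norm_mult intro!: mult_mono\<close>)
        qed
      qed
      also have "(\<Sum>n\<in>J. a n * z n * (V n n)\<^sup>2 / of_real (B'\<^sup>2)) = of_real ((\<Sum>n\<in>J. cmod (a n) * (cmod (W n))\<^sup>2) / B'\<^sup>2)"
      proof -
        have "a n * z n * (V n n)\<^sup>2 = of_real (cmod (a n) * (cmod (W n))\<^sup>2)" for n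
          using z_eq[of n] by (simp add: V_def W_def mult_ac)
        then show ?thesis by (simp add: sum_divide_distrib)
      qed
      finally have "(\<Sum>n\<in>J. cmod (a n) * (cmod (W n))\<^sup>2) / B'\<^sup>2 \<le> R"
        unfolding norm_of_real by (rule order_trans[OF abs_ge_self])
      then have quad: "(\<Sum>n\<in>J. cmod (a n) * (cmod (W n))\<^sup>2) \<le> B'\<^sup>2 * R"
        using B' by (simp add: pos_divide_le_eq mult.commute)
      have cs: "(\<Sum>n\<in>J. cmod (a n) * cmod (W n))\<^sup>2 \<le> A * (\<Sum>n\<in>J. cmod (a n) * (cmod (W n))\<^sup>2)"
      proof -
        have "(\<Sum>n\<in>J. sqrt (cmod (a n)) * (sqrt (cmod (a n)) * cmod (W n)))\<^sup>2
           \<le> (\<Sum>n\<in>J. (sqrt (cmod (a n)))\<^sup>2) * (\<Sum>n\<in>J. (sqrt (cmod (a n)) * cmod (W n))\<^sup>2)"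
          by (rule Cauchy_Schwarz_ineq_sum)
        then show ?thesis by (simp add: A_def power_mult_distrib flip: mult.assoc)
      qed
      have "A \<le> 16 * B'\<^sup>2 / (\<rho> * \<kappa>\<^sup>2) * s"
      proof (cases "A = 0")
        case True
        then show ?thesis using \<rho> real(1) by simp
      next
        case False
        have "(\<kappa> * A)\<^sup>2 \<le> (\<Sum>n\<in>J. cmod (a n) * cmod (W n))\<^sup>2"
          using W_sum \<kappa> A0 by (intro power_mono) auto
        also have "\<dots> \<le> A * (B'\<^sup>2 * R)"
          using cs quad A0 by (meson mult_left_mono order_trans)
        finally have "A * (\<kappa>\<^sup>2 * A) \<le> A * (B'\<^sup>2 * R)" by (simp add: power2_eq_square mult_ac)
        then have "\<kappa>\<^sup>2 * A \<le> B'\<^sup>2 * R" using False A0 by simp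
        also have "\<dots> = 8 * B'\<^sup>2 * s / \<rho> + (8 * B'\<^sup>2 * B ^ 4 * \<rho>) * (A / 2)"
          by (simp add: R_def algebra_simps power2_eq_square power4_eq_xxxx)
        also have "\<dots> \<le> 8 * B'\<^sup>2 * s / \<rho> + \<kappa>\<^sup>2 * (A / 2)"
          using \<rho>_small A0 by (intro add_left_mono mult_right_mono) auto
        finally have "\<kappa>\<^sup>2 * A \<le> 16 * B'\<^sup>2 * s / \<rho>" by simp
        then show ?thesis using \<kappa> \<rho> by (simp add: field_simps)
      qed
      then show ?thesis
        using real \<rho> by (simp add: ennreal_mult[symmetric] ennreal_leI)
    next
      case top
      then show ?thesis using \<rho> \<kappa> B' by (simp add: ennreal_mult_top)
    qed
    then show "ennreal (\<Sum>n | a n \<noteq> 0. cmod (a n)) \<le> ennreal (16 * B'\<^sup>2 / (\<rho> * \<kappa>\<^sup>2)) *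
        Linf_norm (PiM {..<4::nat} (\<lambda>_. m)) (\<lambda>t. \<Sum>n | a n \<noteq> 0. a n * (\<Prod>i<4::nat. \<psi> n (t i)))"
      by (simp add: S_def J_def A_def)
  qed
qed

section \<open>The equivalences\<close>

lemma Sidon_equivalences:
  assumes g: "iid_std_complex_gaussian P g" and m: "prob_space m"
    and psi: "bounded_in_Linf m \<psi>" and phi: "bounded_in_Linf m \<phi>" and bio: "biorthogonal m \<psi> \<phi>"
  shows "(randomly_Sidon P g m \<psi> \<longleftrightarrow> tensor_Sidon 4 m \<psi>) \<and>
         (randomly_Sidon P g m \<psi> \<longleftrightarrow> (\<exists>k\<ge>4. tensor_Sidon k m \<psi>)) \<and>
         (randomly_Sidon P g m \<psi> \<longleftrightarrow> (\<forall>k\<ge>4. tensor_Sidon k m \<psi>))"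
proof -
  have up: "tensor_Sidon k m \<psi>" if "4 \<le> k" "tensor_Sidon 4 m \<psi>" for k
    using that by (induction k rule: dec_induct) (auto intro: tensor_Sidon_Suc[OF m psi phi bio])
  have down: "randomly_Sidon P g m \<psi>" if "4 \<le> k" "tensor_Sidon k m \<psi>" for k
    using tensor_Sidon_imp_randomly_Sidon[OF g m psi, of "k - 1"] that by simp
  have start: "randomly_Sidon P g m \<psi> \<Longrightarrow> tensor_Sidon 4 m \<psi>"
    by (rule randomly_Sidon_imp_tensor_Sidon_4[OF g m psi phi bio])
  show ?thesis using up down start by (meson order_refl)
qed

theorem theorem2p7:
  fixes P :: "'w measure" and g :: "nat \<Rightarrow> 'w \<Rightarrow> complex"
    and m :: "'a measure" and \<psi> :: "nat \<Rightarrow> 'a \<Rightarrow> complex"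
  assumes "iid_std_complex_gaussian P g"
    and "prob_space m"
    and "bounded_in_Linf m \<psi>"
  shows "((\<exists>\<phi>. bounded_in_Linf m \<phi> \<and> biorthogonal m \<psi> \<phi>) \<longrightarrow>
            (randomly_Sidon P g m \<psi> \<longleftrightarrow> tensor_Sidon 4 m \<psi>) \<and>
            (randomly_Sidon P g m \<psi> \<longleftrightarrow> (\<exists>k\<ge>4. tensor_Sidon k m \<psi>)) \<and>
            (randomly_Sidon P g m \<psi> \<longleftrightarrow> (\<forall>k\<ge>4. tensor_Sidon k m \<psi>))) \<and>
         (orthonormal_system m \<psi> \<longrightarrow>
            (randomly_Sidon P g m \<psi> \<longleftrightarrow> tensor_Sidon 4 m \<psi>) \<and>
            (randomly_Sidon P g m \<psi> \<longleftrightarrow> (\<exists>k\<ge>4. tensor_Sidon k m \<psi>)) \<and>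
            (randomly_Sidon P g m \<psi> \<longleftrightarrow> (\<forall>k\<ge>4. tensor_Sidon k m \<psi>)))"
proof (intro conjI[of "_ \<longrightarrow> _"] impI)
  assume "\<exists>\<phi>. bounded_in_Linf m \<phi> \<and> biorthogonal m \<psi> \<phi>"
  then obtain \<phi> where "bounded_in_Linf m \<phi>" "biorthogonal m \<psi> \<phi>" by blast
  then show "(randomly_Sidon P g m \<psi> \<longleftrightarrow> tensor_Sidon 4 m \<psi>) \<and>
         (randomly_Sidon P g m \<psi> \<longleftrightarrow> (\<exists>k\<ge>4. tensor_Sidon k m \<psi>)) \<and>
         (randomly_Sidon P g m \<psi> \<longleftrightarrow> (\<forall>k\<ge>4. tensor_Sidon k m \<psi>))"
    by (rule Sidon_equivalences[OF assms])
next
  assume "orthonormal_system m \<psi>"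
  then have "biorthogonal m \<psi> \<psi>" by (simp add: orthonormal_system_def biorthogonal_def)
  then show "(randomly_Sidon P g m \<psi> \<longleftrightarrow> tensor_Sidon 4 m \<psi>) \<and>
         (randomly_Sidon P g m \<psi> \<longleftrightarrow> (\<exists>k\<ge>4. tensor_Sidon k m \<psi>)) \<and>
         (randomly_Sidon P g m \<psi> \<longleftrightarrow> (\<forall>k\<ge>4. tensor_Sidon k m \<psi>))"
    by (rule Sidon_equivalences[OF assms assms(3)])
qed

end
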